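(* Let $X$ be a separable Banach space. Then $X\in TNNS$ if and only if for some nonquasireflexive Banach space $Y$ there exists a surjective strictly singular operator $T:X\to Y$.
   Context: "Subspace" means closed linear subspace and "operator" means bounded linear operator. Let $X$ be a Banach space with dual $X^{*}$. A subspace $M\subset X^{*}$ is total if for every $0\neq x\in X$ there is $f\in M$ with $f(x)\neq 0$. A subspace $M\subset X^{*}$ is norming over a subspace $L\subset X$ if there is $c>0$ such that $\sup_{f\in S(M)}|f(x)|\ge c\|x\|$ for all $x\in L$, where $S(M)$ is the unit sphere of $M$. A subspace $M\subset X^{*}$ is nowhere norming if there is no infinite-dimensional subspace $L\subset X$ over which $M$ is norming. One writes $X\in TNNS$ if $X^{*}$ contains a total nowhere norming subspace. A Banach space is quasireflexive if its canonical image has finite codimension in its bidual; nonquasireflexive means not quasireflexive. An operator $T:X\to Y$ between Banach spaces is strictly singular if its restriction to any infinite-dimensional subspace of $X$ is not an isomorphism onto its image.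
   Formalization: X is additionally assumed infinite-dimensional: for finite-dimensional X the dual X* is total and vacuously nowhere norming, so X is in TNNS, yet X has no surjection onto a nonquasireflexive space, and the stated equivalence fails. *)

theory Defs
  imports "HOL-Analysis.Analysis"
begin

section \<open>Total and nowhere norming subspaces of the dual of a Banach space\<close>

text \<open>The space \<open>X\<close> is a type of class \<open>banach\<close>, and its dual is the type
  \<open>'a \<Rightarrow>\<^sub>L real\<close> with the operator norm.\<close>

definition closed_subspace :: "'a::real_normed_vector set \<Rightarrow> bool" where
  "closed_subspace L \<longleftrightarrow> subspace L \<and> closed L"

definition infinite_dimensional :: "'a::real_vector set \<Rightarrow> bool" where
  "infinite_dimensional L \<longleftrightarrow> \<not> (\<exists>B. finite B \<and> L \<subseteq> span B)"

definition total_subspace :: "('a::real_normed_vector \<Rightarrow>\<^sub>L real) set \<Rightarrow> bool" where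
  "total_subspace M \<longleftrightarrow> closed_subspace M \<and> (\<forall>x. x \<noteq> 0 \<longrightarrow> (\<exists>f\<in>M. blinfun_apply f x \<noteq> 0))"

text \<open>For \<open>M = {0}\<close> the unit sphere is empty and the supremum is an unspecified real constant,
  independent of \<open>x\<close>; it cannot dominate \<open>c * norm x\<close> on a nonzero subspace \<open>L\<close>, so \<open>{0}\<close> is
  norming over no nonzero subspace.\<close>

definition norming_over :: "('a::real_normed_vector \<Rightarrow>\<^sub>L real) set \<Rightarrow> 'a set \<Rightarrow> bool" where
  "norming_over M L \<longleftrightarrow>
     (\<exists>c>0. \<forall>x\<in>L. (SUP f \<in> M \<inter> sphere 0 1. \<bar>blinfun_apply f x\<bar>) \<ge> c * norm x)"

definition nowhere_norming :: "('a::real_normed_vector \<Rightarrow>\<^sub>L real) set \<Rightarrow> bool" where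
  "nowhere_norming M \<longleftrightarrow> closed_subspace M \<and>
     \<not> (\<exists>L. closed_subspace L \<and> infinite_dimensional L \<and> norming_over M L)"

definition TNNS :: "'a::banach itself \<Rightarrow> bool" where
  "TNNS _ \<longleftrightarrow> (\<exists>M :: ('a \<Rightarrow>\<^sub>L real) set. total_subspace M \<and> nowhere_norming M)"


section \<open>Banach spaces on a carrier set\<close>

text \<open>HOL cannot quantify over types inside a formula, so the existentially quantified space \<open>Y\<close>
  is a real normed space given by a carrier set and explicit operations; their values outside the
  carrier are irrelevant.\<close>

record 'v nspace =
  ncarrier :: "'v set"
  nzero :: 'v
  nadd :: "'v \<Rightarrow> 'v \<Rightarrow> 'v"
  nscale :: "real \<Rightarrow> 'v \<Rightarrow> 'v"
  nnorm :: "'v \<Rightarrow> real"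

locale normed_space_on =
  fixes V :: "'v nspace"
  assumes zero_closed: "nzero V \<in> ncarrier V"
    and add_closed: "\<lbrakk>x \<in> ncarrier V; y \<in> ncarrier V\<rbrakk> \<Longrightarrow> nadd V x y \<in> ncarrier V"
    and scale_closed: "x \<in> ncarrier V \<Longrightarrow> nscale V r x \<in> ncarrier V"
    and add_assoc: "\<lbrakk>x \<in> ncarrier V; y \<in> ncarrier V; z \<in> ncarrier V\<rbrakk>
        \<Longrightarrow> nadd V (nadd V x y) z = nadd V x (nadd V y z)"
    and add_commute: "\<lbrakk>x \<in> ncarrier V; y \<in> ncarrier V\<rbrakk> \<Longrightarrow> nadd V x y = nadd V y x"
    and add_zero: "x \<in> ncarrier V \<Longrightarrow> nadd V x (nzero V) = x"
    and add_inverse: "x \<in> ncarrier V \<Longrightarrow> nadd V x (nscale V (-1) x) = nzero V"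
    and scale_add_right: "\<lbrakk>x \<in> ncarrier V; y \<in> ncarrier V\<rbrakk>
        \<Longrightarrow> nscale V r (nadd V x y) = nadd V (nscale V r x) (nscale V r y)"
    and scale_add_left: "x \<in> ncarrier V
        \<Longrightarrow> nscale V (r + s) x = nadd V (nscale V r x) (nscale V s x)"
    and scale_scale: "x \<in> ncarrier V \<Longrightarrow> nscale V r (nscale V s x) = nscale V (r * s) x"
    and scale_one: "x \<in> ncarrier V \<Longrightarrow> nscale V 1 x = x"
    and norm_nonneg: "x \<in> ncarrier V \<Longrightarrow> 0 \<le> nnorm V x"
    and norm_eq_zero: "x \<in> ncarrier V \<Longrightarrow> nnorm V x = 0 \<longleftrightarrow> x = nzero V"
    and norm_triangle: "\<lbrakk>x \<in> ncarrier V; y \<in> ncarrier V\<rbrakk>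
        \<Longrightarrow> nnorm V (nadd V x y) \<le> nnorm V x + nnorm V y"
    and norm_scale: "x \<in> ncarrier V \<Longrightarrow> nnorm V (nscale V r x) = \<bar>r\<bar> * nnorm V x"

text \<open>The locale \<open>Metric_space\<close> demands nonnegativity and symmetry of the distance on the whole
  type, hence the value \<open>0\<close> off the carrier.\<close>

definition ndist :: "'v nspace \<Rightarrow> 'v \<Rightarrow> 'v \<Rightarrow> real" where
  "ndist V x y = (if x \<in> ncarrier V \<and> y \<in> ncarrier V then nnorm V (nadd V x (nscale V (-1) y)) else 0)"

definition banach_space_on :: "'v nspace \<Rightarrow> bool" where
  "banach_space_on V \<longleftrightarrow> normed_space_on V \<and> Metric_space.mcomplete (ncarrier V) (ndist V)"


section \<open>Dual, bidual and quasireflexivity\<close>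

text \<open>Functionals are taken extensional (\<open>undefined\<close> off the carrier), so that equality of
  functionals is equality on the carrier. The construction can be iterated.\<close>

definition bounded_linear_functionals :: "'v nspace \<Rightarrow> ('v \<Rightarrow> real) set" where
  "bounded_linear_functionals V =
     {f \<in> extensional (ncarrier V).
        (\<forall>x\<in>ncarrier V. \<forall>y\<in>ncarrier V. f (nadd V x y) = f x + f y) \<and>
        (\<forall>r. \<forall>x\<in>ncarrier V. f (nscale V r x) = r * f x) \<and>
        (\<exists>K. \<forall>x\<in>ncarrier V. \<bar>f x\<bar> \<le> K * nnorm V x)}"

definition dual :: "'v nspace \<Rightarrow> ('v \<Rightarrow> real) nspace" where
  "dual V =
     \<lparr> ncarrier = bounded_linear_functionals V,
       nzero = (\<lambda>x\<in>ncarrier V. 0),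
       nadd = (\<lambda>f g. \<lambda>x\<in>ncarrier V. f x + g x),
       nscale = (\<lambda>r f. \<lambda>x\<in>ncarrier V. r * f x),
       nnorm = (\<lambda>f. SUP x \<in> {x \<in> ncarrier V. nnorm V x \<le> 1}. \<bar>f x\<bar>) \<rparr>"

definition canonical_embedding :: "'v nspace \<Rightarrow> 'v \<Rightarrow> (('v \<Rightarrow> real) \<Rightarrow> real)" where
  "canonical_embedding V x = (\<lambda>f\<in>ncarrier (dual V). f x)"

text \<open>A set \<open>W\<close> of functionals has finite codimension in \<open>dual V\<close> if finitely many functionals
  span \<open>dual V\<close> modulo \<open>W\<close>; the vector operations of \<open>dual V\<close> are pointwise on the carrier
  of \<open>V\<close>.\<close>

definition finite_codimension_in_dual :: "('v \<Rightarrow> real) set \<Rightarrow> 'v nspace \<Rightarrow> bool" where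
  "finite_codimension_in_dual W V \<longleftrightarrow>
     (\<exists>B. finite B \<and> B \<subseteq> ncarrier (dual V) \<and>
        (\<forall>\<phi>\<in>ncarrier (dual V). \<exists>w\<in>W. \<exists>c :: ('v \<Rightarrow> real) \<Rightarrow> real.
            \<forall>x\<in>ncarrier V. \<phi> x = w x + (\<Sum>b\<in>B. c b * b x)))"

definition quasireflexive :: "'v nspace \<Rightarrow> bool" where
  "quasireflexive V \<longleftrightarrow>
     finite_codimension_in_dual (canonical_embedding V ` ncarrier V) (dual V)"


section \<open>Strictly singular operators\<close>

definition bounded_operator :: "'v nspace \<Rightarrow> ('a::real_normed_vector \<Rightarrow> 'v) \<Rightarrow> bool" where
  "bounded_operator Y T \<longleftrightarrow>
     (\<forall>x. T x \<in> ncarrier Y) \<and>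
     (\<forall>x y. T (x + y) = nadd Y (T x) (T y)) \<and>
     (\<forall>r x. T (r *\<^sub>R x) = nscale Y r (T x)) \<and>
     (\<exists>K. \<forall>x. nnorm Y (T x) \<le> K * norm x)"

text \<open>For a bounded operator \<open>T\<close>: the restriction to \<open>L\<close> is injective and its inverse
  \<open>T ` L \<rightarrow> L\<close> is bounded.\<close>

definition isomorphism_onto_image ::
  "'v nspace \<Rightarrow> ('a::real_normed_vector \<Rightarrow> 'v) \<Rightarrow> 'a set \<Rightarrow> bool" where
  "isomorphism_onto_image Y T L \<longleftrightarrow>
     inj_on T L \<and> (\<exists>K. \<forall>y \<in> T ` L. norm (the_inv_into L T y) \<le> K * nnorm Y y)"

definition strictly_singular :: "'v nspace \<Rightarrow> ('a::real_normed_vector \<Rightarrow> 'v) \<Rightarrow> bool" where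
  "strictly_singular Y T \<longleftrightarrow> bounded_operator Y T \<and>
     (\<forall>L. closed_subspace L \<and> infinite_dimensional L \<longrightarrow> \<not> isomorphism_onto_image Y T L)"

end

theory Submission
  imports Defs
begin

text \<open>
  Both directions are carried out on \<open>X\<close> itself: a surjection \<open>T : X \<rightarrow> Y\<close> is the seminorm
  \<open>q x = \<parallel>T x\<parallel>\<close>, the dual of \<open>Y\<close> is the set of functionals dominated by \<open>q\<close>, and \<open>Y\<close> is
  quasireflexive iff the functionals on \<open>X*\<close> that agree with a point of \<open>X\<close> on this set have finite
  codimension in \<open>X**\<close>.

  Let \<open>M\<close> be total and nowhere norming, with dual seminorm \<open>\<parallel>x\<parallel>\<^sub>M\<close>. On no subspace of finite
  codimension is \<open>\<parallel>x\<parallel>\<^sub>M\<close> equivalent to the norm, so by Hahn-Banach and the open mapping argument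
  there are functionals \<open>\<gamma>\<close> of arbitrarily small norm that are bounded for \<open>\<parallel>x\<parallel>\<^sub>M\<close>
  and satisfy \<open>\<gamma> x = 1\<close> for some \<open>x\<close> with \<open>\<parallel>x\<parallel>\<^sub>M \<le> 1\<close> in a prescribed subspace of finite
  codimension. Choose such pairs \<open>(\<gamma>\<^sub>k, x\<^sub>k)\<close> inductively, with the norms of the \<open>\<gamma>\<^sub>k\<close> summable,
  together with bounded sequences in \<open>M\<close> which converge to \<open>\<gamma>\<^sub>k\<close> and
  interpolate it on larger and larger finite sets. The differences span a space \<open>Z\<close> for which
  \<open>X \<rightarrow> Z*\<close> has closed range. Evaluation at \<open>x\<^sub>k\<close> bounds the \<open>\<gamma>\<^sub>k\<close>-coordinates on \<open>Z\<close>, so the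
  seminorm of \<open>Z\<close> is dominated by \<open>\<parallel>x\<parallel>\<^sub>M\<close> plus a nuclear term and the quotient map is strictly
  singular; these coordinates also yield independent elements of the bidual of the quotient
  modulo the quotient itself.

  Conversely, if \<open>N\<close> is the dual of \<open>Y\<close> in \<open>X*\<close>, the required subspace is the closure of
  \<open>{f + (\<Sum>k. \<delta>\<^sub>k \<Psi>\<^sub>k(f) g\<^sub>k) | f \<in> N}\<close>: the \<open>g\<^sub>k\<close> are a total sequence in \<open>X*\<close>, the \<open>\<Psi>\<^sub>k\<close>
  are triangular with respect to functionals annihilating \<open>Y\<close> in \<open>Y**\<close>, which gives totality, and
  the perturbation is nuclear, so it does not affect strict singularity.
\<close>

section \<open>Finitely many linear functionals\<close>

text \<open>Induction on \<open>I\<close>: if some \<open>u\<close> in \<open>S\<close> is killed by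
  the other functionals but not by \<open>\<phi> j\<close>, subtracting \<open>t\<close> times
  \<open>\<phi> j\<close> makes \<open>h\<close> vanish on the kernel of the others; otherwise
  \<open>\<phi> j\<close> gets coefficient 0.\<close>

lemma common_kernel_combination:
  fixes \<phi> :: "'i \<Rightarrow> 'v::real_vector \<Rightarrow> real"
  assumes "finite I" "subspace S" "\<And>i. i \<in> I \<Longrightarrow> linear (\<phi> i)" "linear h"
    and "\<And>v. \<lbrakk>v \<in> S; \<forall>i\<in>I. \<phi> i v = 0\<rbrakk> \<Longrightarrow> h v = 0"
  shows "\<exists>c. \<forall>v\<in>S. h v = (\<Sum>i\<in>I. c i * \<phi> i v)"
  using assms
proof (induction I arbitrary: h rule: finite_induct)
  case empty
  then show ?case by auto
next
  case (insert j I)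
  show ?case
  proof (cases "\<exists>u\<in>S. (\<forall>i\<in>I. \<phi> i u = 0) \<and> \<phi> j u \<noteq> 0")
    case True
    then obtain u where u: "u \<in> S" "\<forall>i\<in>I. \<phi> i u = 0" "\<phi> j u \<noteq> 0" by blast
    define t where "t = h u / \<phi> j u"
    have lj: "linear (\<phi> j)" using insert.prems by auto
    have "\<exists>c. \<forall>v\<in>S. h v - t * \<phi> j v = (\<Sum>i\<in>I. c i * \<phi> i v)"
    proof (rule insert.IH)
      show "linear (\<lambda>v. h v - t * \<phi> j v)"
        using lj insert.prems(3) by (auto simp: linear_iff algebra_simps)
      fix v assume v: "v \<in> S" "\<forall>i\<in>I. \<phi> i v = 0"
      let ?w = "v - (\<phi> j v / \<phi> j u) *\<^sub>R u"
      have "h ?w = 0"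
      proof (rule insert.prems(4))
        show "?w \<in> S" using v u insert.prems(1) by (simp add: subspace_diff subspace_scale)
        show "\<forall>i\<in>insert j I. \<phi> i ?w = 0"
          using v u insert.prems(2) by (auto simp: linear_diff linear_scale)
      qed
      then show "h v - t * \<phi> j v = 0"
        using insert.prems(3) u by (simp add: linear_diff linear_scale t_def)
    qed (use insert.prems in auto)
    then obtain c where c: "\<forall>v\<in>S. h v - t * \<phi> j v = (\<Sum>i\<in>I. c i * \<phi> i v)" by blast
    have "h v = (\<Sum>i\<in>insert j I. (c(j := t)) i * \<phi> i v)" if "v \<in> S" for v
    proof -
      have "(\<Sum>i\<in>I. (c(j := t)) i * \<phi> i v) = (\<Sum>i\<in>I. c i * \<phi> i v)"
        using insert.hyps by (intro sum.cong) auto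
      then show ?thesis using c that insert.hyps by (simp add: algebra_simps)
    qed
    then show ?thesis by blast
  next
    case False
    have "\<exists>c. \<forall>v\<in>S. h v = (\<Sum>i\<in>I. c i * \<phi> i v)"
      using False insert.prems by (intro insert.IH) auto
    then obtain c where c: "\<forall>v\<in>S. h v = (\<Sum>i\<in>I. c i * \<phi> i v)" by blast
    have "h v = (\<Sum>i\<in>insert j I. (c(j := 0)) i * \<phi> i v)" if "v \<in> S" for v
    proof -
      have "(\<Sum>i\<in>I. (c(j := 0)) i * \<phi> i v) = (\<Sum>i\<in>I. c i * \<phi> i v)"
        using insert.hyps by (intro sum.cong) auto
      then show ?thesis using c that insert.hyps by (simp add: algebra_simps)
    qed
    then show ?thesis by blast
  qed
qed

text \<open>A solution for \<open>I\<close> is corrected along a vector killed by \<open>I\<close>.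
  If \<open>\<phi> j\<close> vanishes on all such vectors, it depends on the others, and the last
  hypothesis forces the right value.\<close>

lemma consistent_system_solvable:
  fixes \<phi> :: "'i \<Rightarrow> 'v::real_vector \<Rightarrow> real"
  assumes "finite I" "subspace S" "\<And>i. i \<in> I \<Longrightarrow> linear (\<phi> i)"
    and "\<And>l. \<forall>v\<in>S. (\<Sum>i\<in>I. l i * \<phi> i v) = 0 \<Longrightarrow> (\<Sum>i\<in>I. l i * c i) = 0"
  shows "\<exists>v\<in>S. \<forall>i\<in>I. \<phi> i v = c i"
  using assms
proof (induction I rule: finite_induct)
  case empty
  then show ?case using subspace_0 by auto
next
  case (insert j I)
  have upd: "(\<Sum>i\<in>I. (l(j := t)) i * f i) = (\<Sum>i\<in>I. l i * f i)" for l t and f :: "'i \<Rightarrow> real"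
    using insert.hyps by (intro sum.cong) auto
  have "\<exists>v\<in>S. \<forall>i\<in>I. \<phi> i v = c i"
  proof (rule insert.IH)
    fix l assume "\<forall>v\<in>S. (\<Sum>i\<in>I. l i * \<phi> i v) = 0"
    then have "(\<Sum>i\<in>insert j I. (l(j := 0)) i * c i) = 0"
      using insert.hyps upd by (intro insert.prems(3)) simp
    then show "(\<Sum>i\<in>I. l i * c i) = 0" using insert.hyps upd by simp
  qed (use insert.prems in auto)
  then obtain v where v: "v \<in> S" "\<forall>i\<in>I. \<phi> i v = c i" by blast
  show ?case
  proof (cases "\<exists>u\<in>S. (\<forall>i\<in>I. \<phi> i u = 0) \<and> \<phi> j u \<noteq> 0")
    case True
    then obtain u where u: "u \<in> S" "\<forall>i\<in>I. \<phi> i u = 0" "\<phi> j u \<noteq> 0" by blast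
    let ?w = "v + ((c j - \<phi> j v) / \<phi> j u) *\<^sub>R u"
    have "?w \<in> S" using u v insert.prems(1) by (simp add: subspace_add subspace_scale)
    moreover have "\<forall>i\<in>insert j I. \<phi> i ?w = c i"
      using u v insert.prems(2) by (auto simp: linear_add linear_scale)
    ultimately show ?thesis by blast
  next
    case False
    have "\<exists>d. \<forall>v\<in>S. \<phi> j v = (\<Sum>i\<in>I. d i * \<phi> i v)"
      using False insert.prems insert.hyps by (intro common_kernel_combination) auto
    then obtain d where d: "\<forall>v\<in>S. \<phi> j v = (\<Sum>i\<in>I. d i * \<phi> i v)" by blast
    have "(\<Sum>i\<in>insert j I. (d(j := -1)) i * c i) = 0"
      using insert.hyps upd d by (intro insert.prems(3)) simp
    then have "c j = (\<Sum>i\<in>I. d i * c i)" using insert.hyps upd by simp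
    also have "\<dots> = \<phi> j v" using v d by simp
    finally show ?thesis using v by auto
  qed
qed

text \<open>The common kernel has finite codimension in \<open>L\<close>: each functional that is
  not zero on the kernel of the preceding ones contributes one vector to \<open>B\<close>.\<close>

lemma common_kernel_complement:
  fixes \<phi> :: "'i \<Rightarrow> 'v::real_vector \<Rightarrow> real"
  assumes "finite I" "subspace L" "\<And>i. i \<in> I \<Longrightarrow> linear (\<phi> i)"
  shows "\<exists>B. finite B \<and> B \<subseteq> L \<and> (\<forall>v\<in>L. \<exists>b\<in>span B. \<forall>i\<in>I. \<phi> i (v - b) = 0)"
  using assms
proof (induction I rule: finite_induct)
  case empty
  then show ?case by (intro exI[of _ "{}"]) auto
next
  case (insert j I)
  then obtain B where B: "finite B" "B \<subseteq> L" "\<forall>v\<in>L. \<exists>b\<in>span B. \<forall>i\<in>I. \<phi> i (v - b) = 0" by auto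
  have sB: "span B \<subseteq> L" using B insert.prems(1) by (simp add: span_minimal)
  show ?case
  proof (cases "\<exists>u\<in>L. (\<forall>i\<in>I. \<phi> i u = 0) \<and> \<phi> j u \<noteq> 0")
    case True
    then obtain u where u: "u \<in> L" "\<forall>i\<in>I. \<phi> i u = 0" "\<phi> j u \<noteq> 0" by blast
    have "\<exists>b\<in>span (insert u B). \<forall>i\<in>insert j I. \<phi> i (v - b) = 0" if v: "v \<in> L" for v
    proof -
      obtain b where b: "b \<in> span B" "\<forall>i\<in>I. \<phi> i (v - b) = 0" using B v by blast
      let ?b = "b + (\<phi> j (v - b) / \<phi> j u) *\<^sub>R u"
      have "?b \<in> span (insert u B)"
        using b span_mono[of B "insert u B"]
        by (intro span_add span_scale) (auto simp: span_base)
      moreover have "\<forall>i\<in>insert j I. \<phi> i (v - ?b) = 0"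
        using b u insert.prems(2) by (auto simp: linear_add linear_diff linear_scale)
      ultimately show ?thesis by blast
    qed
    then show ?thesis using B u by (intro exI[of _ "insert u B"]) auto
  next
    case False
    have "\<exists>b\<in>span B. \<forall>i\<in>insert j I. \<phi> i (v - b) = 0" if v: "v \<in> L" for v
    proof -
      obtain b where b: "b \<in> span B" "\<forall>i\<in>I. \<phi> i (v - b) = 0" using B v by blast
      moreover have "v - b \<in> L" using v b sB insert.prems(1) by (auto intro: subspace_diff)
      ultimately show ?thesis using False by blast
    qed
    then show ?thesis using B by blast
  qed
qed

lemma infinite_dimensional_Int_kernels:
  fixes \<phi> :: "'i \<Rightarrow> 'v::real_vector \<Rightarrow> real"
  assumes "finite I" "subspace L" "\<And>i. i \<in> I \<Longrightarrow> linear (\<phi> i)" "infinite_dimensional L"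
  shows "infinite_dimensional (L \<inter> {v. \<forall>i\<in>I. \<phi> i v = 0})"
  unfolding infinite_dimensional_def
proof
  assume "\<exists>C. finite C \<and> L \<inter> {v. \<forall>i\<in>I. \<phi> i v = 0} \<subseteq> span C"
  then obtain C where C: "finite C" "L \<inter> {v. \<forall>i\<in>I. \<phi> i v = 0} \<subseteq> span C" by blast
  obtain B where B: "finite B" "B \<subseteq> L" "\<forall>v\<in>L. \<exists>b\<in>span B. \<forall>i\<in>I. \<phi> i (v - b) = 0"
    using common_kernel_complement[of I L \<phi>] assms by blast
  have sB: "span B \<subseteq> L" using B assms(2) by (simp add: span_minimal)
  have "L \<subseteq> span (C \<union> B)"
  proof
    fix v assume v: "v \<in> L"
    obtain b where b: "b \<in> span B" "\<forall>i\<in>I. \<phi> i (v - b) = 0" using B v by blast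
    then have "v - b \<in> span C" using C v sB assms(2) by (auto intro: subspace_diff)
    then have "(v - b) + b \<in> span (C \<union> B)"
      using b span_mono[of C "C \<union> B"] span_mono[of B "C \<union> B"] by (intro span_add) auto
    then show "v \<in> span (C \<union> B)" by simp
  qed
  then show False using assms(4) C B unfolding infinite_dimensional_def by blast
qed

text \<open>There is one index more than \<open>card B\<close>. Dependence is a property of sets, so
  a repetition among the \<open>b k\<close> needs its own combination, with coefficients 1 and
  -1.\<close>

lemma nontrivial_vanishing_combination:
  fixes b :: "nat \<Rightarrow> 'v::real_vector"
  assumes B: "finite B" and b: "\<And>k. b k \<in> span B"
  shows "\<exists>t. (\<exists>k\<le>card B. t k \<noteq> 0) \<and> (\<Sum>k\<le>card B. t k *\<^sub>R b k) = 0"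
proof (cases "inj_on b {..card B}")
  case True
  have "dependent (b ` {..card B})"
  proof (rule ccontr)
    assume "\<not> dependent (b ` {..card B})"
    then have "card (b ` {..card B}) \<le> card B"
      using b by (intro conjunct2[OF independent_span_bound[OF B]]) auto
    then show False using True by (simp add: card_image)
  qed
  then obtain u where u: "\<exists>v\<in>b ` {..card B}. u v \<noteq> 0" "(\<Sum>v\<in>b ` {..card B}. u v *\<^sub>R v) = 0"
    by (subst (asm) dependent_finite) auto
  then show ?thesis using True by (intro exI[of _ "\<lambda>k. u (b k)"]) (auto simp: sum.reindex)
next
  case False
  then obtain i j where ij: "i \<le> card B" "j \<le> card B" "i \<noteq> j" "b i = b j"
    by (auto simp: inj_on_def)
  let ?t = "\<lambda>k. if k = i then 1 else if k = j then - 1 else 0 :: real"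
  have "(\<Sum>k\<le>card B. ?t k *\<^sub>R b k) = (\<Sum>k\<le>card B. (if k = i then b i else 0) - (if k = j then b j else 0))"
    using ij by (intro sum.cong) auto
  also have "\<dots> = 0" using ij by (simp add: sum_subtractf)
  finally show ?thesis using ij by (intro exI[of _ ?t]) auto
qed

section \<open>The Hahn-Banach theorem\<close>

definition seminorm :: "('v::real_vector \<Rightarrow> real) \<Rightarrow> bool" where
  "seminorm P \<longleftrightarrow> (\<forall>x y. P (x + y) \<le> P x + P y) \<and> (\<forall>r x. P (r *\<^sub>R x) = \<bar>r\<bar> * P x)"

lemma seminormI:
  assumes "\<And>x y. P (x + y) \<le> P x + P y" "\<And>r x. P (r *\<^sub>R x) = \<bar>r\<bar> * P x"
  shows "seminorm P"
  using assms by (simp add: seminorm_def)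

lemma seminorm_add: "seminorm P \<Longrightarrow> P (x + y) \<le> P x + P y"
  and seminorm_scale: "seminorm P \<Longrightarrow> P (r *\<^sub>R x) = \<bar>r\<bar> * P x"
  by (simp_all add: seminorm_def)

lemma seminorm_zero: "seminorm P \<Longrightarrow> P 0 = 0"
  using seminorm_scale[of P 0 0] by simp

lemma seminorm_minus: "seminorm P \<Longrightarrow> P (- x) = P x"
  using seminorm_scale[of P "-1" x] by simp

lemma seminorm_diff: "seminorm P \<Longrightarrow> P (x - y) \<le> P x + P y"
  using seminorm_add[of P x "- y"] seminorm_minus[of P y] by simp

lemma seminorm_commute: "seminorm P \<Longrightarrow> P (x - y) = P (y - x)"
  using seminorm_minus[of P "x - y"] by simp

lemma seminorm_nonneg: "seminorm P \<Longrightarrow> 0 \<le> P x"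
  using seminorm_diff[of P x x] seminorm_zero[of P] by simp

lemma seminorm_triangle: "seminorm P \<Longrightarrow> P (x - z) \<le> P (x - y) + P (y - z)"
  using seminorm_add[of P "x - y" "y - z"] by simp

lemma seminorm_le_shift: "seminorm P \<Longrightarrow> P x \<le> P y + P (x - y)"
  using seminorm_add[of P "y" "x - y"] by simp

lemma seminorm_norm: "seminorm (norm :: 'v::real_normed_vector \<Rightarrow> real)"
  by (rule seminormI) (auto simp: norm_triangle_ineq)

text \<open>A partial functional is encoded by its graph; adjoining \<open>(z, c)\<close> extends it
  to \<open>z\<close> with value \<open>c\<close>.\<close>

lemma linear_graph_extension_step:
  fixes P :: "'v::real_vector \<Rightarrow> real"
  assumes P: "seminorm P" and G: "subspace G" and dom: "\<forall>(x, a)\<in>G. a \<le> P x"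
  shows "\<exists>c. \<forall>(x, a)\<in>span (insert (z, c) G). a \<le> P x"
proof -
  have G0: "(0, 0) \<in> G" using subspace_0[OF G] by (simp add: zero_prod_def)
  define A where "A = {a - P (x - z) | x a. (x, a) \<in> G}"
  have ub: "a - P (x - z) \<le> P (y + z) - b" if "(x, a) \<in> G" "(y, b) \<in> G" for x a y b
  proof -
    have "(x + y, a + b) \<in> G" using subspace_add[OF G that] by simp
    then have "a + b \<le> P (x + y)" using dom by blast
    also have "\<dots> \<le> P (x - z) + P (y + z)"
      using seminorm_add[OF P, of "x - z" "y + z"] by (simp add: algebra_simps)
    finally show ?thesis by simp
  qed
  \<comment> \<open>Domination confines \<open>c\<close> to the interval between all
    \<open>a - P (x - z)\<close> and all \<open>P (y + z) - b\<close>, nonempty by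
    \<open>ub\<close>; the supremum of the lower ends lies in it.\<close>
  define c where "c = Sup A"
  have ne: "A \<noteq> {}" using G0 unfolding A_def by blast
  have bdd: "bdd_above A" unfolding A_def bdd_above_def using ub[OF _ G0] by blast
  have lo: "a - P (x - z) \<le> c" if "(x, a) \<in> G" for x a
    unfolding c_def using that bdd by (intro cSup_upper) (auto simp: A_def)
  have hi: "c \<le> P (y + z) - b" if "(y, b) \<in> G" for y b
    unfolding c_def using that ub ne by (intro cSup_least) (auto simp: A_def)
  have "a \<le> P x" if xa: "(x, a) \<in> span (insert (z, c) G)" for x a
  proof -
    obtain t where t: "(x, a) - t *\<^sub>R (z, c) \<in> G"
      using xa unfolding span_insert span_eq_iff[THEN iffD2, OF G] by blast
    then have t': "(x - t *\<^sub>R z, a - t * c) \<in> G" by simp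
    consider "t = 0" | "t > 0" | "t < 0" by linarith
    then show ?thesis
    proof cases
      case 1
      then show ?thesis using t' dom by auto
    next
      case 2
      have "(1 / t) *\<^sub>R (x - t *\<^sub>R z, a - t * c) \<in> G" using t' subspace_scale[OF G] by blast
      then have "((1 / t) *\<^sub>R x - z, a / t - c) \<in> G" using 2 by (simp add: algebra_simps diff_divide_distrib)
      from hi[OF this] have "a / t \<le> P ((1 / t) *\<^sub>R x)" by simp
      then show ?thesis using 2 seminorm_scale[OF P, of "1 / t" x] by (simp add: divide_simps)
    next
      case 3
      have "(- 1 / t) *\<^sub>R (x - t *\<^sub>R z, a - t * c) \<in> G" using t' subspace_scale[OF G] by blast
      then have "((- 1 / t) *\<^sub>R x + z, - a / t + c) \<in> G"
        using 3 by (simp add: algebra_simps diff_divide_distrib)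
      from lo[OF this] have "- a / t \<le> P ((- 1 / t) *\<^sub>R x)" by simp
      then show ?thesis using 3 seminorm_scale[OF P, of "- 1 / t" x]
        by (simp add: divide_simps)
    qed
  qed
  then show ?thesis by blast
qed

text \<open>Domination by a seminorm makes the graph \<open>G\<close> single-valued.\<close>

theorem Hahn_Banach_graph:
  fixes P :: "'v::real_vector \<Rightarrow> real"
  assumes P: "seminorm P" and G: "subspace G" and dom: "\<And>x a. (x, a) \<in> G \<Longrightarrow> a \<le> P x"
  shows "\<exists>F. linear F \<and> (\<forall>(x, a)\<in>G. F x = a) \<and> (\<forall>x. \<bar>F x\<bar> \<le> P x)"
proof -
  \<comment> \<open>Zorn's lemma is applied to the dominated graphs containing \<open>G\<close>; by
    the extension step a maximal one has full domain.\<close>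
  define \<A> where "\<A> = {H. G \<subseteq> H \<and> subspace H \<and> (\<forall>(x, a)\<in>H. a \<le> P x)}"
  have "\<exists>H\<in>\<A>. \<forall>X\<in>\<A>. H \<subseteq> X \<longrightarrow> X = H"
  proof (rule subset_Zorn_nonempty)
    show "\<A> \<noteq> {}" using G dom unfolding \<A>_def by blast
    fix \<C> assume ne: "\<C> \<noteq> {}" and ch: "subset.chain \<A> \<C>"
    have sub: "\<C> \<subseteq> \<A>" and tot: "\<And>X Y. X \<in> \<C> \<Longrightarrow> Y \<in> \<C> \<Longrightarrow> X \<subseteq> Y \<or> Y \<subseteq> X"
      using ch by (auto simp: subset.chain_def)
    have "subspace (\<Union>\<C>)"
    proof (rule subspaceI)
      show "0 \<in> \<Union>\<C>" using ne sub subspace_0 unfolding \<A>_def by blast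
      show "x + y \<in> \<Union>\<C>" if xy: "x \<in> \<Union>\<C>" "y \<in> \<Union>\<C>" for x y
      proof -
        obtain X Y where XY: "X \<in> \<C>" "x \<in> X" "Y \<in> \<C>" "y \<in> Y" using xy by blast
        define Z where "Z = (if X \<subseteq> Y then Y else X)"
        have "Z \<in> \<C>" "x \<in> Z" "y \<in> Z" using tot[of X Y] XY by (auto simp: Z_def)
        moreover from this have "subspace Z" using sub by (auto simp: \<A>_def)
        ultimately show ?thesis using subspace_add by blast
      qed
      show "r *\<^sub>R x \<in> \<Union>\<C>" if x: "x \<in> \<Union>\<C>" for r x
      proof -
        obtain X where X: "X \<in> \<C>" "x \<in> X" using x by blast
        moreover from this have "subspace X" using sub by (auto simp: \<A>_def)
        ultimately show ?thesis using subspace_scale by blast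
      qed
    qed
    moreover have "G \<subseteq> \<Union>\<C>" using ne sub by (auto simp: \<A>_def)
    moreover have "\<forall>(x, a)\<in>\<Union>\<C>. a \<le> P x" using sub unfolding \<A>_def by blast
    ultimately show "\<Union>\<C> \<in> \<A>" by (simp add: \<A>_def)
  qed
  then obtain H where H: "H \<in> \<A>" and max: "\<And>X. X \<in> \<A> \<Longrightarrow> H \<subseteq> X \<Longrightarrow> X = H" by blast
  have HG: "G \<subseteq> H" and Hs: "subspace H" and Hd: "\<And>x a. (x, a) \<in> H \<Longrightarrow> a \<le> P x"
    using H by (auto simp: \<A>_def)
  have ex: "\<exists>a. (z, a) \<in> H" for z
  proof -
    obtain c where c: "\<forall>(x, a)\<in>span (insert (z, c) H). a \<le> P x"
      using linear_graph_extension_step[OF P Hs, of z] Hd by auto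
    have sub: "insert (z, c) H \<subseteq> span (insert (z, c) H)" by (rule span_superset)
    have "span (insert (z, c) H) \<in> \<A>" using HG sub c by (auto simp: \<A>_def)
    then have "span (insert (z, c) H) = H" using sub by (intro max) auto
    then show ?thesis using sub by auto
  qed
  \<comment> \<open>The difference of two values at \<open>z\<close> is a value at 0, hence at most
    \<open>P 0 = 0\<close>; exchanging the two gives equality.\<close>
  have uniq: "a = b" if "(z, a) \<in> H" "(z, b) \<in> H" for z a b
  proof -
    have "a' - b' \<le> 0" if "(z, a') \<in> H" "(z, b') \<in> H" for a' b'
      using Hd[of 0 "a' - b'"] subspace_diff[OF Hs that] seminorm_zero[OF P] by simp
    then show ?thesis using that by (meson antisym diff_le_0_iff_le)
  qed
  define F where "F z = (THE a. (z, a) \<in> H)" for z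
  have FH: "(z, F z) \<in> H" for z unfolding F_def using ex[of z] uniq by (rule_tac theI') blast
  have FI: "F z = a" if "(z, a) \<in> H" for z a using uniq[OF FH that] .
  have "linear F"
  proof (rule linearI)
    show "F (x + y) = F x + F y" for x y using subspace_add[OF Hs FH[of x] FH[of y]] by (intro FI) simp
    show "F (r *\<^sub>R x) = r *\<^sub>R F x" for r x using subspace_scale[OF Hs FH[of x], of r] by (intro FI) simp
  qed
  moreover have "\<bar>F x\<bar> \<le> P x" for x
    using Hd[OF FH, of x] Hd[OF FH, of "- x"] linear_neg[OF \<open>linear F\<close>, of x] seminorm_minus[OF P, of x]
    by auto
  ultimately show ?thesis using HG FI by blast
qed

lemma Hahn_Banach_extension:
  fixes P :: "'v::real_vector \<Rightarrow> real"
  assumes "seminorm P" "subspace L" "linear f" "\<And>x. x \<in> L \<Longrightarrow> \<bar>f x\<bar> \<le> P x"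
  shows "\<exists>F. linear F \<and> (\<forall>x\<in>L. F x = f x) \<and> (\<forall>x. \<bar>F x\<bar> \<le> P x)"
proof -
  have "\<exists>F. linear F \<and> (\<forall>(x, a)\<in>{(x, f x) | x. x \<in> L}. F x = a) \<and> (\<forall>x. \<bar>F x\<bar> \<le> P x)"
  proof (rule Hahn_Banach_graph[OF assms(1)])
    show "subspace {(x, f x) | x. x \<in> L}"
      using assms(2,3)
      by (auto simp: subspace_def zero_prod_def linear_0 linear_add linear_scale)
  qed (use assms(4) in force)
  then show ?thesis by auto
qed

text \<open>The functional with value \<open>t * d\<close> at \<open>j + t *\<^sub>R v\<close> is
  dominated, because for \<open>t \<noteq> 0\<close> the seminorm of this vector is
  \<open>\<bar>t\<bar>\<close> times that of \<open>v\<close> minus a point of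
  \<open>J\<close>.\<close>

lemma Hahn_Banach_distance:
  fixes P :: "'v::real_vector \<Rightarrow> real"
  assumes P: "seminorm P" and J: "subspace J" and d: "\<And>j. j \<in> J \<Longrightarrow> d \<le> P (v - j)" and "0 \<le> d"
  shows "\<exists>F. linear F \<and> (\<forall>x. \<bar>F x\<bar> \<le> P x) \<and> (\<forall>j\<in>J. F j = 0) \<and> F v = d"
proof -
  let ?G = "{(j + t *\<^sub>R v, t * d) | j t. j \<in> J}"
  have "\<exists>F. linear F \<and> (\<forall>(x, a)\<in>?G. F x = a) \<and> (\<forall>x. \<bar>F x\<bar> \<le> P x)"
  proof (rule Hahn_Banach_graph[OF P])
    show "subspace ?G"
    proof (rule subspaceI)
      show "0 \<in> ?G" using subspace_0[OF J] by (force simp: zero_prod_def)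
      show "x + y \<in> ?G" if xy: "x \<in> ?G" "y \<in> ?G" for x y
      proof -
        obtain j t i s where "j \<in> J" "i \<in> J" "x = (j + t *\<^sub>R v, t * d)" "y = (i + s *\<^sub>R v, s * d)"
          using xy by blast
        then have "x + y = ((j + i) + (t + s) *\<^sub>R v, (t + s) * d)" "j + i \<in> J"
          using subspace_add[OF J] by (auto simp: algebra_simps)
        then show ?thesis by blast
      qed
      show "r *\<^sub>R x \<in> ?G" if x: "x \<in> ?G" for r x
      proof -
        obtain j t where "j \<in> J" "x = (j + t *\<^sub>R v, t * d)" using x by blast
        then have "r *\<^sub>R x = (r *\<^sub>R j + (r * t) *\<^sub>R v, (r * t) * d)" "r *\<^sub>R j \<in> J"
          using subspace_scale[OF J] by (auto simp: algebra_simps)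
        then show ?thesis by blast
      qed
    qed
    show "a \<le> P x" if xa: "(x, a) \<in> ?G" for x a
    proof -
      obtain j t where jt: "j \<in> J" "x = j + t *\<^sub>R v" "a = t * d" using xa by blast
      show ?thesis
      proof (cases "t = 0")
        case True
        then show ?thesis using jt seminorm_nonneg[OF P] by simp
      next
        case False
        have "(- 1 / t) *\<^sub>R j \<in> J" using jt subspace_scale[OF J] by blast
        then have "d \<le> P (v - (- 1 / t) *\<^sub>R j)" by (rule d)
        also have "v - (- 1 / t) *\<^sub>R j = (1 / t) *\<^sub>R x" using jt False by (simp add: algebra_simps)
        finally have "\<bar>t\<bar> * d \<le> P x" using False by (simp add: seminorm_scale[OF P] divide_simps mult.commute)
        moreover have "t * d \<le> \<bar>t\<bar> * d" using \<open>0 \<le> d\<close> by (simp add: mult_right_mono)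
        ultimately show ?thesis using jt by simp
      qed
    qed
  qed
  then obtain F where F: "linear F" "\<forall>(x, a)\<in>?G. F x = a" "\<forall>x. \<bar>F x\<bar> \<le> P x" by blast
  have FG: "F x = a" if "(x, a) \<in> ?G" for x a using bspec[OF F(2) that] by simp
  have "F j = 0" if "j \<in> J" for j by (rule FG) (use that in force)
  moreover have "F v = d" by (rule FG) (use subspace_0[OF J] in force)
  ultimately show ?thesis using F by blast
qed

lemma blinfun_of_linear:
  fixes F :: "'v::real_normed_vector \<Rightarrow> real"
  assumes "linear F" "\<And>x. \<bar>F x\<bar> \<le> C * norm x" "0 \<le> C"
  obtains G where "\<And>x. blinfun_apply G x = F x" "norm G \<le> C"
proof -
  have "bounded_linear F" using assms(1,2)
    by (intro bounded_linear_intro[where K = C]) (auto simp: linear_add linear_scale mult.commute)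
  then have "\<And>x. blinfun_apply (Blinfun F) x = F x" by (simp add: bounded_linear_Blinfun_apply)
  moreover from this have "norm (Blinfun F) \<le> C" using assms(2,3) by (intro norm_blinfun_bound) auto
  ultimately show ?thesis using that by blast
qed

lemma linear_blinfun_apply: "linear (blinfun_apply f)"
  using blinfun.bounded_linear_right bounded_linear.linear by blast

lemma abs_blinfun_apply_le: "\<bar>blinfun_apply f x\<bar> \<le> norm f * norm x"
  for f :: "'v::real_normed_vector \<Rightarrow>\<^sub>L real"
  using norm_blinfun[of f x] by simp

lemma separating_functional:
  fixes J :: "'v::real_normed_vector set"
  assumes J: "closed_subspace J" and v: "v \<notin> J"
  obtains F :: "'v \<Rightarrow>\<^sub>L real" where "\<forall>j\<in>J. blinfun_apply F j = 0" "blinfun_apply F v = 1"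
proof -
  have Js: "subspace J" and "closed J" using J by (auto simp: closed_subspace_def)
  then obtain d where d: "0 < d" "ball v d \<subseteq> - J"
    using v open_contains_ball[of "- J"] by (auto simp: open_Compl)
  have "d \<le> norm (v - j)" if "j \<in> J" for j
    using d that by (force simp: subset_iff dist_norm not_less[symmetric])
  then obtain F where F: "linear F" "\<forall>x. \<bar>F x\<bar> \<le> norm x" "\<forall>j\<in>J. F j = 0" "F v = d"
    using Hahn_Banach_distance[OF seminorm_norm Js, of d v] d by auto
  obtain G where G: "\<And>x. blinfun_apply G x = F x"
    by (rule blinfun_of_linear[of F 1]) (use F in auto)
  show ?thesis
    by (rule that[of "(1 / d) *\<^sub>R G"]) (use F G d in \<open>auto simp: blinfun.scaleR_left\<close>)
qed

lemma norming_functional: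
  fixes v :: "'v::real_normed_vector"
  obtains F :: "'v \<Rightarrow>\<^sub>L real" where "norm F \<le> 1" "blinfun_apply F v = norm v"
proof -
  obtain F where F: "linear F" "\<forall>x. \<bar>F x\<bar> \<le> norm x" "F v = norm v"
    using Hahn_Banach_distance[OF seminorm_norm subspace_single_0, of "norm v" v] by auto
  obtain G where "\<And>x. blinfun_apply G x = F x" "norm G \<le> 1"
    by (rule blinfun_of_linear[of F 1]) (use F in auto)
  then show ?thesis using that F by auto
qed

section \<open>Seminorms on Banach spaces\<close>

text \<open>The closed ball replaces the unit sphere so that for a subspace the supremum is over a
  nonempty set, even for \<open>{0}\<close>.\<close>

definition dual_seminorm :: "('a::real_normed_vector \<Rightarrow>\<^sub>L real) set \<Rightarrow> 'a \<Rightarrow> real" where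
  "dual_seminorm S x = (SUP f\<in>S \<inter> cball 0 1. \<bar>blinfun_apply f x\<bar>)"

lemma dual_seminorm_upper:
  assumes "f \<in> S" "norm f \<le> 1"
  shows "\<bar>blinfun_apply f x\<bar> \<le> dual_seminorm S x"
proof -
  have "\<bar>blinfun_apply g x\<bar> \<le> norm x" if "g \<in> S \<inter> cball 0 1" for g
    using abs_blinfun_apply_le[of g x] mult_right_mono[of "norm g" 1 "norm x"] that by auto
  then have "bdd_above ((\<lambda>f. \<bar>blinfun_apply f x\<bar>) ` (S \<inter> cball 0 1))"
    by (intro bdd_aboveI2)
  then show ?thesis unfolding dual_seminorm_def using assms by (intro cSUP_upper) auto
qed

lemma dual_seminorm_least:
  assumes "subspace S" "\<And>f. \<lbrakk>f \<in> S; norm f \<le> 1\<rbrakk> \<Longrightarrow> \<bar>blinfun_apply f x\<bar> \<le> c"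
  shows "dual_seminorm S x \<le> c"
proof -
  have "0 \<in> S \<inter> cball 0 1" using assms(1) by (simp add: subspace_0)
  then show ?thesis unfolding dual_seminorm_def using assms(2) by (intro cSUP_least) auto
qed

lemma dual_seminorm_bound:
  assumes "subspace S" "f \<in> S"
  shows "\<bar>blinfun_apply f x\<bar> \<le> norm f * dual_seminorm S x"
proof (cases "f = 0")
  case False
  have "\<bar>blinfun_apply ((1 / norm f) *\<^sub>R f) x\<bar> \<le> dual_seminorm S x"
    using assms False by (intro dual_seminorm_upper subspace_scale) auto
  then show ?thesis using False by (simp add: blinfun.scaleR_left abs_mult field_simps)
qed simp

lemma dual_seminorm_le_norm:
  assumes "subspace S"
  shows "dual_seminorm S x \<le> norm x"
proof (rule dual_seminorm_least[OF assms])
  fix f :: "'a \<Rightarrow>\<^sub>L real" assume "norm f \<le> 1"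
  then show "\<bar>blinfun_apply f x\<bar> \<le> norm x"
    using abs_blinfun_apply_le[of f x] mult_right_mono[of "norm f" 1 "norm x"] by auto
qed

lemma dual_seminorm_mono:
  assumes "subspace S" "S \<subseteq> S'"
  shows "dual_seminorm S x \<le> dual_seminorm S' x"
  using assms by (intro dual_seminorm_least dual_seminorm_upper) auto

lemma seminorm_dual_seminorm:
  assumes S: "subspace S"
  shows "seminorm (dual_seminorm S)"
proof (rule seminormI)
  show "dual_seminorm S (x + y) \<le> dual_seminorm S x + dual_seminorm S y" for x y
  proof (rule dual_seminorm_least[OF S])
    fix f assume "f \<in> S" "norm f \<le> 1"
    then show "\<bar>blinfun_apply f (x + y)\<bar> \<le> dual_seminorm S x + dual_seminorm S y"
      using dual_seminorm_upper[of f S x] dual_seminorm_upper[of f S y]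
      by (simp add: blinfun.add_right)
  qed
  have le: "dual_seminorm S (r *\<^sub>R x) \<le> \<bar>r\<bar> * dual_seminorm S x" for r x
  proof (rule dual_seminorm_least[OF S])
    fix f assume "f \<in> S" "norm f \<le> 1"
    then show "\<bar>blinfun_apply f (r *\<^sub>R x)\<bar> \<le> \<bar>r\<bar> * dual_seminorm S x"
      using dual_seminorm_upper[of f S x]
      by (simp add: blinfun.scaleR_right abs_mult mult_left_mono)
  qed
  have "0 \<le> dual_seminorm S 0"
    using dual_seminorm_upper[of 0 S 0] subspace_0[OF S] by simp
  then show "dual_seminorm S (r *\<^sub>R x) = \<bar>r\<bar> * dual_seminorm S x" for r x
    using le[of r x] le[of "1 / r" "r *\<^sub>R x"] le[of 0 0]
    by (cases "r = 0") (auto simp: field_simps abs_if split: if_splits)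
qed

section \<open>Nowhere dominating seminorms and nuclear perturbations\<close>

text \<open>With \<open>q\<close> the norm of \<open>T x\<close> this is strict singularity of
  \<open>T\<close>; with \<open>q\<close> the dual seminorm of a nonzero \<open>M\<close> it says
  that \<open>M\<close> is nowhere norming.\<close>

definition nowhere_dominating :: "('a::real_normed_vector \<Rightarrow> real) \<Rightarrow> bool" where
  "nowhere_dominating q \<longleftrightarrow>
     (\<forall>L c. closed_subspace L \<and> infinite_dimensional L \<and> c > 0 \<longrightarrow> (\<exists>x\<in>L. q x < c * norm x))"

lemma nowhere_dominating_mono:
  assumes "nowhere_dominating q" "C > 0" "\<And>x. q' x \<le> C * q x"
  shows "nowhere_dominating q'"
  unfolding nowhere_dominating_def
proof (intro allI impI)
  fix L :: "'a set" and c :: real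
  assume "closed_subspace L \<and> infinite_dimensional L \<and> c > 0"
  then have "\<exists>x\<in>L. q x < c / C * norm x"
    using assms(1,2) unfolding nowhere_dominating_def by (meson divide_pos_pos)
  then obtain x where "x \<in> L" "q x < c / C * norm x" by blast
  moreover from this have "C * q x < c * norm x" using assms(2) by (simp add: field_simps)
  ultimately show "\<exists>x\<in>L. q' x < c * norm x" using assms(3) le_less_trans by blast
qed

lemma dual_seminorm_eq_SUP_sphere:
  assumes S: "subspace S" and ne: "S \<noteq> {0}"
  shows "dual_seminorm S x = (SUP f\<in>S \<inter> sphere 0 1. \<bar>blinfun_apply f x\<bar>)" (is "_ = ?r")
proof (rule antisym)
  obtain f where f: "f \<in> S" "f \<noteq> 0" using S ne subspace_0 by blast
  have ne': "(1 / norm f) *\<^sub>R f \<in> S \<inter> sphere 0 1" using f S by (simp add: subspace_scale)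
  have up: "\<bar>blinfun_apply g x\<bar> \<le> dual_seminorm S x" if "g \<in> S \<inter> sphere 0 1" for g
    using that by (intro dual_seminorm_upper) auto
  then have bdd: "bdd_above ((\<lambda>f. \<bar>blinfun_apply f x\<bar>) ` (S \<inter> sphere 0 1))"
    by (intro bdd_aboveI2)
  show "?r \<le> dual_seminorm S x" using ne' up by (intro cSUP_least) auto
  have sph: "\<bar>blinfun_apply g x\<bar> \<le> ?r" if "g \<in> S \<inter> sphere 0 1" for g
    using that bdd by (intro cSUP_upper) auto
  have r0: "0 \<le> ?r" using sph[OF ne'] by linarith
  show "dual_seminorm S x \<le> ?r"
  proof (rule dual_seminorm_least[OF S])
    fix g assume g: "g \<in> S" "norm g \<le> 1"
    show "\<bar>blinfun_apply g x\<bar> \<le> ?r"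
    proof (cases "g = 0")
      case False
      have "\<bar>blinfun_apply ((1 / norm g) *\<^sub>R g) x\<bar> \<le> ?r"
        using g False S by (intro sph) (auto simp: subspace_scale)
      then have "\<bar>blinfun_apply g x\<bar> \<le> norm g * ?r"
        using False by (simp add: blinfun.scaleR_left abs_mult field_simps)
      also have "\<dots> \<le> 1 * ?r" using g r0 by (intro mult_right_mono) auto
      finally show ?thesis by simp
    qed (use r0 in simp)
  qed
qed

text \<open>The sphere of \<open>{0}\<close> is empty and its supremum unspecified, hence the
  exclusion of that case.\<close>

lemma nowhere_norming_iff:
  assumes "closed_subspace M" "M \<noteq> {0}"
  shows "nowhere_norming M \<longleftrightarrow> nowhere_dominating (dual_seminorm M)"
proof -
  have "(SUP f\<in>M \<inter> sphere 0 1. \<bar>blinfun_apply f x\<bar>) = dual_seminorm M x" for x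
    using dual_seminorm_eq_SUP_sphere assms by (metis closed_subspace_def)
  then show ?thesis
    unfolding nowhere_norming_def nowhere_dominating_def norming_over_def
    using assms by (auto simp: not_le[symmetric])
qed

text \<open>All but finitely many \<open>g k\<close> have total norm below \<open>c / 2\<close>; the
  others vanish on a subspace of \<open>L\<close> that is still infinite-dimensional, and there
  \<open>q\<close> can be made smaller than the other half.\<close>

lemma nowhere_dominating_add_nuclear:
  fixes g :: "nat \<Rightarrow> 'a::real_normed_vector \<Rightarrow>\<^sub>L real"
  assumes q: "nowhere_dominating q" and g: "summable (\<lambda>k. norm (g k))"
  shows "nowhere_dominating (\<lambda>x. q x + (\<Sum>k. \<bar>blinfun_apply (g k) x\<bar>))"
  unfolding nowhere_dominating_def
proof (intro allI impI)
  fix L :: "'a set" and c :: real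
  assume L: "closed_subspace L \<and> infinite_dimensional L \<and> c > 0"
  then have "\<exists>r. \<forall>n\<ge>r. norm (\<Sum>i. norm (g (i + n))) < c / 2"
    by (intro suminf_exist_split g) auto
  then obtain r where "norm (\<Sum>i. norm (g (i + r))) < c / 2" by blast
  then have r: "(\<Sum>i. norm (g (i + r))) < c / 2" by simp
  define L' where "L' = L \<inter> {x. \<forall>k\<in>{..<r}. blinfun_apply (g k) x = 0}"
  have sub: "subspace L" "closed L" using L by (auto simp: closed_subspace_def)
  have "subspace L'" unfolding L'_def using sub
    by (auto simp: subspace_def blinfun.add_right blinfun.scaleR_right)
  moreover have "closed L'"
  proof -
    have "L' = L \<inter> (\<Inter>k\<in>{..<r}. {x. blinfun_apply (g k) x = 0})" by (auto simp: L'_def)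
    also have "closed \<dots>"
      by (intro closed_Int sub closed_INT ballI closed_Collect_eq continuous_intros)
    finally show ?thesis .
  qed
  moreover have "infinite_dimensional L'" unfolding L'_def
    using L sub by (intro infinite_dimensional_Int_kernels linear_blinfun_apply) auto
  ultimately obtain x where x: "x \<in> L'" "q x < c / 2 * norm x"
    using q L unfolding nowhere_dominating_def closed_subspace_def
    by (metis half_gt_zero)
  have s1: "summable (\<lambda>i. norm (g (i + r)) * norm x)"
    using g by (intro summable_mult2 summable_ignore_initial_segment)
  have s2: "summable (\<lambda>i. \<bar>blinfun_apply (g i) x\<bar>)"
    using summable_mult2[OF g, of "norm x"]
    by (rule summable_comparison_test'[where N = 0]) (simp add: abs_blinfun_apply_le)
  have "(\<Sum>k. \<bar>blinfun_apply (g k) x\<bar>) = (\<Sum>i. \<bar>blinfun_apply (g (i + r)) x\<bar>)"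
    using suminf_split_initial_segment[OF s2, of r] x(1) by (simp add: L'_def)
  also have "\<dots> \<le> (\<Sum>i. norm (g (i + r)) * norm x)"
    using s1 s2 by (intro suminf_le abs_blinfun_apply_le) (auto intro: summable_ignore_initial_segment)
  also have "\<dots> = (\<Sum>i. norm (g (i + r))) * norm x"
    using g by (intro suminf_mult2[symmetric] summable_ignore_initial_segment)
  also have "\<dots> \<le> c / 2 * norm x" using r by (intro mult_right_mono) auto
  finally have "q x + (\<Sum>k. \<bar>blinfun_apply (g k) x\<bar>) < c * norm x" using x by simp
  then show "\<exists>x\<in>L. q x + (\<Sum>k. \<bar>blinfun_apply (g k) x\<bar>) < c * norm x"
    using x by (auto simp: L'_def)
qed

section \<open>Lifting through a seminorm\<close>

text \<open>The iteration of the open mapping theorem: the remainder is lifted again with its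
  seminorm halved each time, and the corrections sum up in the closed subspace \<open>L\<close>. The
  factor 2 is the sum of the geometric series.\<close>

lemma approximate_lifting_imp_lifting:
  fixes q :: "'a::banach \<Rightarrow> real"
  assumes q: "seminorm q" "\<And>x. q x \<le> K * norm x" and L: "closed_subspace L" and "0 \<le> C"
    and step: "\<And>x. x \<in> L \<Longrightarrow> \<exists>w\<in>L. norm w \<le> C * q x \<and> q (x - w) \<le> q x / 2"
    and x: "x \<in> L"
  shows "\<exists>w\<in>L. norm w \<le> 2 * C * q x \<and> q (x - w) = 0"
proof -
  have Ls: "subspace L" and Lc: "closed L" using L by (auto simp: closed_subspace_def)
  obtain w where w: "\<And>x. x \<in> L \<Longrightarrow> w x \<in> L" "\<And>x. x \<in> L \<Longrightarrow> norm (w x) \<le> C * q x"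
      "\<And>x. x \<in> L \<Longrightarrow> q (x - w x) \<le> q x / 2"
    using step by metis
  define r where "r n = ((\<lambda>y. y - w y) ^^ n) x" for n
  have rS: "r (Suc n) = r n - w (r n)" for n by (simp add: r_def)
  have rL: "r n \<in> L" for n
    by (induction n) (use x w(1) Ls rS in \<open>auto simp: r_def subspace_diff\<close>)
  have qr: "q (r n) \<le> q x * (1 / 2) ^ n" for n
  proof (induction n)
    case 0
    show ?case by (simp add: r_def)
  next
    case (Suc n)
    then show ?case using w(3)[OF rL[of n]] by (simp add: rS)
  qed
  define v where "v n = w (r n)" for n
  have vb: "norm (v n) \<le> C * q x * (1 / 2) ^ n" for n
  proof -
    have "norm (v n) \<le> C * q (r n)" unfolding v_def by (rule w(2)[OF rL])
    also have "\<dots> \<le> C * (q x * (1 / 2) ^ n)" using qr \<open>0 \<le> C\<close> by (rule mult_left_mono)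
    finally show ?thesis by simp
  qed
  have geo: "(\<lambda>n. C * q x * (1 / 2) ^ n) sums (C * q x * 2)"
    using sums_mult[OF geometric_sums[of "1 / 2 :: real"], of "C * q x"] by simp
  have sn: "summable (\<lambda>n. norm (v n))"
    by (rule summable_comparison_test'[OF sums_summable[OF geo], of 0]) (use vb in auto)
  then have sv: "summable v" by (rule summable_norm_cancel)
  have part: "(\<Sum>i<n. v i) = x - r n" for n
    by (induction n) (auto simp: r_def v_def)
  have lim: "(\<lambda>n. x - r n) \<longlonglongrightarrow> suminf v" using summable_LIMSEQ[OF sv] by (simp add: part)
  have "suminf v \<in> L"
    by (rule closed_sequentially[OF Lc _ lim]) (use x rL Ls in \<open>auto intro: subspace_diff\<close>)
  moreover have "norm (suminf v) \<le> 2 * C * q x"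
  proof -
    have "norm (suminf v) \<le> (\<Sum>n. norm (v n))" by (rule summable_norm[OF sn])
    also have "\<dots> \<le> (\<Sum>n. C * q x * (1 / 2) ^ n)" using vb sn sums_summable[OF geo] by (rule suminf_le)
    also have "\<dots> = 2 * C * q x" using sums_unique[OF geo] by simp
    finally show ?thesis .
  qed
  moreover have "q (x - suminf v) = 0"
  proof -
    have le: "q (x - suminf v) \<le> q x * (1 / 2) ^ n + K * norm ((x - r n) - suminf v)" for n
    proof -
      have "q (x - suminf v) \<le> q (r n) + q ((x - r n) - suminf v)"
        using seminorm_add[OF q(1), of "r n" "(x - r n) - suminf v"] by simp
      then show ?thesis using qr[of n] q(2)[of "(x - r n) - suminf v"] by linarith
    qed
    have "(\<lambda>n. q x * (1 / 2) ^ n + K * norm ((x - r n) - suminf v)) \<longlonglongrightarrow> q x * 0 + K * 0"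
      using lim by (intro tendsto_intros LIMSEQ_power_zero) (auto simp: LIM_zero tendsto_norm_zero)
    then have "q (x - suminf v) \<le> 0" using le by (intro LIMSEQ_le_const) auto
    then show ?thesis using seminorm_nonneg[OF q(1), of "x - suminf v"] by simp
  qed
  ultimately show ?thesis by blast
qed

text \<open>A dual criterion for openness: one constant \<open>C\<close> must serve all
  \<open>q\<close>-bounded functionals of norm at most 1 on \<open>L\<close>, whatever their own
  \<open>R\<close>. The factor 4 is 2 from the separation times 2 from the iteration.\<close>

lemma dual_bound_imp_lifting:
  fixes q :: "'a::banach \<Rightarrow> real"
  assumes q: "seminorm q" "\<And>x. q x \<le> K * norm x" and L: "closed_subspace L" and C: "0 < C"
    and dual: "\<And>f R x. \<lbrakk>linear f; \<And>y. \<bar>f y\<bar> \<le> R * q y; \<And>w. w \<in> L \<Longrightarrow> \<bar>f w\<bar> \<le> norm w; x \<in> L\<rbrakk>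
      \<Longrightarrow> \<bar>f x\<bar> \<le> C * q x"
    and x: "x \<in> L"
  shows "\<exists>w\<in>L. norm w \<le> 4 * C * q x \<and> q (x - w) = 0"
proof -
  have Ls: "subspace L" using L by (auto simp: closed_subspace_def)
  have "\<exists>w\<in>L. norm w \<le> 2 * C * q x \<and> q (x - w) \<le> q x / 2" if x: "x \<in> L" for x
  proof (cases "q x = 0")
    case True
    then show ?thesis using subspace_0[OF Ls] by (intro bexI[of _ 0]) auto
  next
    case False
    then have qx: "q x > 0" using seminorm_nonneg[OF q(1), of x] by simp
    \<comment> \<open>The weights let one inequality deliver both the norm bound and the halved
      error. If it fails for every \<open>w\<close>, separation yields a functional with value
      \<open>2 * C * q x\<close> at \<open>x\<close>, twice what \<open>dual\<close> allows.\<close>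
    have "\<exists>w\<in>L. norm w + 4 * C * q (x - w) < 2 * C * q x"
    proof (rule ccontr)
      assume "\<not> (\<exists>w\<in>L. norm w + 4 * C * q (x - w) < 2 * C * q x)"
      then have no: "2 * C * q x \<le> norm w + 4 * C * q (x - w)" if "w \<in> L" for w
        using that by force
      \<comment> \<open>A functional on \<open>X \<times> X\<close> killing the antidiagonal of \<open>L\<close> is bounded on \<open>L\<close> by both summands.\<close>
      define P where "P z = norm (fst z) + 4 * C * q (snd z)" for z :: "'a \<times> 'a"
      define J where "J = {(w, - w) | w. w \<in> L}"
      have P: "seminorm P"
      proof (rule seminormI)
        show "P (y + z) \<le> P y + P z" for y z
        proof -
          have "4 * C * q (snd y + snd z) \<le> 4 * C * (q (snd y) + q (snd z))"
            using C seminorm_add[OF q(1)] by (intro mult_left_mono) auto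
          then show ?thesis using norm_triangle_ineq[of "fst y" "fst z"]
            by (simp add: P_def algebra_simps)
        qed
      qed (simp add: P_def seminorm_scale[OF q(1)] algebra_simps)
      have J: "subspace J"
      proof (rule subspaceI)
        show "0 \<in> J" using subspace_0[OF Ls] by (force simp: J_def zero_prod_def)
        show "y + z \<in> J" if "y \<in> J" "z \<in> J" for y z
          using that subspace_add[OF Ls] by (force simp: J_def)
        show "c *\<^sub>R y \<in> J" if "y \<in> J" for c y
          using that subspace_scale[OF Ls] by (force simp: J_def)
      qed
      have "2 * C * q x \<le> P ((0, x) - j)" if j: "j \<in> J" for j
      proof -
        obtain w where w: "w \<in> L" "j = (w, - w)" using j by (auto simp: J_def)
        then show ?thesis using no[of "- w"] subspace_neg[OF Ls] by (simp add: P_def)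
      qed
      then obtain F where F: "linear F" "\<forall>z. \<bar>F z\<bar> \<le> P z" "\<forall>j\<in>J. F j = 0" "F (0, x) = 2 * C * q x"
        using Hahn_Banach_distance[OF P J, of "2 * C * q x" "(0, x)"] C qx by auto
      define f where "f y = F (0, y)" for y
      have lf: "linear f"
      proof (rule linearI)
        show "f (y + z) = f y + f z" for y z
          using linear_add[OF F(1), of "(0, y)" "(0, z)"] by (simp add: f_def)
        show "f (r *\<^sub>R y) = r *\<^sub>R f y" for r y
          using linear_scale[OF F(1), of r "(0, y)"] by (simp add: f_def)
      qed
      have f1: "\<bar>f y\<bar> \<le> 4 * C * q y" for y using F(2)[rule_format, of "(0, y)"] by (simp add: f_def P_def)
      have f2: "\<bar>f w\<bar> \<le> norm w" if w: "w \<in> L" for w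
      proof -
        have "F (w, - w) = 0" using F(3) w by (auto simp: J_def)
        then have "f w = F (w, 0)"
          using linear_add[OF F(1), of "(w, - w)" "(0, w)"] by (simp add: f_def)
        then show ?thesis using F(2)[rule_format, of "(w, 0)"] seminorm_zero[OF q(1)] by (simp add: P_def)
      qed
      have "\<bar>f x\<bar> \<le> C * q x" by (rule dual[OF lf f1 f2 x])
      moreover have "C * q x > 0" using C qx by simp
      ultimately show False using F(4) by (simp add: f_def)
    qed
    then obtain w where w: "w \<in> L" "norm w + 4 * C * q (x - w) < 2 * C * q x" by blast
    have "0 \<le> 4 * C * q (x - w)" using C seminorm_nonneg[OF q(1)] by simp
    then have "norm w \<le> 2 * C * q x" using w by linarith
    moreover have "4 * C * q (x - w) < 2 * C * q x" using w norm_ge_zero[of w] by linarith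
    then have "q (x - w) \<le> q x / 2" using C by (simp add: field_simps)
    ultimately show ?thesis using w by blast
  qed
  then show ?thesis
    using approximate_lifting_imp_lifting[OF q L _ _ x, of "2 * C"] C by simp
qed

section \<open>Complete seminorms, uniform boundedness and the open mapping theorem\<close>

text \<open>Completeness of the space modulo the kernel of \<open>q\<close>, expressed through
  representatives; limits are determined only up to that kernel.\<close>

definition seminorm_complete :: "('a::real_vector \<Rightarrow> real) \<Rightarrow> bool" where
  "seminorm_complete q \<longleftrightarrow>
     (\<forall>X :: nat \<Rightarrow> 'a. (\<forall>e>0. \<exists>N. \<forall>m\<ge>N. \<forall>n\<ge>N. q (X m - X n) < e) \<longrightarrow> (\<exists>x. (\<lambda>n. q (X n - x)) \<longlonglongrightarrow> 0))"

text \<open>A gliding hump in place of Baire's theorem: pick \<open>f n\<close> of norm at least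
  \<open>4 ^ n\<close> and walk from 0 in steps of length at most \<open>(1 / 3) ^ Suc n\<close>,
  each with the sign that makes \<open>f n\<close> large. All later steps together have at most half
  that length, so \<open>f n\<close> stays large at the limit.\<close>

lemma seminorm_uniform_boundedness:
  fixes q :: "'a::real_vector \<Rightarrow> real"
  assumes q: "seminorm q" "seminorm_complete q"
    and lin: "\<And>f. f \<in> \<F> \<Longrightarrow> linear f"
    and bounded: "\<And>f. f \<in> \<F> \<Longrightarrow> \<exists>R. \<forall>x. \<bar>f x\<bar> \<le> R * q x"
    and pointwise: "\<And>x. \<exists>B. \<forall>f\<in>\<F>. \<bar>f x\<bar> \<le> B"
  shows "\<exists>C>0. \<forall>f\<in>\<F>. \<forall>x. \<bar>f x\<bar> \<le> C * q x"
proof (rule ccontr)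
  assume no: "\<not> ?thesis"
  have "\<exists>f u N. f \<in> \<F> \<and> 4 ^ n \<le> N \<and> q u \<le> 1 \<and> 3 / 4 * N \<le> \<bar>f u\<bar> \<and> (\<forall>y. \<bar>f y\<bar> \<le> N * q y)" for n :: nat
  proof -
    have "\<not> (\<forall>f\<in>\<F>. \<forall>x. \<bar>f x\<bar> \<le> 4 ^ n * q x)"
      using no zero_less_power[of "4::real" n] by auto
    then obtain f x0 where f: "f \<in> \<F>" and x0: "4 ^ n * q x0 < \<bar>f x0\<bar>" by (auto simp: not_le)
    obtain R where R: "\<And>x. \<bar>f x\<bar> \<le> R * q x" using bounded[OF f] by blast
    have lf: "linear f" by (rule lin[OF f])
    \<comment> \<open>\<open>N\<close> is the norm of \<open>f\<close> with respect to
      \<open>q\<close>; it need not be attained, hence the factor 3/4 for \<open>u\<close>.\<close>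
    define N where "N = (SUP u\<in>{u. q u \<le> 1}. \<bar>f u\<bar>)"
    have bd: "\<bar>f u\<bar> \<le> \<bar>R\<bar>" if "q u \<le> 1" for u
    proof -
      have "R * q u \<le> \<bar>R\<bar> * q u" using seminorm_nonneg[OF q(1)] by (intro mult_right_mono) auto
      also have "\<dots> \<le> \<bar>R\<bar> * 1" using that by (intro mult_left_mono) auto
      finally show ?thesis using R[of u] by simp
    qed
    have bdd: "bdd_above ((\<lambda>u. \<bar>f u\<bar>) ` {u. q u \<le> 1})" by (rule bdd_aboveI2[of _ _ "\<bar>R\<bar>"]) (use bd in simp)
    have N: "\<bar>f y\<bar> \<le> N * q y" for y
    proof (cases "q y = 0")
      case True
      then show ?thesis using R[of y] by simp
    next
      case False
      then have qy: "q y > 0" using seminorm_nonneg[OF q(1), of y] by simp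
      have "\<bar>f ((1 / q y) *\<^sub>R y)\<bar> \<le> N"
        unfolding N_def using qy bdd by (intro cSUP_upper) (auto simp: seminorm_scale[OF q(1)])
      then show ?thesis using qy by (simp add: linear_scale[OF lf] abs_mult field_simps)
    qed
    have "4 ^ n * q x0 < N * q x0" using x0 N[of x0] by linarith
    then have N4: "4 ^ n < N" using seminorm_nonneg[OF q(1), of x0] by (simp add: mult_less_cancel_right)
    then have "3 / 4 * N < N" using zero_less_power[of "4::real" n] by linarith
    then have "\<exists>u\<in>{u. q u \<le> 1}. 3 / 4 * N < \<bar>f u\<bar>"
    proof (rule contrapos_pp)
      assume "\<not> (\<exists>u\<in>{u. q u \<le> 1}. 3 / 4 * N < \<bar>f u\<bar>)"
      moreover have "0 \<in> {u. q u \<le> 1}" using seminorm_zero[OF q(1)] by simp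
      ultimately have "N \<le> 3 / 4 * N" unfolding N_def by (intro cSUP_least) auto
      then show "\<not> 3 / 4 * N < N" by simp
    qed
    then obtain u where "q u \<le> 1" "3 / 4 * N \<le> \<bar>f u\<bar>" by (auto simp: less_imp_le)
    then show ?thesis using f N N4 by (intro exI[of _ f] exI[of _ u] exI[of _ N]) auto
  qed
  then obtain f u N where F: "\<And>n::nat. f n \<in> \<F>" and N4: "\<And>n. 4 ^ n \<le> N n" and u1: "\<And>n. q (u n) \<le> 1"
      and fu: "\<And>n. 3 / 4 * N n \<le> \<bar>f n (u n)\<bar>" and fN: "\<And>n y. \<bar>f n y\<bar> \<le> N n * q y"
    by metis
  define step where "step n y =
      (if (1 / 3) ^ Suc n * \<bar>f n (u n)\<bar> \<le> \<bar>f n (y + (1 / 3) ^ Suc n *\<^sub>R u n)\<bar>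
       then y + (1 / 3) ^ Suc n *\<^sub>R u n else y - (1 / 3) ^ Suc n *\<^sub>R u n)" for n y
  define X where "X = rec_nat 0 step"
  have XS: "X (Suc n) = step n (X n)" for n by (simp add: X_def)
  \<comment> \<open>The values of \<open>f n\<close> at the two candidates differ by
    \<open>2 * (?t * f n (u n))\<close>, so one of them is at least half of that in absolute
    value.\<close>
  have big: "(1 / 3) ^ Suc n * \<bar>f n (u n)\<bar> \<le> \<bar>f n (X (Suc n))\<bar>" for n
  proof -
    let ?t = "(1 / 3) ^ Suc n :: real"
    have lf: "linear (f n)" by (rule lin[OF F])
    have "f n (X n + ?t *\<^sub>R u n) - f n (X n - ?t *\<^sub>R u n) = 2 * (?t * f n (u n))"
      by (simp only: linear_add[OF lf] linear_diff[OF lf] linear_scale[OF lf]) simp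
    moreover have "\<bar>?t * f n (u n)\<bar> = ?t * \<bar>f n (u n)\<bar>" by (simp add: abs_mult)
    ultimately show ?thesis unfolding XS step_def by (smt (verit))
  qed
  have small: "q (X (Suc n) - X n) \<le> (1 / 3) ^ Suc n" for n
  proof -
    have "q (X (Suc n) - X n) = (1 / 3) ^ Suc n * q (u n)"
      unfolding XS step_def by (simp add: seminorm_scale[OF q(1)] seminorm_minus[OF q(1)])
    also have "\<dots> \<le> (1 / 3) ^ Suc n * 1" using u1 by (intro mult_left_mono) auto
    finally show ?thesis by simp
  qed
  have dist: "q (X (k + d) - X k) \<le> (1 / 3) ^ k / 2 - (1 / 3) ^ (k + d) / 2" for k d
  proof (induction d)
    case 0
    then show ?case using seminorm_zero[OF q(1)] by simp
  next
    case (Suc d)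
    have "q (X (k + Suc d) - X k) \<le> q (X (Suc (k + d)) - X (k + d)) + q (X (k + d) - X k)"
      using seminorm_triangle[OF q(1)] by simp
    also have "\<dots> \<le> (1 / 3) ^ Suc (k + d) + ((1 / 3) ^ k / 2 - (1 / 3) ^ (k + d) / 2)"
      using small[of "k + d"] Suc by linarith
    finally show ?case by simp
  qed
  have half: "q (X m - X k) \<le> (1 / 3) ^ k / 2" if "k \<le> m" for m k
  proof -
    have "q (X m - X k) \<le> (1 / 3) ^ k / 2 - (1 / 3) ^ m / 2" using dist[of k "m - k"] that by simp
    then show ?thesis by (smt (verit) zero_le_divide_1_iff zero_le_power divide_nonneg_nonneg)
  qed
  have "\<exists>x. (\<lambda>n. q (X n - x)) \<longlonglongrightarrow> 0"
  proof (rule q(2)[unfolded seminorm_complete_def, rule_format])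
    fix e :: real assume "e > 0"
    then obtain M :: nat where M: "(1 / 3 :: real) ^ M < e"
      using real_arch_pow_inv[of e "1 / 3"] by auto
    have "q (X m - X n) < e" if "M \<le> m" "M \<le> n" for m n
    proof -
      have "q (X m - X n) \<le> q (X m - X M) + q (X M - X n)" by (rule seminorm_triangle[OF q(1)])
      also have "q (X M - X n) = q (X n - X M)" by (rule seminorm_commute[OF q(1)])
      finally show ?thesis using half[OF that(1)] half[OF that(2)] M by linarith
    qed
    then show "\<exists>N. \<forall>m\<ge>N. \<forall>n\<ge>N. q (X m - X n) < e" by blast
  qed
  then obtain x where x: "(\<lambda>n. q (X n - x)) \<longlonglongrightarrow> 0" by blast
  have close: "q (X k - x) \<le> (1 / 3) ^ k / 2" for k
  proof -
    have "q (X k - x) \<le> (1 / 3) ^ k / 2 + q (X m - x)" if "k \<le> m" for m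
      using seminorm_triangle[OF q(1), of "X k" x "X m"] half[OF that] seminorm_commute[OF q(1), of "X k"]
      by simp
    moreover have "(\<lambda>m. (1 / 3) ^ k / 2 + q (X m - x)) \<longlonglongrightarrow> (1 / 3) ^ k / 2 + 0"
      by (intro tendsto_intros x)
    ultimately show ?thesis by (intro LIMSEQ_le_const[of _ _ "q (X k - x)"]) auto
  qed
  \<comment> \<open>The step gains at least \<open>3 / 4 * ?t * N n\<close> and the later ones lose
    at most half of \<open>?t * N n\<close>; the remaining quarter is at least
    \<open>(4 / 3) ^ n / 12\<close>.\<close>
  have low: "(4 / 3) ^ n / 12 \<le> \<bar>f n x\<bar>" for n
  proof -
    let ?t = "(1 / 3) ^ Suc n :: real"
    have "f n (X (Suc n)) - f n x = f n (X (Suc n) - x)" by (simp add: linear_diff[OF lin[OF F]])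
    then have "\<bar>f n (X (Suc n))\<bar> - \<bar>f n x\<bar> \<le> N n * q (X (Suc n) - x)"
      using fN[of n "X (Suc n) - x"] by linarith
    also have "\<dots> \<le> N n * (?t / 2)"
      using close[of "Suc n"] N4[of n] zero_le_power[of "4::real" n] by (intro mult_left_mono) linarith+
    finally have "\<bar>f n x\<bar> \<ge> ?t * \<bar>f n (u n)\<bar> - N n * (?t / 2)" using big[of n] by linarith
    moreover have "?t * \<bar>f n (u n)\<bar> \<ge> ?t * (3 / 4 * N n)" using fu by (intro mult_left_mono) auto
    moreover have "?t * (3 / 4 * N n) - N n * (?t / 2) = ?t * N n / 4" by (simp add: algebra_simps)
    ultimately have "\<bar>f n x\<bar> \<ge> ?t * N n / 4" by linarith
    moreover have "?t * N n \<ge> ?t * 4 ^ n" using N4 by (intro mult_left_mono) auto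
    moreover have "?t * 4 ^ n = (4 / 3) ^ n / 3" by (simp add: power_divide)
    ultimately show ?thesis by linarith
  qed
  obtain B where "\<forall>f\<in>\<F>. \<bar>f x\<bar> \<le> B" using pointwise by blast
  then have "(4 / 3) ^ n \<le> 12 * B" for n using low[of n] F[of n] by fastforce
  moreover obtain n where "12 * B < (4 / 3 :: real) ^ n" using real_arch_pow[of "4 / 3" "12 * B"] by auto
  ultimately show False by (simp add: not_le[symmetric])
qed

text \<open>The open mapping theorem: functionals of norm at most 1 are bounded at each point, so
  uniform boundedness for the complete \<open>q\<close> supplies the constant in
  \<open>dual_bound_imp_lifting\<close> with \<open>L = UNIV\<close>.\<close>

lemma complete_seminorm_lifting:
  fixes q :: "'a::banach \<Rightarrow> real"
  assumes q: "seminorm q" "\<And>x. q x \<le> K * norm x" "seminorm_complete q"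
  obtains C where "C > 0" "\<And>x. \<exists>w. norm w \<le> C * q x \<and> q (x - w) = 0"
proof -
  define \<F> where "\<F> = {f :: 'a \<Rightarrow> real. linear f \<and> (\<exists>R. \<forall>x. \<bar>f x\<bar> \<le> R * q x) \<and> (\<forall>x. \<bar>f x\<bar> \<le> norm x)}"
  have "\<exists>C>0. \<forall>f\<in>\<F>. \<forall>x. \<bar>f x\<bar> \<le> C * q x"
    by (rule seminorm_uniform_boundedness[OF q(1,3)]) (auto simp: \<F>_def)
  then obtain C where C: "C > 0" "\<And>f x. f \<in> \<F> \<Longrightarrow> \<bar>f x\<bar> \<le> C * q x" by blast
  have "\<exists>w\<in>UNIV. norm w \<le> 4 * C * q x \<and> q (x - w) = 0" for x
  proof (rule dual_bound_imp_lifting[OF q(1,2) _ C(1)])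
    fix f :: "'a \<Rightarrow> real" and R x
    assume "linear f" "\<And>y. \<bar>f y\<bar> \<le> R * q y" "\<And>w. w \<in> UNIV \<Longrightarrow> \<bar>f w\<bar> \<le> norm w"
    then have "f \<in> \<F>" unfolding \<F>_def by blast
    then show "\<bar>f x\<bar> \<le> C * q x" by (rule C(2))
  qed (auto simp: closed_subspace_def)
  then show ?thesis using that[of "4 * C"] C(1) by auto
qed

text \<open>Differences along a rapidly Cauchy subsequence are lifted to an absolutely convergent
  series in the Banach space, whose sum yields the limit.\<close>

lemma lifting_imp_complete:
  fixes q :: "'a::banach \<Rightarrow> real"
  assumes q: "seminorm q" "\<And>x. q x \<le> K * norm x"
    and C: "\<And>x. \<exists>w. norm w \<le> C * q x \<and> q (x - w) = 0"
  shows "seminorm_complete q"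
  unfolding seminorm_complete_def
proof (intro allI impI)
  fix X :: "nat \<Rightarrow> 'a" assume X: "\<forall>e>0. \<exists>N. \<forall>m\<ge>N. \<forall>n\<ge>N. q (X m - X n) < e"
  obtain w where w: "\<And>x. norm (w x) \<le> C * q x" "\<And>x. q (x - w x) = 0" using C by metis
  have "\<forall>k. \<exists>N. \<forall>m\<ge>N. \<forall>n\<ge>N. q (X m - X n) < (1 / 2) ^ k" using X by simp
  then obtain M :: "nat \<Rightarrow> nat" where M: "\<And>k m n. \<lbrakk>m \<ge> M k; n \<ge> M k\<rbrakk> \<Longrightarrow> q (X m - X n) < (1 / 2) ^ k" by metis
  \<comment> \<open>Summing the thresholds gives indices that are at least each of
    \<open>M 0\<close>, ..., \<open>M k\<close>, although \<open>M\<close> need not be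
    monotone.\<close>
  define s where "s k = (\<Sum>i\<le>k. M i)" for k
  have sM: "M k \<le> s k" "M k \<le> s (Suc k)" for k unfolding s_def by (rule member_le_sum; simp)+
  define v where "v k = w (X (s (Suc k)) - X (s k))" for k
  have vb: "norm (v k) \<le> \<bar>C\<bar> * (1 / 2) ^ k" for k
  proof -
    have "norm (v k) \<le> C * q (X (s (Suc k)) - X (s k))" unfolding v_def by (rule w(1))
    also have "\<dots> \<le> \<bar>C\<bar> * q (X (s (Suc k)) - X (s k))"
      using seminorm_nonneg[OF q(1)] by (intro mult_right_mono) auto
    also have "\<dots> \<le> \<bar>C\<bar> * (1 / 2) ^ k"
      using M[OF sM(2) sM(1), of k] by (intro mult_left_mono) auto
    finally show ?thesis .
  qed
  have "summable (\<lambda>k. \<bar>C\<bar> * (1 / 2) ^ k)" by (rule summable_mult) (simp add: summable_geometric)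
  then have "summable (\<lambda>k. norm (v k))"
    by (rule summable_comparison_test'[where N = 0]) (use vb in simp)
  then have sv: "summable v" by (rule summable_norm_cancel)
  define x where "x = X (s 0) + suminf v"
  have eq: "q (X (s k) - (X (s 0) + (\<Sum>i<k. v i))) = 0" for k
  proof (induction k)
    case 0
    then show ?case using seminorm_zero[OF q(1)] by simp
  next
    case (Suc k)
    have "q (X (s (Suc k)) - (X (s 0) + (\<Sum>i<Suc k. v i)))
        \<le> q (X (s (Suc k)) - X (s k) - v k) + q (X (s k) - (X (s 0) + (\<Sum>i<k. v i)))"
      using seminorm_add[OF q(1), of "X (s (Suc k)) - X (s k) - v k" "X (s k) - (X (s 0) + (\<Sum>i<k. v i))"]
      by (simp add: algebra_simps)
    moreover have "q (X (s (Suc k)) - X (s k) - v k) = 0" unfolding v_def by (rule w(2))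
    ultimately show ?case using Suc seminorm_nonneg[OF q(1), of "X (s (Suc k)) - (X (s 0) + (\<Sum>i<Suc k. v i))"]
      by linarith
  qed
  have "(\<lambda>k. q (X (s k) - x)) \<longlonglongrightarrow> 0"
  proof (rule tendsto_sandwich[OF _ _ tendsto_const])
    show "\<forall>\<^sub>F k in sequentially. q (X (s k) - x) \<le> K * norm ((\<Sum>i<k. v i) - suminf v)"
    proof (intro always_eventually allI)
      fix k
      have "q (X (s k) - x) \<le> q (X (s k) - (X (s 0) + (\<Sum>i<k. v i))) + q ((\<Sum>i<k. v i) - suminf v)"
        using seminorm_add[OF q(1), of "X (s k) - (X (s 0) + (\<Sum>i<k. v i))" "(\<Sum>i<k. v i) - suminf v"]
        by (simp add: x_def algebra_simps)
      then show "q (X (s k) - x) \<le> K * norm ((\<Sum>i<k. v i) - suminf v)"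
        using eq[of k] q(2)[of "(\<Sum>i<k. v i) - suminf v"] by linarith
    qed
    have "(\<lambda>k. norm ((\<Sum>i<k. v i) - suminf v)) \<longlonglongrightarrow> 0"
      using summable_LIMSEQ[OF sv] by (simp add: LIM_zero tendsto_norm_zero)
    from tendsto_mult_left[OF this, of K]
    show "(\<lambda>k. K * norm ((\<Sum>i<k. v i) - suminf v)) \<longlonglongrightarrow> 0" by simp
  qed (use seminorm_nonneg[OF q(1)] in auto)
  then have x: "\<And>e. e > 0 \<Longrightarrow> \<exists>k0. \<forall>k\<ge>k0. q (X (s k) - x) < e"
    unfolding LIMSEQ_def using seminorm_nonneg[OF q(1)] by (auto simp: dist_real_def)
  have "(\<lambda>n. q (X n - x)) \<longlonglongrightarrow> 0"
  proof (rule LIMSEQ_I)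
    fix e :: real assume e: "e > 0"
    obtain k0 where k0: "\<And>k. k \<ge> k0 \<Longrightarrow> q (X (s k) - x) < e / 2" using x[of "e / 2"] e by auto
    obtain k1 where k1: "(1 / 2 :: real) ^ k1 < e / 2"
      using real_arch_pow_inv[of "e / 2" "1 / 2"] e by auto
    let ?k = "max k0 k1"
    have "norm (q (X n - x) - 0) < e" if n: "n \<ge> M k1" for n
    proof -
      have "M k1 \<le> s ?k" unfolding s_def by (intro member_le_sum) auto
      then have "q (X n - X (s ?k)) < e / 2" using M[OF n, of "s ?k"] k1 by linarith
      moreover have "q (X (s ?k) - x) < e / 2" by (intro k0) simp
      ultimately show ?thesis
        using seminorm_triangle[OF q(1), of "X n" x "X (s ?k)"] seminorm_nonneg[OF q(1), of "X n - x"]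
        by simp
    qed
    then show "\<exists>no. \<forall>n\<ge>no. norm (q (X n - x) - 0) < e" by blast
  qed
  then show "\<exists>x. (\<lambda>n. q (X n - x)) \<longlonglongrightarrow> 0" by blast
qed

section \<open>Dominated functionals and codimension in the bidual\<close>

definition dominated :: "('a::real_normed_vector \<Rightarrow> real) \<Rightarrow> ('a \<Rightarrow>\<^sub>L real) set" where
  "dominated q = {f. \<exists>R. \<forall>y. \<bar>blinfun_apply f y\<bar> \<le> R * q y}"

text \<open>For \<open>q\<close> the norm of \<open>T x\<close> this is the preimage, under the
  second adjoint of \<open>T\<close>, of the canonical image of \<open>Y\<close> in its
  bidual.\<close>

definition represented :: "('a::real_normed_vector \<Rightarrow> real) \<Rightarrow> (('a \<Rightarrow>\<^sub>L real) \<Rightarrow>\<^sub>L real) set" where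
  "represented q = {\<Psi>. \<exists>x. \<forall>f\<in>dominated q. blinfun_apply \<Psi> f = blinfun_apply f x}"

text \<open>For \<open>q\<close> the norm of \<open>T x\<close> under a surjection \<open>T : X \<rightarrow> Y\<close>, the set \<open>dominated q\<close> is the image
  of the dual of \<open>Y\<close> in the dual of \<open>X\<close>, and \<open>finite_corank q\<close> says that \<open>Y\<close> is quasireflexive.\<close>

definition finite_corank :: "('a::real_normed_vector \<Rightarrow> real) \<Rightarrow> bool" where
  "finite_corank q \<longleftrightarrow> (\<exists>B. finite B \<and> (\<forall>\<Psi>. \<exists>b\<in>span B. \<Psi> - b \<in> represented q))"

lemma subspace_dominated:
  assumes "seminorm q"
  shows "subspace (dominated q)"
proof (rule subspaceI)
  show "0 \<in> dominated q" by (auto simp: dominated_def intro: exI[of _ 0])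
  show "f + g \<in> dominated q" if fg: "f \<in> dominated q" "g \<in> dominated q" for f g
  proof -
    obtain R S where R: "\<And>y. \<bar>blinfun_apply f y\<bar> \<le> R * q y" and S: "\<And>y. \<bar>blinfun_apply g y\<bar> \<le> S * q y"
      using fg by (auto simp: dominated_def)
    have "\<bar>blinfun_apply (f + g) y\<bar> \<le> (R + S) * q y" for y
      using R[of y] S[of y] by (simp add: blinfun.add_left distrib_right)
    then show ?thesis by (auto simp: dominated_def)
  qed
  show "c *\<^sub>R f \<in> dominated q" if f: "f \<in> dominated q" for c f
  proof -
    obtain R where R: "\<And>y. \<bar>blinfun_apply f y\<bar> \<le> R * q y" using f by (auto simp: dominated_def)
    have "\<bar>blinfun_apply (c *\<^sub>R f) y\<bar> \<le> (\<bar>c\<bar> * R) * q y" for y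
      using mult_left_mono[OF R[of y], of "\<bar>c\<bar>"] by (simp add: blinfun.scaleR_left abs_mult mult.assoc)
    then show ?thesis by (auto simp: dominated_def)
  qed
qed

lemma subspace_represented: "subspace (represented q)"
proof (rule subspaceI)
  show "0 \<in> represented q" by (auto simp: represented_def intro: exI[of _ 0])
  show "\<Phi> + \<Psi> \<in> represented q" if "\<Phi> \<in> represented q" "\<Psi> \<in> represented q" for \<Phi> \<Psi>
    using that by (auto simp: represented_def blinfun.add_left blinfun.add_right[symmetric])
  show "c *\<^sub>R \<Psi> \<in> represented q" if \<Psi>: "\<Psi> \<in> represented q" for c \<Psi>
  proof -
    obtain x where "\<forall>f\<in>dominated q. blinfun_apply \<Psi> f = blinfun_apply f x"
      using \<Psi> by (auto simp: represented_def)
    then have "\<forall>f\<in>dominated q. blinfun_apply (c *\<^sub>R \<Psi>) f = blinfun_apply f (c *\<^sub>R x)"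
      by (simp add: blinfun.scaleR_left blinfun.scaleR_right)
    then show ?thesis by (auto simp: represented_def)
  qed
qed

text \<open>Modulo \<open>represented q\<close>, the first \<open>card B + 1\<close> of the \<Phi> k
  equal vectors in the span of \<open>B\<close>, which are dependent.\<close>

lemma not_finite_corankI:
  fixes \<Phi> :: "nat \<Rightarrow> ('a::real_normed_vector \<Rightarrow>\<^sub>L real) \<Rightarrow>\<^sub>L real"
  assumes indep: "\<And>N t. (\<Sum>k\<le>N. t k *\<^sub>R \<Phi> k) \<in> represented q \<Longrightarrow> \<forall>k\<le>N. t k = 0"
  shows "\<not> finite_corank q"
proof
  assume "finite_corank q"
  then obtain B where B: "finite B" "\<And>\<Psi>. \<exists>b\<in>span B. \<Psi> - b \<in> represented q"
    by (auto simp: finite_corank_def)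
  then have "\<forall>k. \<exists>b. b \<in> span B \<and> \<Phi> k - b \<in> represented q" by blast
  then obtain b where b: "\<And>k. b k \<in> span B" "\<And>k. \<Phi> k - b k \<in> represented q" by metis
  obtain t where t: "\<exists>k\<le>card B. t k \<noteq> 0" "(\<Sum>k\<le>card B. t k *\<^sub>R b k) = 0"
    using nontrivial_vanishing_combination[of B b] B(1) b(1) by blast
  have "(\<Sum>k\<le>card B. t k *\<^sub>R (\<Phi> k - b k)) \<in> represented q"
    using b(2) by (intro subspace_sum subspace_scale subspace_represented)
  then have "(\<Sum>k\<le>card B. t k *\<^sub>R \<Phi> k) \<in> represented q"
    using t(2) by (simp add: scaleR_diff_right sum_subtractf)
  then show False using indep t(1) by blast
qed

text \<open>Helly's theorem. If \<open>v0\<close> had distance at least \<open>D\<close> from the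
  common kernel, Hahn-Banach would give a functional of norm at most 1 that vanishes there and
  equals \<open>D\<close> at \<open>v0\<close>; on \<open>S\<close> it is a combination of the
  \<phi> i, against the bound \<open>C\<close>.\<close>

lemma Helly_interpolation:
  fixes \<phi> :: "'i \<Rightarrow> 'v::real_normed_vector \<Rightarrow> real"
  assumes I: "finite I" and S: "subspace S" and lin: "\<And>i. i \<in> I \<Longrightarrow> linear (\<phi> i)" and v0: "v0 \<in> S"
    and C: "\<And>l. \<forall>v\<in>S. \<bar>\<Sum>i\<in>I. l i * \<phi> i v\<bar> \<le> norm v \<Longrightarrow> \<bar>\<Sum>i\<in>I. l i * \<phi> i v0\<bar> \<le> C"
    and e: "0 \<le> C" "C < D"
  shows "\<exists>v\<in>S. (\<forall>i\<in>I. \<phi> i v = \<phi> i v0) \<and> norm v < D"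
proof (rule ccontr)
  assume no: "\<not> ?thesis"
  define K where "K = {v \<in> S. \<forall>i\<in>I. \<phi> i v = 0}"
  have K: "subspace K" unfolding K_def using S lin
    by (auto simp: subspace_def linear_0 linear_add linear_scale)
  have "D \<le> norm (v0 - j)" if j: "j \<in> K" for j
  proof -
    have "v0 - j \<in> S" "\<forall>i\<in>I. \<phi> i (v0 - j) = \<phi> i v0"
      using j v0 S lin by (auto simp: K_def linear_diff subspace_diff)
    then show ?thesis using no by (meson not_le)
  qed
  then obtain F where F: "linear F" "\<forall>x. \<bar>F x\<bar> \<le> norm x" "\<forall>j\<in>K. F j = 0" "F v0 = D"
    using Hahn_Banach_distance[OF seminorm_norm K, of D v0] e by auto
  have "\<exists>c. \<forall>v\<in>S. F v = (\<Sum>i\<in>I. c i * \<phi> i v)"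
    using I S lin F by (intro common_kernel_combination) (auto simp: K_def)
  then obtain c where c: "\<forall>v\<in>S. F v = (\<Sum>i\<in>I. c i * \<phi> i v)" by blast
  have "\<forall>v\<in>S. \<bar>\<Sum>i\<in>I. c i * \<phi> i v\<bar> \<le> norm v"
    using F(2) by (auto simp: c[rule_format, symmetric])
  then have "\<bar>F v0\<bar> \<le> C" using C[of c] c v0 by simp
  then show False using F(4) e by simp
qed

section \<open>From a total nowhere norming subspace to a quotient seminorm\<close>

lemma separable_dense_sequence:
  assumes "separable_space (euclidean :: 'a::real_normed_vector topology)"
  obtains d :: "nat \<Rightarrow> 'a::real_normed_vector" where "\<And>x e. e > 0 \<Longrightarrow> \<exists>n. norm (x - d n) < e"
proof -
  obtain C :: "'a set" where C: "countable C" "closure C = UNIV"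
    using assms by (auto simp: separable_space_def)
  then have "C \<noteq> {}" by auto
  then have d: "range (from_nat_into C) = C" using C(1) by (rule range_from_nat_into)
  have "\<exists>n. norm (x - from_nat_into C n) < e" if e: "e > 0" for x e
  proof -
    have "x \<in> closure C" using C(2) by simp
    then obtain y where "y \<in> C" "dist y x < e" using e by (auto simp: closure_approachable)
    then show ?thesis using d by (metis dist_norm dist_commute rangeE)
  qed
  then show ?thesis by (rule that)
qed

lemma span_range_nat:
  assumes "x \<in> span (range (g :: nat \<Rightarrow> 'v::real_vector))"
  shows "\<exists>N u. x = (\<Sum>i<N. u i *\<^sub>R g i)"
proof -
  let ?V = "{x. \<exists>N u. x = (\<Sum>i<N. u i *\<^sub>R g i)}"
  have "subspace ?V"
  proof (rule subspaceI)
    show "0 \<in> ?V" by (auto intro: exI[of _ 0])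
    show "x + y \<in> ?V" if xy: "x \<in> ?V" "y \<in> ?V" for x y
    proof -
      obtain N u N' u' where x: "x = (\<Sum>i<N. u i *\<^sub>R g i)" and y: "y = (\<Sum>i<N'. u' i *\<^sub>R g i)"
        using xy by auto
      have pad: "(\<Sum>i<n. v i *\<^sub>R g i) = (\<Sum>i<m. (if i < n then v i else 0) *\<^sub>R g i)"
        if "n \<le> m" for n m and v :: "nat \<Rightarrow> real"
        using that by (intro sum.mono_neutral_cong_left) auto
      let ?m = "max N N'"
      have "x + y = (\<Sum>i<?m. ((if i < N then u i else 0) + (if i < N' then u' i else 0)) *\<^sub>R g i)"
        unfolding x y pad[of N ?m, OF max.cobounded1] pad[of N' ?m, OF max.cobounded2]
        by (simp only: scaleR_add_left sum.distrib)
      then show ?thesis by (intro CollectI exI)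
    qed
    show "c *\<^sub>R x \<in> ?V" if x: "x \<in> ?V" for c x
    proof -
      obtain N u where "x = (\<Sum>i<N. u i *\<^sub>R g i)" using x by auto
      then have "c *\<^sub>R x = (\<Sum>i<N. (c * u i) *\<^sub>R g i)" by (simp add: scaleR_right.sum)
      then show ?thesis by (intro CollectI exI)
    qed
  qed
  moreover have "g j \<in> ?V" for j
  proof -
    have "g j = (\<Sum>i<Suc j. (if i = j then 1 else 0) *\<^sub>R g i)"
      by (simp add: if_distrib[of "\<lambda>c. c *\<^sub>R _"] cong: if_cong)
    then show ?thesis by (intro CollectI exI)
  qed
  then have "range g \<subseteq> ?V" by auto
  ultimately have "span (range g) \<subseteq> ?V" by (intro span_minimal)
  then show ?thesis using assms by blast
qed

lemma total_subspace_eq_zero: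
  assumes "total_subspace M" "dual_seminorm M x = 0"
  shows "x = 0"
proof (rule ccontr)
  assume "x \<noteq> 0"
  then obtain f where "f \<in> M" "blinfun_apply f x \<noteq> 0" using assms(1) by (auto simp: total_subspace_def)
  then show False using dual_seminorm_bound[of M f x] assms
    by (simp add: total_subspace_def closed_subspace_def)
qed

section \<open>Small functionals, interpolation and lifting of finitely many values\<close>

text \<open>Otherwise \<open>dual_bound_imp_lifting\<close> applies on the common kernel
  \<open>L\<close> of \<open>A\<close> with constant \<open>1 / \<eta>\<close>. As \<open>M\<close>
  is total, its seminorm is a norm, so the lift of \<open>x\<close> is \<open>x\<close> itself and
  the two norms are equivalent on the infinite-dimensional \<open>L\<close>.\<close>

lemma small_functional_exists:
  fixes M :: "('a::banach \<Rightarrow>\<^sub>L real) set"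
  assumes M: "total_subspace M" "nowhere_dominating (dual_seminorm M)"
    and inf: "infinite_dimensional (UNIV :: 'a set)"
    and A: "finite A" "\<And>g. g \<in> A \<Longrightarrow> \<exists>R. \<forall>y. \<bar>blinfun_apply g y\<bar> \<le> R * dual_seminorm M y"
    and \<eta>: "\<eta> > 0"
  shows "\<exists>x \<gamma> R. norm \<gamma> \<le> \<eta> \<and> (\<forall>y. \<bar>blinfun_apply \<gamma> y\<bar> \<le> R * dual_seminorm M y) \<and>
      blinfun_apply \<gamma> x = 1 \<and> dual_seminorm M x \<le> 1 \<and> (\<forall>g\<in>A. blinfun_apply g x = 0)"
proof -
  let ?q = "dual_seminorm M"
  have Ms: "subspace M" using M(1) by (simp add: total_subspace_def closed_subspace_def)
  have q: "seminorm ?q" "\<And>x. ?q x \<le> 1 * norm x"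
    using seminorm_dual_seminorm[OF Ms] dual_seminorm_le_norm[OF Ms] by auto
  define L where "L = {x. \<forall>g\<in>A. blinfun_apply g x = 0}"
  have L: "closed_subspace L"
  proof -
    have "L = (\<Inter>g\<in>A. {x. blinfun_apply g x = 0})" by (auto simp: L_def)
    also have "closed \<dots>" by (intro closed_INT ballI closed_Collect_eq continuous_intros)
    finally have "closed L" .
    moreover have "subspace L"
      by (auto simp: L_def subspace_def blinfun.add_right blinfun.scaleR_right)
    ultimately show ?thesis by (simp add: closed_subspace_def)
  qed
  have Linf: "infinite_dimensional L"
    using infinite_dimensional_Int_kernels[OF A(1) subspace_UNIV linear_blinfun_apply inf]
    by (simp add: L_def)
  have "\<exists>f R x. linear f \<and> (\<forall>y. \<bar>f y\<bar> \<le> R * ?q y) \<and> (\<forall>w\<in>L. \<bar>f w\<bar> \<le> norm w) \<and> x \<in> L \<and> 1 / \<eta> * ?q x < \<bar>f x\<bar>"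
  proof (rule ccontr)
    assume no: "\<not> ?thesis"
    have "norm x \<le> 4 * (1 / \<eta>) * ?q x" if x: "x \<in> L" for x
    proof -
      have "\<exists>w\<in>L. norm w \<le> 4 * (1 / \<eta>) * ?q x \<and> ?q (x - w) = 0"
      proof (rule dual_bound_imp_lifting[OF q L _ _ x])
        fix f R x
        assume "linear f" "\<And>y. \<bar>f y\<bar> \<le> R * ?q y" "\<And>w. w \<in> L \<Longrightarrow> \<bar>f w\<bar> \<le> norm w" "x \<in> L"
        then show "\<bar>f x\<bar> \<le> 1 / \<eta> * ?q x" using no by (meson not_le)
      qed (use \<eta> in simp)
      then show ?thesis using total_subspace_eq_zero[OF M(1)] by force
    qed
    moreover have "\<exists>x\<in>L. ?q x < \<eta> / 4 * norm x"
      using M(2) L Linf \<eta> unfolding nowhere_dominating_def by (meson divide_pos_pos zero_less_numeral)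
    ultimately show False using \<eta> by (fastforce simp: field_simps)
  qed
  then obtain f R x where f: "linear f" "\<And>y. \<bar>f y\<bar> \<le> R * ?q y" "\<And>w. w \<in> L \<Longrightarrow> \<bar>f w\<bar> \<le> norm w"
    and x: "x \<in> L" "1 / \<eta> * ?q x < \<bar>f x\<bar>" by blast
  \<comment> \<open>\<open>f\<close> has norm at most 1 only on \<open>L\<close>. The extension
    \<open>F\<close> differs from it by a functional vanishing on \<open>L\<close>, hence by a
    combination of \<open>A\<close>, and so stays bounded for the seminorm of
    \<open>M\<close>.\<close>
  obtain F where F: "linear F" "\<forall>y\<in>L. F y = f y" "\<forall>y. \<bar>F y\<bar> \<le> norm y"
    using Hahn_Banach_extension[OF seminorm_norm conjunct1[OF L[unfolded closed_subspace_def]] f(1) f(3)]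
    by blast
  obtain G where G: "\<And>y. blinfun_apply G y = F y" "norm G \<le> 1"
    by (rule blinfun_of_linear[of F 1]) (use F in auto)
  have "\<exists>c. \<forall>v\<in>UNIV. F v - f v = (\<Sum>g\<in>A. c g * blinfun_apply g v)"
    using F f(1) A(1)
    by (intro common_kernel_combination linear_blinfun_apply linear_compose_sub) (auto simp: L_def)
  then obtain c where c: "\<And>v. F v = f v + (\<Sum>g\<in>A. c g * blinfun_apply g v)"
    by (auto simp: algebra_simps)
  obtain r where r: "\<And>g y. g \<in> A \<Longrightarrow> \<bar>blinfun_apply g y\<bar> \<le> r g * ?q y" using A(2) by metis
  have FR: "\<bar>F y\<bar> \<le> (R + (\<Sum>g\<in>A. \<bar>c g\<bar> * r g)) * ?q y" for y
  proof -
    have "\<bar>\<Sum>g\<in>A. c g * blinfun_apply g y\<bar> \<le> (\<Sum>g\<in>A. \<bar>c g * blinfun_apply g y\<bar>)" by (rule sum_abs)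
    also have "\<dots> \<le> (\<Sum>g\<in>A. \<bar>c g\<bar> * (r g * ?q y))"
      using r by (intro sum_mono) (auto simp: abs_mult intro: mult_left_mono)
    also have "\<dots> = (\<Sum>g\<in>A. \<bar>c g\<bar> * r g) * ?q y" by (simp add: sum_distrib_right mult.assoc)
    finally show ?thesis using f(2)[of y] by (simp add: c[of y] algebra_simps)
  qed
  have "0 \<le> 1 / \<eta> * ?q x" using \<eta> seminorm_nonneg[OF q(1)] by simp
  then have fx: "f x \<noteq> 0" using x(2) by auto
  \<comment> \<open>The factor in \<open>?x\<close> normalises the value to 1; then
    \<open>1 / \<eta> * ?q x < \<bar>f x\<bar>\<close> says that \<open>?q ?x\<close> is below
    1.\<close>
  let ?\<gamma> = "\<eta> *\<^sub>R G" and ?x = "(1 / (\<eta> * f x)) *\<^sub>R x"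
  have "norm ?\<gamma> \<le> \<eta>" using G(2) \<eta> by simp
  moreover have "\<bar>blinfun_apply ?\<gamma> y\<bar> \<le> (\<eta> * (R + (\<Sum>g\<in>A. \<bar>c g\<bar> * r g))) * ?q y" for y
    using mult_left_mono[OF FR[of y], of \<eta>] \<eta> by (simp add: G blinfun.scaleR_left abs_mult mult.assoc)
  moreover have "blinfun_apply ?\<gamma> ?x = 1"
    using F(2) x(1) fx \<eta> by (simp add: G blinfun.scaleR_left linear_scale[OF F(1)])
  moreover have "?q ?x \<le> 1"
    using x(2) fx \<eta> by (simp add: seminorm_scale[OF q(1)] abs_mult field_simps)
  moreover have "\<forall>g\<in>A. blinfun_apply g ?x = 0"
    using x(1) by (simp add: L_def blinfun.scaleR_right)
  ultimately show ?thesis by blast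
qed

text \<open>By totality a linear relation between evaluations on \<open>M\<close> is a relation
  between the points, so the values of \<open>\<gamma>\<close> on \<open>F\<close> are attained in
  \<open>M\<close>. Helly's theorem with constant \<open>R\<close> then controls the norm.\<close>

lemma interpolation_in_total_subspace:
  fixes M :: "('a::real_normed_vector \<Rightarrow>\<^sub>L real) set"
  assumes M: "total_subspace M" and F: "finite F"
    and R: "0 \<le> R" "\<And>y. \<bar>blinfun_apply \<gamma> y\<bar> \<le> R * dual_seminorm M y"
  shows "\<exists>f\<in>M. (\<forall>x\<in>F. blinfun_apply f x = blinfun_apply \<gamma> x) \<and> norm f < R + 1"
proof -
  have Ms: "subspace M" using M by (simp add: total_subspace_def closed_subspace_def)
  have lin: "linear (\<lambda>f. blinfun_apply f x)" for x :: 'a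
    by (rule linearI) (auto simp: blinfun.add_left blinfun.scaleR_left)
  have comb: "(\<Sum>x\<in>F. l x * blinfun_apply f x) = blinfun_apply f (\<Sum>x\<in>F. l x *\<^sub>R x)"
    for l and f :: "'a \<Rightarrow>\<^sub>L real"
    by (simp add: blinfun.sum_right blinfun.scaleR_right)
  have "\<exists>f\<in>M. \<forall>x\<in>F. blinfun_apply f x = blinfun_apply \<gamma> x"
  proof (rule consistent_system_solvable[OF F Ms lin])
    fix l assume "\<forall>f\<in>M. (\<Sum>x\<in>F. l x * blinfun_apply f x) = 0"
    then have "(\<Sum>x\<in>F. l x *\<^sub>R x) = 0" using M unfolding comb total_subspace_def by blast
    then show "(\<Sum>x\<in>F. l x * blinfun_apply \<gamma> x) = 0" unfolding comb by simp
  qed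
  then obtain f0 where f0: "f0 \<in> M" "\<forall>x\<in>F. blinfun_apply f0 x = blinfun_apply \<gamma> x" by blast
  have "\<exists>f\<in>M. (\<forall>x\<in>F. blinfun_apply f x = blinfun_apply f0 x) \<and> norm f < R + 1"
  proof (rule Helly_interpolation[OF F Ms lin f0(1) _ R(1)])
    fix l assume l: "\<forall>f\<in>M. \<bar>\<Sum>x\<in>F. l x * blinfun_apply f x\<bar> \<le> norm f"
    let ?y = "\<Sum>x\<in>F. l x *\<^sub>R x"
    have "dual_seminorm M ?y \<le> 1"
      using l unfolding comb by (intro dual_seminorm_least[OF Ms]) force
    then have "R * dual_seminorm M ?y \<le> R" using R(1) mult_left_mono by fastforce
    moreover have "(\<Sum>x\<in>F. l x * blinfun_apply f0 x) = blinfun_apply \<gamma> ?y"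
      using f0(2) unfolding comb[symmetric] by simp
    ultimately show "\<bar>\<Sum>x\<in>F. l x * blinfun_apply f0 x\<bar> \<le> R" using R(2)[of ?y] by simp
  qed simp
  then show ?thesis using f0(2) by auto
qed

text \<open>These lifts are the source of the closed range: their norm is controlled by the first
  \<open>n + 1\<close> functionals alone. The factor 2 is slack for the strict inequality in Helly's
  theorem, which requires a positive seminorm.\<close>

lemma Helly_lift:
  fixes e :: "nat \<Rightarrow> 'a::real_normed_vector \<Rightarrow>\<^sub>L real"
  shows "\<exists>v. (\<forall>i\<le>n. blinfun_apply (e i) v = blinfun_apply (e i) x) \<and>
      norm v \<le> 2 * dual_seminorm (span (e ` {..n})) x"
proof -
  let ?C = "dual_seminorm (span (e ` {..n})) x"
  have S: "subspace (span (e ` {..n}))" by simp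
  show ?thesis
  proof (cases "?C = 0")
    case True
    have "blinfun_apply (e i) x = 0" if "i \<le> n" for i
      using dual_seminorm_bound[OF S, of "e i" x] that True by (simp add: span_base)
    then show ?thesis using True by (intro exI[of _ 0]) auto
  next
    case False
    then have C: "?C > 0" using seminorm_nonneg[OF seminorm_dual_seminorm[OF S], of x] by simp
    have "\<exists>v\<in>UNIV. (\<forall>i\<in>{..n}. blinfun_apply (e i) v = blinfun_apply (e i) x) \<and> norm v < 2 * ?C"
    proof (rule Helly_interpolation)
      fix l assume l: "\<forall>v\<in>UNIV. \<bar>\<Sum>i\<in>{..n}. l i * blinfun_apply (e i) v\<bar> \<le> norm v"
      let ?h = "\<Sum>i\<le>n. l i *\<^sub>R e i"
      have h: "blinfun_apply ?h v = (\<Sum>i\<le>n. l i * blinfun_apply (e i) v)" for v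
        by (simp add: blinfun.sum_left blinfun.scaleR_left)
      have "norm ?h \<le> 1" by (rule norm_blinfun_bound) (use l h in auto)
      moreover have "?h \<in> span (e ` {..n})" by (intro span_sum span_scale span_base) auto
      ultimately have "\<bar>blinfun_apply ?h x\<bar> \<le> ?C" by (intro dual_seminorm_upper)
      then show "\<bar>\<Sum>i\<in>{..n}. l i * blinfun_apply (e i) x\<bar> \<le> ?C" using h by simp
    qed (use C in \<open>auto intro: linear_blinfun_apply\<close>)
    then show ?thesis by (auto intro: less_imp_le)
  qed
qed

section \<open>The inductive construction\<close>

text \<open>Stage \<open>n\<close> of the construction. The functional \<open>E n\<close> is a difference \<open>f - G k\<close> with \<open>f \<in> M\<close>
  and \<open>k = fst (prod_decode n)\<close>, so that every \<open>k\<close> is used infinitely often and \<open>k \<le> n\<close>. The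
  vectors \<open>X k\<close> test the coefficients of the \<open>G k\<close>, and \<open>l n\<close> lifts \<open>d n\<close>.\<close>

definition stage ::
  "('a::real_normed_vector \<Rightarrow>\<^sub>L real) set \<Rightarrow> (nat \<Rightarrow> 'a) \<Rightarrow> (nat \<Rightarrow> 'a) \<Rightarrow> (nat \<Rightarrow> 'a \<Rightarrow>\<^sub>L real) \<Rightarrow>
    (nat \<Rightarrow> real) \<Rightarrow> (nat \<Rightarrow> 'a \<Rightarrow>\<^sub>L real) \<Rightarrow> (nat \<Rightarrow> 'a) \<Rightarrow> nat \<Rightarrow> bool" where
  "stage M d X G R E l n \<longleftrightarrow>
     norm (G n) \<le> (1 / 2) ^ n / 16 \<and>
     (\<forall>k<n. \<bar>blinfun_apply (G n) (X k)\<bar> \<le> (1 / 2) ^ n / 16) \<and>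
     0 \<le> R n \<and> (\<forall>y. \<bar>blinfun_apply (G n) y\<bar> \<le> R n * dual_seminorm M y) \<and>
     blinfun_apply (G n) (X n) = 1 \<and> dual_seminorm M (X n) \<le> 1 \<and>
     (\<forall>i<n. blinfun_apply (E i) (X n) = 0 \<and> blinfun_apply (G i) (X n) = 0) \<and>
     E n + G (fst (prod_decode n)) \<in> M \<and>
     norm (E n + G (fst (prod_decode n))) \<le> R (fst (prod_decode n)) + 1 \<and>
     (\<forall>j\<le>n. blinfun_apply (E n) (d j) = 0 \<and> blinfun_apply (E n) (X j) = 0) \<and>
     (\<forall>j<n. blinfun_apply (E n) (l j) = 0) \<and>
     (\<forall>i\<le>n. blinfun_apply (E i) (l n) = blinfun_apply (E i) (d n)) \<and>
     norm (l n) \<le> 2 * dual_seminorm (span (E ` {..n})) (d n)"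

lemma fst_prod_decode_le: "fst (prod_decode n) \<le> n"
  using le_prod_encode_1[of "fst (prod_decode n)" "snd (prod_decode n)"] by simp

text \<open>The index \<open>fst (prod_decode n)\<close> is at most \<open>n\<close>, so stage
  \<open>n\<close> looks only at entries up to \<open>n\<close> and the sequences can be built by
  recursion.\<close>

lemma stage_cong:
  assumes "\<And>j. j \<le> n \<Longrightarrow> X j = X' j" "\<And>j. j \<le> n \<Longrightarrow> G j = G' j" "\<And>j. j \<le> n \<Longrightarrow> R j = R' j"
    "\<And>j. j \<le> n \<Longrightarrow> E j = E' j" "\<And>j. j \<le> n \<Longrightarrow> l j = l' j"
  shows "stage M d X G R E l n = stage M d X' G' R' E' l' n"
proof -
  have "E ` {..n} = E' ` {..n}" using assms(4) by (intro image_cong) auto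
  then show ?thesis
    unfolding stage_def using assms fst_prod_decode_le[of n] by (simp cong: conj_cong)
qed

text \<open>Order of choice: first \<open>x\<close> and \<open>g\<close>, with all earlier
  \<open>E\<close> and \<open>G\<close> vanishing at \<open>x\<close>; then \<open>f\<close> in
  \<open>M\<close> interpolating the functional with index \<open>c\<close>, and \<open>e\<close> as
  the difference; last the lift \<open>v\<close> of \<open>d n\<close>.\<close>

lemma stage_exists:
  fixes M :: "('a::banach \<Rightarrow>\<^sub>L real) set"
  assumes M: "total_subspace M" "nowhere_dominating (dual_seminorm M)"
    and inf: "infinite_dimensional (UNIV :: 'a set)"
    and st: "\<And>k. k < n \<Longrightarrow> stage M d X G R E l k"
  shows "\<exists>x g r e v. stage M d (X(n := x)) (G(n := g)) (R(n := r)) (E(n := e)) (l(n := v)) n"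
proof -
  have Ms: "subspace M" using M(1) by (simp add: total_subspace_def closed_subspace_def)
  let ?q = "dual_seminorm M"
  define c where "c = fst (prod_decode n)"
  have c: "c \<le> n" unfolding c_def by (rule fst_prod_decode_le)
  have Gb: "\<exists>r. \<forall>y. \<bar>blinfun_apply (G k) y\<bar> \<le> r * ?q y" if "k < n" for k
    using st[OF that] by (auto simp: stage_def)
  \<comment> \<open>An earlier \<open>E k\<close> is a member of \<open>M\<close> minus some
    \<open>G\<close>, so it is bounded for the seminorm of \<open>M\<close> and may enter the finite
    set in \<open>small_functional_exists\<close>.\<close>
  have Eb: "\<exists>r. \<forall>y. \<bar>blinfun_apply (E k) y\<bar> \<le> r * ?q y" if k: "k < n" for k
  proof -
    let ?c = "fst (prod_decode k)"
    have mem: "E k + G ?c \<in> M" using st[OF k] by (simp add: stage_def)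
    obtain r where r: "\<And>y. \<bar>blinfun_apply (G ?c) y\<bar> \<le> r * ?q y"
      using Gb[of ?c] fst_prod_decode_le[of k] k by auto
    have "\<bar>blinfun_apply (E k) y\<bar> \<le> (norm (E k + G ?c) + r) * ?q y" for y
      using dual_seminorm_bound[OF Ms mem, of y] r[of y]
      by (simp add: blinfun.add_left distrib_right)
    then show ?thesis by blast
  qed
  \<comment> \<open>The denominator keeps both the norm of \<open>g\<close> and its values at the
    earlier \<open>X k\<close> at most \<open>(1 / 2) ^ n / 16\<close>.\<close>
  define \<eta> where "\<eta> = (1 / 2) ^ n / 16 / (1 + (\<Sum>k<n. norm (X k)))"
  have s0: "0 \<le> (\<Sum>k<n. norm (X k))" by (intro sum_nonneg) auto
  then have \<eta>: "\<eta> > 0" by (simp add: \<eta>_def add_pos_nonneg)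
  have \<eta>': "\<eta> * (1 + (\<Sum>k<n. norm (X k))) = (1 / 2) ^ n / 16"
    using s0 unfolding \<eta>_def by (intro nonzero_eq_divide_eq[THEN iffD1]) (linarith, rule refl)
  have "\<exists>x g r. norm g \<le> \<eta> \<and> (\<forall>y. \<bar>blinfun_apply g y\<bar> \<le> r * ?q y) \<and>
      blinfun_apply g x = 1 \<and> ?q x \<le> 1 \<and> (\<forall>h\<in>E ` {..<n} \<union> G ` {..<n}. blinfun_apply h x = 0)"
  proof (rule small_functional_exists[OF M inf _ _ \<eta>])
    show "\<exists>r. \<forall>y. \<bar>blinfun_apply h y\<bar> \<le> r * ?q y" if "h \<in> E ` {..<n} \<union> G ` {..<n}" for h
      using that Gb Eb by blast
  qed simp
  then obtain x g r where g: "norm g \<le> \<eta>" "\<And>y. \<bar>blinfun_apply g y\<bar> \<le> r * ?q y" "blinfun_apply g x = 1"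
    and x: "?q x \<le> 1" "\<And>i. i < n \<Longrightarrow> blinfun_apply (E i) x = 0 \<and> blinfun_apply (G i) x = 0"
    by (metis UnI1 UnI2 imageI lessThan_iff)
  have gr: "\<bar>blinfun_apply g y\<bar> \<le> \<bar>r\<bar> * ?q y" for y
  proof -
    have "r * ?q y \<le> \<bar>r\<bar> * ?q y"
      using seminorm_nonneg[OF seminorm_dual_seminorm[OF Ms]] by (intro mult_right_mono) auto
    then show ?thesis using g(2)[of y] by simp
  qed
  have gs: "norm g \<le> (1 / 2) ^ n / 16"
  proof -
    have "norm g \<le> \<eta> * 1" using g(1) by simp
    also have "\<dots> \<le> \<eta> * (1 + (\<Sum>k<n. norm (X k)))" using \<eta> s0 by (intro mult_left_mono) auto
    finally show ?thesis using \<eta>' by simp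
  qed
  have gX: "\<bar>blinfun_apply g (X k)\<bar> \<le> (1 / 2) ^ n / 16" if "k < n" for k
  proof -
    have "\<bar>blinfun_apply g (X k)\<bar> \<le> norm g * norm (X k)" by (rule abs_blinfun_apply_le)
    also have "\<dots> \<le> \<eta> * norm (X k)" using g(1) by (intro mult_right_mono) auto
    also have "\<dots> \<le> \<eta> * (1 + (\<Sum>k<n. norm (X k)))"
      using \<eta> that member_le_sum[of k "{..<n}" "\<lambda>k. norm (X k)"] by (intro mult_left_mono) auto
    finally show ?thesis using \<eta>' by simp
  qed
  let ?X = "X(n := x)" and ?G = "G(n := g)" and ?R = "R(n := \<bar>r\<bar>)"
  \<comment> \<open>The index \<open>c\<close> may be \<open>n\<close> itself, hence the updated
    sequences.\<close>
  have Rc: "0 \<le> ?R c" "\<And>y. \<bar>blinfun_apply (?G c) y\<bar> \<le> ?R c * ?q y"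
    using st[of c] c gr by (auto simp: stage_def)
  have "\<exists>f\<in>M. (\<forall>y\<in>d ` {..n} \<union> ?X ` {..n} \<union> l ` {..<n}. blinfun_apply f y = blinfun_apply (?G c) y) \<and>
      norm f < ?R c + 1"
    by (rule interpolation_in_total_subspace[OF M(1) _ Rc]) auto
  then obtain f where f: "f \<in> M" "norm f < ?R c + 1"
      "\<And>y. y \<in> d ` {..n} \<union> ?X ` {..n} \<union> l ` {..<n} \<Longrightarrow> blinfun_apply f y = blinfun_apply (?G c) y" by blast
  define e where "e = f - ?G c"
  let ?E = "E(n := e)"
  have e0: "blinfun_apply e y = 0" if "y \<in> d ` {..n} \<union> ?X ` {..n} \<union> l ` {..<n}" for y
    using f(3)[OF that] by (simp add: e_def blinfun.diff_left)
  obtain v where v: "\<And>i. i \<le> n \<Longrightarrow> blinfun_apply (?E i) v = blinfun_apply (?E i) (d n)"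
      "norm v \<le> 2 * dual_seminorm (span (?E ` {..n})) (d n)"
    using Helly_lift[of n ?E "d n"] by blast
  have "stage M d ?X ?G ?R ?E (l(n := v)) n"
    unfolding stage_def c_def[symmetric]
  proof (intro conjI allI impI)
    show "blinfun_apply (?E n) (d j) = 0" if "j \<le> n" for j using that by (simp add: e0)
    show "blinfun_apply (?E n) (?X j) = 0" if "j \<le> n" for j using that e0[of "?X j"] by simp
    show "blinfun_apply (?E n) ((l(n := v)) j) = 0" if "j < n" for j using that by (simp add: e0)
  qed (use gs gX gr g(3) x f v in \<open>auto simp: e_def\<close>)
  then show ?thesis by blast
qed

lemma stages_exist:
  fixes M :: "('a::banach \<Rightarrow>\<^sub>L real) set"
  assumes M: "total_subspace M" "nowhere_dominating (dual_seminorm M)"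
    and inf: "infinite_dimensional (UNIV :: 'a set)"
  shows "\<exists>X G R E l. \<forall>n. stage M d X G R E l n"
proof -
  define st where "st f n = stage M d (\<lambda>j. fst (f j)) (\<lambda>j. fst (snd (f j))) (\<lambda>j. fst (snd (snd (f j))))
      (\<lambda>j. fst (snd (snd (snd (f j))))) (\<lambda>j. snd (snd (snd (snd (f j))))) n"
    for f :: "nat \<Rightarrow> 'a \<times> ('a \<Rightarrow>\<^sub>L real) \<times> real \<times> ('a \<Rightarrow>\<^sub>L real) \<times> 'a" and n
  have st_cong: "st f n = st g n" if "\<And>j. j \<le> n \<Longrightarrow> f j = g j" for f g n
    unfolding st_def using that by (intro stage_cong) auto
  \<comment> \<open>All entries from \<open>n\<close> on are replaced by the candidate
    \<open>r\<close>. Stage \<open>n\<close> reads only indices up to \<open>n\<close>, so this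
    amounts to an update at \<open>n\<close>, and \<open>P f n r\<close> depends on \<open>f\<close>
    only below \<open>n\<close>, as well-founded choice demands.\<close>
  define P where "P f n r \<longleftrightarrow> st (\<lambda>j. if j < n then f j else r) n" for f n r
  have P: "P f n (f n) = st f n" for f n unfolding P_def by (rule st_cong) auto
  have "\<exists>f. \<forall>n. P f n (f n)"
  proof (rule dependent_wf_choice[OF wf_less_than])
    show "P f n r = P g n r" if "\<And>z. (z, n) \<in> less_than \<Longrightarrow> f z = g z" for f g n r
    proof -
      have "(\<lambda>j. if j < n then f j else r) = (\<lambda>j. if j < n then g j else r)" using that by auto
      then show ?thesis by (simp add: P_def)
    qed
    show "\<exists>r. P f n r" if prev: "\<And>y. (y, n) \<in> less_than \<Longrightarrow> P f y (f y)" for n f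
    proof -
      have "st f k" if "k < n" for k using prev[of k] that P by simp
      then obtain x g r e v where s: "stage M d ((\<lambda>j. fst (f j))(n := x)) ((\<lambda>j. fst (snd (f j)))(n := g))
          ((\<lambda>j. fst (snd (snd (f j))))(n := r)) ((\<lambda>j. fst (snd (snd (snd (f j)))))(n := e))
          ((\<lambda>j. snd (snd (snd (snd (f j)))))(n := v)) n"
        using stage_exists[OF M inf, of n d "\<lambda>j. fst (f j)" "\<lambda>j. fst (snd (f j))"
            "\<lambda>j. fst (snd (snd (f j)))" "\<lambda>j. fst (snd (snd (snd (f j))))" "\<lambda>j. snd (snd (snd (snd (f j))))"]
        unfolding st_def by blast
      have "P f n (x, g, r, e, v)"
        unfolding P_def st_def by (rule stage_cong[THEN iffD1, OF _ _ _ _ _ s]) auto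
      then show ?thesis by blast
    qed
  qed
  then obtain f where "\<forall>n. st f n" using P by auto
  then show ?thesis unfolding st_def by blast
qed

section \<open>The quotient seminorm\<close>

theorem quotient_seminorm_exists:
  fixes M :: "('a::banach \<Rightarrow>\<^sub>L real) set" and d :: "nat \<Rightarrow> 'a"
  assumes M: "total_subspace M" "nowhere_dominating (dual_seminorm M)"
    and inf: "infinite_dimensional (UNIV :: 'a set)"
    and d: "\<And>x e. e > 0 \<Longrightarrow> \<exists>n. norm (x - d n) < e"
  obtains q :: "'a \<Rightarrow> real" and C where "seminorm q" "\<And>x. q x \<le> norm x" "nowhere_dominating q"
    "\<And>x. \<exists>w. norm w \<le> C * q x \<and> q (x - w) = 0" "\<not> finite_corank q"
proof -
  have Ms: "subspace M" using M(1) by (simp add: total_subspace_def closed_subspace_def)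
  obtain X G R E l where st: "\<And>n. stage M d X G R E l n" using stages_exist[OF M inf] by blast
  define c where "c n = fst (prod_decode n)" for n
  have cle: "c n \<le> n" for n unfolding c_def by (rule fst_prod_decode_le)
  have Gn: "norm (G n) \<le> (1 / 2) ^ n / 16" for n using st[of n] by (simp add: stage_def)
  \<comment> \<open>For \<open>n < k\<close> the value is 0 by the choice of \<open>X k\<close>; for
    \<open>n > k\<close> it is small by the choice of \<open>G n\<close>.\<close>
  have GX: "\<bar>blinfun_apply (G n) (X k)\<bar> \<le> (1 / 2) ^ n / 16" if "n \<noteq> k" for n k
    using that st[of n] st[of k] by (cases n k rule: linorder_cases) (auto simp: stage_def)
  have GX1: "blinfun_apply (G n) (X n) = 1" and X1: "dual_seminorm M (X n) \<le> 1" for n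
    using st[of n] by (auto simp: stage_def)
  have EX: "blinfun_apply (E n) (X k) = 0" for n k
    using st[of n] st[of k] by (cases "n < k") (auto simp: stage_def)
  have EG: "E n + G (c n) \<in> M" "norm (E n + G (c n)) \<le> R (c n) + 1" for n
    using st[of n] by (auto simp: stage_def c_def)
  have Ed: "blinfun_apply (E n) (d j) = 0" if "j \<le> n" for n j
    using st[of n] that by (auto simp: stage_def)
  \<comment> \<open>For \<open>n \<le> j\<close> the lift was chosen so; for larger \<open>n\<close>
    both sides vanish, since \<open>E n\<close> was made to vanish at \<open>d j\<close> and
    \<open>l j\<close>.\<close>
  have El: "blinfun_apply (E n) (l j) = blinfun_apply (E n) (d j)" for n j
    using st[of n] st[of j] by (cases "n \<le> j") (auto simp: stage_def)
  have ln: "norm (l n) \<le> 2 * dual_seminorm (span (E ` {..n})) (d n)" for n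
    using st[of n] by (simp add: stage_def)
  have geo: "(\<Sum>i<N. (1 / 2 :: real) ^ i / 16) \<le> 1 / 8" for N
  proof -
    have "(\<Sum>i<N. (1 / 2 :: real) ^ i) \<le> (\<Sum>i. (1 / 2) ^ i)"
      by (intro sum_le_suminf summable_geometric) auto
    then show ?thesis by (simp add: suminf_geometric sum_divide_distrib[symmetric])
  qed
  \<comment> \<open>Testing \<open>z\<close>, which vanishes at every \<open>X k\<close>, bounds the coefficients of the \<open>G k\<close> in \<open>z\<close>.\<close>
  have key: "\<exists>s m. m \<in> M \<and> z = m - (\<Sum>k<N. s k *\<^sub>R G k) \<and> norm m \<le> 2 * norm z \<and>
      (\<forall>k. s k = (\<Sum>i<N. if c i = k then u i else 0)) \<and> (\<forall>k. \<bar>s k\<bar> \<le> 2 * norm z)"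
    if z: "z = (\<Sum>i<N. u i *\<^sub>R E i)" for z N u
  proof -
    define s where "s k = (\<Sum>i<N. if c i = k then u i else 0)" for k
    define m where "m = (\<Sum>i<N. u i *\<^sub>R (E i + G (c i)))"
    have mM: "m \<in> M" unfolding m_def using EG Ms by (intro subspace_sum subspace_scale)
    have "(\<Sum>i<N. u i *\<^sub>R G (c i)) = (\<Sum>i<N. \<Sum>k<N. (if c i = k then u i else 0) *\<^sub>R G k)"
    proof (rule sum.cong)
      fix i assume "i \<in> {..<N}"
      then have "c i < N" using cle[of i] by simp
      then show "u i *\<^sub>R G (c i) = (\<Sum>k<N. (if c i = k then u i else 0) *\<^sub>R G k)"
        by (simp add: if_distrib[of "\<lambda>r. r *\<^sub>R _"] cong: if_cong)
    qed simp
    also have "\<dots> = (\<Sum>k<N. s k *\<^sub>R G k)"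
      unfolding s_def by (subst sum.swap) (simp add: scaleR_sum_left)
    finally have zm: "z = m - (\<Sum>k<N. s k *\<^sub>R G k)"
      by (simp add: z m_def scaleR_add_right sum.distrib)
    have s0: "s k = 0" if "N \<le> k" for k
      unfolding s_def
    proof (rule sum.neutral, rule ballI)
      fix i assume "i \<in> {..<N}"
      then have "c i \<noteq> k" using cle[of i] that by simp
      then show "(if c i = k then u i else 0) = 0" by simp
    qed
    define S where "S = Max (insert 0 ((\<lambda>k. \<bar>s k\<bar>) ` {..<N}))"
    have fin: "finite (insert 0 ((\<lambda>k. \<bar>s k\<bar>) ` {..<N}))" by simp
    have S0: "0 \<le> S" unfolding S_def by (rule Max_ge[OF fin]) simp
    have sS: "\<bar>s k\<bar> \<le> S" for k
    proof (cases "k < N")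
      case True
      then show ?thesis unfolding S_def by (intro Max_ge[OF fin]) auto
    qed (use s0 S0 in simp)
    have small: "\<bar>\<Sum>k<N. a k\<bar> \<le> S / 8" if "\<And>k. k < N \<Longrightarrow> \<bar>a k\<bar> \<le> S * ((1 / 2) ^ k / 16)" for a
    proof -
      have "\<bar>\<Sum>k<N. a k\<bar> \<le> (\<Sum>k<N. S * ((1 / 2) ^ k / 16))" using that by (intro order.trans[OF sum_abs] sum_mono) auto
      also have "\<dots> = S * (\<Sum>k<N. (1 / 2) ^ k / 16)" by (simp add: sum_distrib_left)
      also have "\<dots> \<le> S * (1 / 8)" using S0 geo by (intro mult_left_mono) auto
      finally show ?thesis by simp
    qed
    have sb: "\<bar>s k * t\<bar> \<le> S * ((1 / 2) ^ k / 16)" if "\<bar>t\<bar> \<le> (1 / 2) ^ k / 16" for k t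
      unfolding abs_mult by (rule mult_mono) (use sS S0 that in auto)
    have nm: "norm m \<le> norm z + S / 8"
    proof -
      have "norm (\<Sum>k<N. s k *\<^sub>R G k) \<le> (\<Sum>k<N. norm (s k *\<^sub>R G k))" by (rule norm_sum)
      also have "\<dots> \<le> \<bar>\<Sum>k<N. norm (s k *\<^sub>R G k)\<bar>" by simp
      also have "\<dots> \<le> S / 8"
      proof (rule small)
        fix k
        show "\<bar>norm (s k *\<^sub>R G k)\<bar> \<le> S * ((1 / 2) ^ k / 16)"
          using sb[of "norm (G k)" k] Gn[of k] by (simp add: abs_mult)
      qed
      finally have "norm (\<Sum>k<N. s k *\<^sub>R G k) \<le> S / 8" .
      moreover have "m = z + (\<Sum>k<N. s k *\<^sub>R G k)" using zm by simp
      ultimately show ?thesis using norm_triangle_ineq[of z "\<Sum>k<N. s k *\<^sub>R G k"] by simp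
    qed
    \<comment> \<open>At \<open>X k\<close> the functional \<open>z\<close> vanishes and
      \<open>G k\<close> is 1, so \<open>s k\<close> is the value of \<open>m\<close> up to at most
      \<open>S / 8\<close> from the other terms. With the bound on \<open>norm m\<close> this gives
      \<open>S \<le> norm z + S / 4\<close>, and \<open>S\<close> is absorbed.\<close>
    have sk: "\<bar>s k\<bar> \<le> norm z + S / 4" if k: "k < N" for k
    proof -
      have "blinfun_apply z (X k) = 0" by (simp add: z blinfun.sum_left blinfun.scaleR_left EX)
      then have "blinfun_apply m (X k) = (\<Sum>i<N. s i * blinfun_apply (G i) (X k))"
        by (simp add: zm blinfun.sum_left blinfun.scaleR_left blinfun.diff_left)
      also have "\<dots> = (\<Sum>i<N. (if i = k then s k else 0) + (if i = k then 0 else s i * blinfun_apply (G i) (X k)))"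
        using GX1 by (intro sum.cong) auto
      also have "\<dots> = s k + (\<Sum>i<N. if i = k then 0 else s i * blinfun_apply (G i) (X k))"
        using k by (simp add: sum.distrib)
      finally have "\<bar>s k\<bar> \<le> \<bar>blinfun_apply m (X k)\<bar>
          + \<bar>\<Sum>i<N. if i = k then 0 else s i * blinfun_apply (G i) (X k)\<bar>" by linarith
      moreover have "\<bar>\<Sum>i<N. if i = k then 0 else s i * blinfun_apply (G i) (X k)\<bar> \<le> S / 8"
      proof (rule small)
        fix i
        show "\<bar>if i = k then 0 else s i * blinfun_apply (G i) (X k)\<bar> \<le> S * ((1 / 2) ^ i / 16)"
          using sb[OF GX, of i k] S0 by simp
      qed
      moreover have "\<bar>blinfun_apply m (X k)\<bar> \<le> norm m"
        using dual_seminorm_bound[OF Ms mM, of "X k"] mult_left_mono[OF X1[of k] norm_ge_zero[of m]] by simp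
      ultimately show ?thesis using nm by linarith
    qed
    have "S \<in> insert 0 ((\<lambda>k. \<bar>s k\<bar>) ` {..<N})" unfolding S_def by (rule Max_in[OF fin]) simp
    then have "S \<le> norm z + S / 4" using sk by auto
    then have "S \<le> 2 * norm z" using norm_ge_zero[of z] by linarith
    then have "norm m \<le> 2 * norm z" "\<forall>k. \<bar>s k\<bar> \<le> 2 * norm z"
      using nm norm_ge_zero[of z] sS by (linarith, meson order.trans)
    then show ?thesis using mM zm s_def by blast
  qed
  define Z where "Z = span (range E)"
  define q where "q = dual_seminorm Z"
  have Zs: "subspace Z" by (simp add: Z_def)
  have EZ: "E n \<in> Z" for n by (simp add: Z_def span_base)
  have q: "seminorm q" and qn: "q x \<le> norm x" for x
    using seminorm_dual_seminorm[OF Zs] dual_seminorm_le_norm[OF Zs] by (auto simp: q_def)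
  have sumG: "summable (\<lambda>k. norm (G k))"
    by (rule summable_comparison_test'[of "\<lambda>n. (1 / 2) ^ n / 16" 0])
      (use Gn in \<open>auto intro: summable_divide summable_geometric\<close>)
  \<comment> \<open>By \<open>key\<close>, each \<open>z\<close> in the unit ball of
    \<open>Z\<close> is a member of \<open>M\<close> of norm at most 2 minus a combination of the
    \<open>G k\<close> with coefficients at most 2; the combination accounts for the nuclear
    term.\<close>
  have "nowhere_dominating q"
  proof (rule nowhere_dominating_mono[OF nowhere_dominating_add_nuclear[OF M(2) sumG], of 2])
    fix x
    have sGx: "summable (\<lambda>k. \<bar>blinfun_apply (G k) x\<bar>)"
      using summable_mult2[OF sumG, of "norm x"]
      by (rule summable_comparison_test'[where N = 0]) (simp add: abs_blinfun_apply_le)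
    show "q x \<le> 2 * (dual_seminorm M x + (\<Sum>k. \<bar>blinfun_apply (G k) x\<bar>))"
      unfolding q_def
    proof (rule dual_seminorm_least[OF Zs])
      fix z assume "z \<in> Z" and z1: "norm z \<le> 1"
      then obtain N u where "z = (\<Sum>i<N. u i *\<^sub>R E i)" using span_range_nat unfolding Z_def by blast
      from key[OF this] obtain s m where m: "m \<in> M" "z = m - (\<Sum>k<N. s k *\<^sub>R G k)" "norm m \<le> 2 * norm z"
        and s: "\<And>k. \<bar>s k\<bar> \<le> 2 * norm z" by blast
      have q0: "0 \<le> dual_seminorm M x" using seminorm_nonneg[OF seminorm_dual_seminorm[OF Ms]] .
      have "\<bar>blinfun_apply m x\<bar> \<le> norm m * dual_seminorm M x" by (rule dual_seminorm_bound[OF Ms m(1)])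
      also have "\<dots> \<le> 2 * dual_seminorm M x" using m(3) z1 q0 by (intro mult_right_mono) auto
      finally have 1: "\<bar>blinfun_apply m x\<bar> \<le> 2 * dual_seminorm M x" .
      have "\<bar>\<Sum>k<N. s k * blinfun_apply (G k) x\<bar> \<le> (\<Sum>k<N. 2 * \<bar>blinfun_apply (G k) x\<bar>)"
      proof (intro order.trans[OF sum_abs] sum_mono)
        fix k
        have "\<bar>s k\<bar> \<le> 2" using s[of k] z1 by simp
        then show "\<bar>s k * blinfun_apply (G k) x\<bar> \<le> 2 * \<bar>blinfun_apply (G k) x\<bar>"
          by (simp add: abs_mult mult_right_mono)
      qed
      also have "\<dots> \<le> 2 * (\<Sum>k. \<bar>blinfun_apply (G k) x\<bar>)"
        unfolding sum_distrib_left[symmetric] using sGx by (intro mult_left_mono sum_le_suminf) auto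
      finally have 2: "\<bar>\<Sum>k<N. s k * blinfun_apply (G k) x\<bar> \<le> 2 * (\<Sum>k. \<bar>blinfun_apply (G k) x\<bar>)" .
      have "blinfun_apply z x = blinfun_apply m x - (\<Sum>k<N. s k * blinfun_apply (G k) x)"
        by (simp add: m(2) blinfun.diff_left blinfun.sum_left blinfun.scaleR_left)
      then show "\<bar>blinfun_apply z x\<bar> \<le> 2 * (dual_seminorm M x + (\<Sum>k. \<bar>blinfun_apply (G k) x\<bar>))"
        using 1 2 unfolding distrib_left by linarith
    qed
  qed simp
  \<comment> \<open>With \<open>d n\<close> within \<open>q x / 4\<close> of \<open>x\<close>,
    \<open>q (d n)\<close> is at most \<open>5 / 4 * q x\<close> and \<open>l n\<close> has norm at
    most \<open>3 * q x\<close>. All of \<open>Z\<close> takes equal values at \<open>d n\<close>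
    and \<open>l n\<close>, so only the approximation error remains.\<close>
  moreover have "\<exists>w\<in>UNIV. norm w \<le> 2 * 3 * q x \<and> q (x - w) = 0" for x
  proof (rule approximate_lifting_imp_lifting[OF q, of 1])
    fix x
    show "\<exists>w\<in>UNIV. norm w \<le> 3 * q x \<and> q (x - w) \<le> q x / 2"
    proof (cases "q x = 0")
      case True
      then show ?thesis by (intro bexI[of _ 0]) auto
    next
      case False
      then have "q x > 0" using seminorm_nonneg[OF q, of x] by simp
      then obtain n where n: "norm (x - d n) < q x / 4" using d[of "q x / 4" x] by auto
      then have qd: "q (x - d n) \<le> q x / 4" using qn[of "x - d n"] by simp
      have "blinfun_apply z (d n - l n) = 0" if "z \<in> Z" for z
      proof -
        obtain N u where "z = (\<Sum>i<N. u i *\<^sub>R E i)" using span_range_nat \<open>z \<in> Z\<close> unfolding Z_def by blast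
        then show ?thesis by (simp add: blinfun.sum_left blinfun.scaleR_left blinfun.diff_right El)
      qed
      then have "q (d n - l n) \<le> 0" unfolding q_def by (intro dual_seminorm_least[OF Zs]) simp
      then have "q (x - l n) \<le> q x / 4" using seminorm_triangle[OF q, of x "l n" "d n"] qd by linarith
      moreover have "norm (l n) \<le> 3 * q x"
      proof -
        have "dual_seminorm (span (E ` {..n})) (d n) \<le> q (d n)"
          unfolding q_def Z_def by (intro dual_seminorm_mono span_mono) auto
        moreover have "q (d n) \<le> q x + q x / 4"
          using seminorm_le_shift[OF q, of "d n" x] seminorm_commute[OF q, of "d n" x] qd by linarith
        ultimately show ?thesis using ln[of n] seminorm_nonneg[OF q, of x] by linarith
      qed
      ultimately show ?thesis using seminorm_nonneg[OF q, of x] by (intro bexI[of _ "l n"]) auto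
    qed
  qed (use qn in \<open>auto simp: closed_subspace_def\<close>)
  then have "\<exists>w. norm w \<le> 6 * q x \<and> q (x - w) = 0" for x by auto
  \<comment> \<open>The coefficient of \<open>G k\<close> in elements of \<open>Z\<close> is bounded
    by \<open>key\<close> and extends to the whole dual. It is given as a graph because the
    \<open>E n\<close> need not be independent; the value -1 is the coefficient of
    \<open>G (c n)\<close> in \<open>E n\<close>.\<close>
  moreover have "\<exists>F :: ('a \<Rightarrow>\<^sub>L real) \<Rightarrow>\<^sub>L real. \<forall>n. blinfun_apply F (E n) = (if c n = k then - 1 else 0)" for k
  proof -
    define \<Gamma> where "\<Gamma> = span (range (\<lambda>n. (E n, if c n = k then - 1 else 0 :: real)))"
    have "seminorm (\<lambda>z :: 'a \<Rightarrow>\<^sub>L real. 2 * norm z)"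
    proof (rule seminormI)
      show "2 * norm (x + y) \<le> 2 * norm x + 2 * norm y" for x y :: "'a \<Rightarrow>\<^sub>L real"
        using norm_triangle_ineq[of x y] by simp
    qed simp
    moreover have "a \<le> 2 * norm z" if za: "(z, a) \<in> \<Gamma>" for z a
    proof -
      obtain N u where "(z, a) = (\<Sum>i<N. u i *\<^sub>R (E i, if c i = k then - 1 else 0 :: real))"
        using span_range_nat za unfolding \<Gamma>_def by blast
      then have z: "z = (\<Sum>i<N. u i *\<^sub>R E i)" and a: "a = (\<Sum>i<N. u i * (if c i = k then - 1 else 0))"
        by (auto simp: prod_eq_iff fst_sum snd_sum)
      have "a = - (\<Sum>i<N. if c i = k then u i else 0)"
        unfolding a sum_negf[symmetric] by (intro sum.cong) auto
      moreover have "\<bar>\<Sum>i<N. if c i = k then u i else 0\<bar> \<le> 2 * norm z" using key[OF z] by metis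
      ultimately show ?thesis by linarith
    qed
    ultimately have "\<exists>F. linear F \<and> (\<forall>(z, a)\<in>\<Gamma>. F z = a) \<and> (\<forall>z. \<bar>F z\<bar> \<le> 2 * norm z)"
      by (intro Hahn_Banach_graph) (auto simp: \<Gamma>_def)
    then obtain F where F: "linear F" "\<forall>(z, a)\<in>\<Gamma>. F z = a" "\<forall>z. \<bar>F z\<bar> \<le> 2 * norm z" by blast
    obtain F' where F': "\<And>z. blinfun_apply F' z = F z"
      by (rule blinfun_of_linear[of F 2]) (use F in auto)
    have "(E n, if c n = k then - 1 else 0) \<in> \<Gamma>" for n unfolding \<Gamma>_def by (intro span_base) auto
    then have "F (E n) = (if c n = k then - 1 else 0)" for n using bspec[OF F(2), of "(E n, if c n = k then - 1 else 0)"] by simp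
    then show ?thesis using F' by (intro exI[of _ F']) simp
  qed
  then obtain \<Phi> :: "nat \<Rightarrow> ('a \<Rightarrow>\<^sub>L real) \<Rightarrow>\<^sub>L real"
    where \<Phi>: "\<And>k n. blinfun_apply (\<Phi> k) (E n) = (if c n = k then - 1 else 0)" by metis
  have EN: "E n \<in> dominated q" for n
    unfolding dominated_def q_def using dual_seminorm_bound[OF Zs EZ] by blast
  \<comment> \<open>If a combination of the \<Phi> k is evaluation at \<open>x\<close>, every
    \<open>E n\<close> with \<open>c n = k\<close> has the value \<open>- t k\<close> at
    \<open>x\<close>. These functionals are bounded in norm, and among them are some that vanish at
    a \<open>d j\<close> as close to \<open>x\<close> as desired.\<close>
  have indep: "\<forall>k\<le>N. t k = 0" if rep: "(\<Sum>k\<le>N. t k *\<^sub>R \<Phi> k) \<in> represented q" for N t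
  proof (intro allI impI)
    obtain x where t: "\<And>f. f \<in> dominated q \<Longrightarrow> (\<Sum>k\<le>N. t k * blinfun_apply (\<Phi> k) f) = blinfun_apply f x"
      using rep by (auto simp: represented_def blinfun.sum_left blinfun.scaleR_left)
    fix k assume k: "k \<le> N"
    have tk: "- t k = blinfun_apply (E n) x" if "c n = k" for n
    proof -
      have "(\<Sum>j\<le>N. t j * blinfun_apply (\<Phi> j) (E n)) = (\<Sum>j\<le>N. if k = j then - t j else 0)"
        using that by (intro sum.cong) (auto simp: \<Phi>)
      also have "\<dots> = - t k" using k by simp
      finally show ?thesis
        using t[OF EN, of n] by simp
    qed
    have "\<bar>t k\<bar> \<le> e" if e: "e > 0" for e
    proof -
      let ?B = "\<bar>R k\<bar> + 3"
      have "e / ?B > 0" using e by simp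
      then obtain j where j: "norm (x - d j) < e / ?B" using d by blast
      define n where "n = prod_encode (k, j)"
      have cn: "c n = k" by (simp add: n_def c_def)
      have "blinfun_apply (E n) (d j) = 0" by (rule Ed) (simp add: n_def le_prod_encode_2)
      then have "\<bar>t k\<bar> = \<bar>blinfun_apply (E n) (x - d j)\<bar>"
        using tk[OF cn] by (simp add: blinfun.diff_right)
      also have "\<dots> \<le> norm (E n) * norm (x - d j)" by (rule abs_blinfun_apply_le)
      also have "\<dots> \<le> ?B * (e / ?B)"
      proof (intro mult_mono)
        have "(1 / 2 :: real) ^ k \<le> 1" by (simp add: power_le_one)
        then have "norm (G k) \<le> 1" using Gn[of k] by linarith
        moreover have "norm (E n) \<le> norm (E n + G k) + norm (G k)"
          using norm_triangle_ineq4[of "E n + G k" "G k"] by simp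
        ultimately show "norm (E n) \<le> ?B" using EG(2)[of n] cn by simp
      qed (use j in auto)
      finally show ?thesis by simp
    qed
    then show "t k = 0" by (metis abs_le_zero_iff dense_ge)
  qed
  then have "\<not> finite_corank q" by (rule not_finite_corankI)
  ultimately show ?thesis using that[of q 6] q qn by blast
qed

section \<open>From a quotient seminorm to a total nowhere norming subspace\<close>

lemma closed_subspace_closure:
  fixes S :: "'v::real_normed_vector set"
  assumes S: "subspace S"
  shows "closed_subspace (closure S)"
  unfolding closed_subspace_def
proof (intro conjI subspaceI closed_closure)
  show "0 \<in> closure S" using subspace_0[OF S] closure_subset by blast
  show "x + y \<in> closure S" if xy: "x \<in> closure S" "y \<in> closure S" for x y
  proof -
    obtain X Y where "\<And>n. X n \<in> S" "X \<longlonglongrightarrow> x" "\<And>n. Y n \<in> S" "Y \<longlonglongrightarrow> y"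
      using xy unfolding closure_sequential by blast
    then have "\<And>n. X n + Y n \<in> S" "(\<lambda>n. X n + Y n) \<longlonglongrightarrow> x + y"
      using subspace_add[OF S] by (auto intro: tendsto_add)
    then show ?thesis unfolding closure_sequential by (intro exI[of _ "\<lambda>n. X n + Y n"]) blast
  qed
  show "c *\<^sub>R x \<in> closure S" if x: "x \<in> closure S" for c x
  proof -
    obtain X where "\<And>n. X n \<in> S" "X \<longlonglongrightarrow> x" using x unfolding closure_sequential by blast
    then have "\<And>n. c *\<^sub>R X n \<in> S" "(\<lambda>n. c *\<^sub>R X n) \<longlonglongrightarrow> c *\<^sub>R x"
      using subspace_scale[OF S] by (auto intro: tendsto_scaleR)
    then show ?thesis unfolding closure_sequential by (intro exI[of _ "\<lambda>n. c *\<^sub>R X n"]) blast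
  qed
qed

lemma seminorm_attained:
  fixes q :: "'a::real_normed_vector \<Rightarrow> real"
  assumes q: "seminorm q" "\<And>x. q x \<le> K * norm x"
  obtains g where "\<And>y. \<bar>blinfun_apply g y\<bar> \<le> q y" "blinfun_apply g x = q x" "norm g \<le> \<bar>K\<bar>"
proof -
  obtain F where F: "linear F" "\<And>y. \<bar>F y\<bar> \<le> q y" "F x = q x"
    using Hahn_Banach_distance[OF q(1) subspace_single_0, of "q x" x] seminorm_nonneg[OF q(1)] by auto
  have "\<bar>F y\<bar> \<le> \<bar>K\<bar> * norm y" for y
  proof -
    have "K * norm y \<le> \<bar>K\<bar> * norm y" by (intro mult_right_mono) auto
    then show ?thesis using F(2)[of y] q(2)[of y] by linarith
  qed
  then obtain g where "\<And>y. blinfun_apply g y = F y" "norm g \<le> \<bar>K\<bar>"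
    by (rule blinfun_of_linear[OF F(1), of "\<bar>K\<bar>"]) auto
  then show ?thesis using F by (intro that[of g]) auto
qed

text \<open>A complete space is closed in its bidual: \<open>q\<close> is attained by dominated
  functionals of bounded norm, so points representing a convergent sequence are
  \<open>q\<close>-Cauchy, and their \<open>q\<close>-limit represents the limit.\<close>

lemma closed_subspace_represented:
  fixes q :: "'a::real_normed_vector \<Rightarrow> real"
  assumes q: "seminorm q" "\<And>x. q x \<le> K * norm x" "seminorm_complete q"
  shows "closed_subspace (represented q)"
proof -
  have "closed (represented q)"
    unfolding closed_sequential_limits
  proof (intro allI impI, elim conjE)
    fix \<Psi> \<Phi> assume "\<forall>n. \<Psi> n \<in> represented q" and lim: "\<Psi> \<longlonglongrightarrow> \<Phi>"
    then obtain x where x: "\<And>n f. f \<in> dominated q \<Longrightarrow> blinfun_apply (\<Psi> n) f = blinfun_apply f (x n)"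
      unfolding represented_def by simp metis
    have le: "q (x m - x n) \<le> \<bar>K\<bar> * norm (\<Psi> m - \<Psi> n)" for m n
    proof -
      obtain g where g: "\<And>y. \<bar>blinfun_apply g y\<bar> \<le> q y" "blinfun_apply g (x m - x n) = q (x m - x n)"
        "norm g \<le> \<bar>K\<bar>" using seminorm_attained[OF q(1,2)] by blast
      then have "g \<in> dominated q" unfolding dominated_def by (auto intro: exI[of _ 1])
      then have "q (x m - x n) = blinfun_apply (\<Psi> m - \<Psi> n) g"
        using g(2) x by (simp add: blinfun.diff_left blinfun.diff_right)
      also have "\<dots> \<le> norm (\<Psi> m - \<Psi> n) * norm g" using abs_blinfun_apply_le[of "\<Psi> m - \<Psi> n" g] by linarith
      also have "\<dots> \<le> norm (\<Psi> m - \<Psi> n) * \<bar>K\<bar>" using g(3) by (intro mult_left_mono) auto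
      finally show ?thesis by (simp add: mult.commute)
    qed
    have "\<exists>N. \<forall>m\<ge>N. \<forall>n\<ge>N. q (x m - x n) < e" if e: "e > 0" for e
    proof -
      have "e / (\<bar>K\<bar> + 1) > 0" using e by simp
      then obtain N where N: "\<And>m n. \<lbrakk>m \<ge> N; n \<ge> N\<rbrakk> \<Longrightarrow> norm (\<Psi> m - \<Psi> n) < e / (\<bar>K\<bar> + 1)"
        using CauchyD[OF LIMSEQ_imp_Cauchy[OF lim]] by blast
      have "q (x m - x n) < e" if "m \<ge> N" "n \<ge> N" for m n
      proof -
        have "\<bar>K\<bar> * norm (\<Psi> m - \<Psi> n) \<le> (\<bar>K\<bar> + 1) * norm (\<Psi> m - \<Psi> n)" by (intro mult_right_mono) auto
        also have "\<dots> < e" using N[OF that] by (simp add: field_simps)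
        finally show ?thesis using le[of m n] by linarith
      qed
      then show ?thesis by blast
    qed
    then obtain y where y: "(\<lambda>n. q (x n - y)) \<longlonglongrightarrow> 0" using q(3) unfolding seminorm_complete_def by blast
    have "blinfun_apply \<Phi> f = blinfun_apply f y" if f: "f \<in> dominated q" for f
    proof (rule LIMSEQ_unique)
      show "(\<lambda>n. blinfun_apply (\<Psi> n) f) \<longlonglongrightarrow> blinfun_apply \<Phi> f" by (intro tendsto_intros lim)
      obtain R where R: "\<And>y. \<bar>blinfun_apply f y\<bar> \<le> R * q y" using f by (auto simp: dominated_def)
      have "(\<lambda>n. R * q (x n - y)) \<longlonglongrightarrow> 0" using tendsto_mult_left[OF y, of R] by simp
      then have "(\<lambda>n. blinfun_apply f (x n) - blinfun_apply f y) \<longlonglongrightarrow> 0"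
        by (rule Lim_null_comparison[rotated])
          (use R[of "x _ - y"] in \<open>simp add: blinfun.diff_right\<close>)
      then show "(\<lambda>n. blinfun_apply (\<Psi> n) f) \<longlonglongrightarrow> blinfun_apply f y"
        using x[OF f] by (simp add: LIM_zero_iff)
    qed
    then show "\<Phi> \<in> represented q" by (auto simp: represented_def)
  qed
  then show ?thesis using subspace_represented by (simp add: closed_subspace_def)
qed

text \<open>The common kernel of the functionals chosen so far has finite codimension, hence is not
  contained in \<open>J\<close>. A vector of it outside \<open>J\<close> and a functional separating
  that vector from \<open>J\<close> form the next pair.\<close>

lemma triangular_system_exists:
  fixes J :: "'v::real_normed_vector set"
  assumes J: "closed_subspace J" and codim: "\<not> (\<exists>B. finite B \<and> (\<forall>v. \<exists>b\<in>span B. v - b \<in> J))"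
  shows "\<exists>(\<Psi> :: nat \<Rightarrow> 'v) \<xi> :: nat \<Rightarrow> 'v \<Rightarrow>\<^sub>L real.
    (\<forall>k. \<forall>j\<in>J. blinfun_apply (\<xi> k) j = 0) \<and> (\<forall>k. blinfun_apply (\<xi> k) (\<Psi> k) = 1) \<and>
    (\<forall>k. \<forall>i<k. blinfun_apply (\<xi> i) (\<Psi> k) = 0)"
proof -
  define P where "P f n r \<longleftrightarrow> (\<forall>i<n. blinfun_apply (snd (f i)) (fst r) = 0) \<and>
      (\<forall>j\<in>J. blinfun_apply (snd r) j = 0) \<and> blinfun_apply (snd r) (fst r) = 1"
    for f :: "nat \<Rightarrow> 'v \<times> ('v \<Rightarrow>\<^sub>L real)" and n and r :: "'v \<times> ('v \<Rightarrow>\<^sub>L real)"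
  have "\<exists>f. \<forall>n. P f n (f n)"
  proof (rule dependent_wf_choice[OF wf_less_than])
    show "P f n r = P g n r" if "\<And>z. (z, n) \<in> less_than \<Longrightarrow> f z = g z" for f g n r
      using that by (auto simp: P_def)
    show "\<exists>r. P f n r" for n f
    proof -
      obtain B where B: "finite B" "\<forall>v\<in>UNIV. \<exists>b\<in>span B. \<forall>i\<in>{..<n}. blinfun_apply (snd (f i)) (v - b) = 0"
        using common_kernel_complement[OF finite_lessThan[of n] subspace_UNIV, of "\<lambda>i. blinfun_apply (snd (f i))"]
          linear_blinfun_apply by blast
      have "\<exists>v. (\<forall>i<n. blinfun_apply (snd (f i)) v = 0) \<and> v \<notin> J"
      proof (rule ccontr)
        assume "\<not> ?thesis"
        then have mem: "v \<in> J" if "\<forall>i<n. blinfun_apply (snd (f i)) v = 0" for v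
          using that by blast
        have "\<exists>b\<in>span B. v - b \<in> J" for v
        proof -
          obtain b where b: "b \<in> span B" "\<forall>i\<in>{..<n}. blinfun_apply (snd (f i)) (v - b) = 0"
            using bspec[OF B(2) UNIV_I, of v] by (elim bexE)
          then show ?thesis by (intro bexI[OF _ b(1)] mem) simp
        qed
        then have "finite B \<and> (\<forall>v. \<exists>b\<in>span B. v - b \<in> J)" using B(1) by simp
        then show False using codim by (elim notE) (rule exI)
      qed
      then obtain v where v: "\<forall>i<n. blinfun_apply (snd (f i)) v = 0" "v \<notin> J" by blast
      obtain F :: "'v \<Rightarrow>\<^sub>L real" where "\<forall>j\<in>J. blinfun_apply F j = 0" "blinfun_apply F v = 1"
        using separating_functional[OF J v(2)] by blast
      then have "P f n (v, F)" using v(1) by (simp add: P_def)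
      then show ?thesis by blast
    qed
  qed
  then obtain f where "\<And>n. P f n (f n)" by blast
  then show ?thesis
    by (intro exI[of _ "\<lambda>k. fst (f k)"] exI[of _ "\<lambda>k. snd (f k)"]) (simp add: P_def)
qed

section \<open>The perturbed dual of the quotient\<close>

theorem TNNS_if_quotient_seminorm:
  fixes q :: "'a::banach \<Rightarrow> real" and d :: "nat \<Rightarrow> 'a"
  assumes q: "seminorm q" "\<And>x. q x \<le> K * norm x" "seminorm_complete q"
    and nd: "nowhere_dominating q" and corank: "\<not> finite_corank q"
    and inf: "infinite_dimensional (UNIV :: 'a set)"
    and d: "\<And>x e. e > 0 \<Longrightarrow> \<exists>n. norm (x - d n) < e"
  shows "TNNS TYPE('a)"
proof -
  define N where "N = dominated q"
  define J where "J = represented q"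
  have Ns: "subspace N" unfolding N_def by (rule subspace_dominated[OF q(1)])
  have J: "closed_subspace J" unfolding J_def by (rule closed_subspace_represented[OF q])
  have "\<not> (\<exists>B. finite B \<and> (\<forall>\<Psi>. \<exists>b\<in>span B. \<Psi> - b \<in> J))"
    using corank by (simp add: finite_corank_def J_def)
  from triangular_system_exists[OF J this]
  obtain \<Psi> :: "nat \<Rightarrow> ('a \<Rightarrow>\<^sub>L real) \<Rightarrow>\<^sub>L real" and \<xi> :: "nat \<Rightarrow> (('a \<Rightarrow>\<^sub>L real) \<Rightarrow>\<^sub>L real) \<Rightarrow>\<^sub>L real"
    where "\<forall>k. \<forall>j\<in>J. blinfun_apply (\<xi> k) j = 0" and "\<forall>k. blinfun_apply (\<xi> k) (\<Psi> k) = 1"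
      and "\<forall>k. \<forall>i<k. blinfun_apply (\<xi> i) (\<Psi> k) = 0" by (elim exE conjE)
  then have \<xi>J: "\<And>k j. j \<in> J \<Longrightarrow> blinfun_apply (\<xi> k) j = 0"
    and \<xi>1: "\<And>k. blinfun_apply (\<xi> k) (\<Psi> k) = 1"
    and \<xi>0: "\<And>i k. i < k \<Longrightarrow> blinfun_apply (\<xi> i) (\<Psi> k) = 0" by simp_all
  have "\<exists>F :: 'a \<Rightarrow>\<^sub>L real. norm F \<le> 1 \<and> blinfun_apply F (d k) = norm (d k)" for k
    using norming_functional by blast
  then obtain g :: "nat \<Rightarrow> 'a \<Rightarrow>\<^sub>L real" where g: "\<And>k. norm (g k) \<le> 1" "\<And>k. blinfun_apply (g k) (d k) = norm (d k)"
    by metis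
  \<comment> \<open>If all \<open>g k\<close> vanish at \<open>x\<close>, the norm of
    \<open>d k\<close> is at most its distance to \<open>x\<close>, which is impossible for
    \<open>d k\<close> close to \<open>x \<noteq> 0\<close>.\<close>
  have g_total: "x = 0" if gx: "\<And>k. blinfun_apply (g k) x = 0" for x
  proof (rule ccontr)
    assume "x \<noteq> 0"
    then obtain k where k: "norm (x - d k) < norm x / 2" using d[of "norm x / 2" x] by auto
    have "norm (d k) = \<bar>blinfun_apply (g k) (x - d k)\<bar>" using g(2)[of k] gx[of k] by (simp add: blinfun.diff_right)
    also have "\<dots> \<le> norm (g k) * norm (x - d k)" by (rule abs_blinfun_apply_le)
    also have "\<dots> \<le> 1 * norm (x - d k)" using g(1) by (intro mult_right_mono) auto
    finally have "norm x \<le> 2 * norm (x - d k)" using norm_triangle_sub[of x "d k"] by simp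
    then show False using k by simp
  qed
  \<comment> \<open>The positive weights make \<open>\<delta> k * norm (\<Psi> k)\<close> sum to at
    most 1/2, so \<open>S\<close> has norm at most 1/2 and \<open>f\<close> is controlled by
    \<open>f + S f\<close>.\<close>
  define \<delta> where "\<delta> k = (1 / 2) ^ k / (4 * (1 + norm (\<Psi> k)))" for k
  have \<delta>: "\<delta> k > 0" "\<delta> k * norm (\<Psi> k) \<le> (1 / 2) ^ k / 4" for k
  proof -
    have p: "1 + norm (\<Psi> k) > 0" using norm_ge_zero[of "\<Psi> k"] by linarith
    then show pos: "\<delta> k > 0" by (simp add: \<delta>_def)
    have "\<delta> k * norm (\<Psi> k) \<le> \<delta> k * (1 + norm (\<Psi> k))" using pos by (intro mult_left_mono) auto
    also have "\<dots> = (1 / 2) ^ k / 4"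
    proof -
      have "a / (4 * b) * b = a / 4" if "b > 0" for a b :: real using that by simp
      from this[OF p] show ?thesis unfolding \<delta>_def .
    qed
    finally show "\<delta> k * norm (\<Psi> k) \<le> (1 / 2) ^ k / 4" .
  qed
  have geo: "(\<lambda>k. (1 / 2 :: real) ^ k / 4 * c) sums (c / 2)" for c
    using sums_mult2[OF sums_divide[OF geometric_sums[of "1 / 2 :: real"]], of 4 c] by simp
  define S where "S f = (\<Sum>k. (\<delta> k * blinfun_apply (\<Psi> k) f) *\<^sub>R g k)" for f
  have coef: "\<bar>\<delta> k * blinfun_apply (\<Psi> k) f\<bar> \<le> (1 / 2) ^ k / 4 * norm f" for k f
  proof -
    have "\<bar>\<delta> k * blinfun_apply (\<Psi> k) f\<bar> \<le> \<delta> k * (norm (\<Psi> k) * norm f)"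
      using \<delta>(1)[of k] abs_blinfun_apply_le[of "\<Psi> k" f] by (simp add: abs_mult mult_left_mono)
    also have "\<dots> = (\<delta> k * norm (\<Psi> k)) * norm f" by simp
    also have "\<dots> \<le> (1 / 2) ^ k / 4 * norm f" using \<delta>(2) by (intro mult_right_mono) auto
    finally show ?thesis .
  qed
  have summand: "norm ((\<delta> k * blinfun_apply (\<Psi> k) f) *\<^sub>R g k) \<le> (1 / 2) ^ k / 4 * norm f" for k f
  proof -
    have "norm ((\<delta> k * blinfun_apply (\<Psi> k) f) *\<^sub>R g k) \<le> \<bar>\<delta> k * blinfun_apply (\<Psi> k) f\<bar> * 1"
      unfolding norm_scaleR using g(1) by (intro mult_left_mono) auto
    then show ?thesis using coef[of k f] by simp
  qed
  have Snorm: "summable (\<lambda>k. norm ((\<delta> k * blinfun_apply (\<Psi> k) f) *\<^sub>R g k))" for f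
    by (rule summable_comparison_test'[OF sums_summable[OF geo[of "norm f"]], of 0])
      (simp only: real_norm_def abs_norm_cancel summand)
  have Ssum: "summable (\<lambda>k. (\<delta> k * blinfun_apply (\<Psi> k) f) *\<^sub>R g k)" for f
    by (rule summable_norm_cancel[OF Snorm])
  have Sle: "norm (S f) \<le> norm f / 2" for f
  proof -
    have "norm (S f) \<le> (\<Sum>k. norm ((\<delta> k * blinfun_apply (\<Psi> k) f) *\<^sub>R g k))"
      unfolding S_def by (rule summable_norm[OF Snorm])
    also have "\<dots> \<le> (\<Sum>k. (1 / 2) ^ k / 4 * norm f)"
      by (rule suminf_le[OF summand Snorm sums_summable[OF geo]])
    also have "\<dots> = norm f / 2" using sums_unique[OF geo[of "norm f"]] by simp
    finally show ?thesis .
  qed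
  have Sadd: "S (f + h) = S f + S h" for f h
    unfolding S_def suminf_add[OF Ssum Ssum]
    by (simp add: blinfun.add_right distrib_left scaleR_add_left)
  have Sscale: "S (c *\<^sub>R f) = c *\<^sub>R S f" for c f
    unfolding S_def suminf_scaleR_right[OF Ssum] by (simp add: blinfun.scaleR_right mult.left_commute)
  have Sapp: "(\<lambda>k. \<delta> k * blinfun_apply (\<Psi> k) f * blinfun_apply (g k) x) sums blinfun_apply (S f) x" for f x
  proof -
    have "bounded_linear (\<lambda>h :: 'a \<Rightarrow>\<^sub>L real. blinfun_apply h x)" by (rule blinfun.bounded_linear_left)
    from bounded_linear.sums[OF this summable_sums[OF Ssum]]
    show ?thesis by (simp add: S_def blinfun.scaleR_left)
  qed
  define M0 where "M0 = {f + S f | f. f \<in> N}"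
  have "subspace M0"
  proof (rule subspaceI)
    show "0 \<in> M0" using subspace_0[OF Ns] Sscale[of 0 0] by (force simp: M0_def)
    show "x + y \<in> M0" if xy: "x \<in> M0" "y \<in> M0" for x y
    proof -
      obtain f h where "f \<in> N" "h \<in> N" "x = f + S f" "y = h + S h" using xy by (auto simp: M0_def)
      then have "x + y = (f + h) + S (f + h)" "f + h \<in> N" using subspace_add[OF Ns] by (auto simp: Sadd)
      then show ?thesis by (auto simp: M0_def)
    qed
    show "c *\<^sub>R x \<in> M0" if x: "x \<in> M0" for c x
    proof -
      obtain f where "f \<in> N" "x = f + S f" using x by (auto simp: M0_def)
      then have "c *\<^sub>R x = c *\<^sub>R f + S (c *\<^sub>R f)" "c *\<^sub>R f \<in> N"
        using subspace_scale[OF Ns] by (auto simp: Sscale scaleR_add_right)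
      then show ?thesis by (auto simp: M0_def)
    qed
  qed
  define M where "M = closure M0"
  have Mcs: "closed_subspace M" unfolding M_def by (rule closed_subspace_closure) fact
  then have Ms: "subspace M" by (simp add: closed_subspace_def)
  \<comment> \<open>If \<open>M\<close> kills \<open>x\<close>, then \<open>\<Theta>\<close> acts on
    \<open>N\<close> as evaluation at \<open>- x\<close>, so it lies in \<open>J\<close> and each
    \<open>\<xi> j\<close> is 0 at it. In the series for this value the terms after \<open>j\<close>
    vanish by triangularity and those before \<open>j\<close> by induction, leaving
    \<open>\<delta> j\<close> times the value of \<open>g j\<close> at \<open>x\<close>.\<close>
  have total: "x = 0" if x: "\<forall>h\<in>M. blinfun_apply h x = 0" for x
  proof -
    define \<Theta> where "\<Theta> = (\<Sum>k. (\<delta> k * blinfun_apply (g k) x) *\<^sub>R \<Psi> k)"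
    have "summable (\<lambda>k. norm ((\<delta> k * blinfun_apply (g k) x) *\<^sub>R \<Psi> k))"
    proof (rule summable_comparison_test'[OF sums_summable[OF geo[of "norm x"]], of 0])
      fix k
      have "norm ((\<delta> k * blinfun_apply (g k) x) *\<^sub>R \<Psi> k) = (\<delta> k * norm (\<Psi> k)) * \<bar>blinfun_apply (g k) x\<bar>"
        using \<delta>(1)[of k] by (simp add: abs_mult)
      also have "\<dots> \<le> ((1 / 2) ^ k / 4) * norm x"
      proof (intro mult_mono \<delta>(2))
        show "\<bar>blinfun_apply (g k) x\<bar> \<le> norm x"
          using abs_blinfun_apply_le[of "g k" x] mult_right_mono[OF g(1)[of k] norm_ge_zero[of x]] by simp
      qed auto
      finally show "norm (norm ((\<delta> k * blinfun_apply (g k) x) *\<^sub>R \<Psi> k)) \<le> (1 / 2) ^ k / 4 * norm x" by simp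
    qed
    then have sum: "(\<lambda>k. (\<delta> k * blinfun_apply (g k) x) *\<^sub>R \<Psi> k) sums \<Theta>"
      unfolding \<Theta>_def by (rule summable_sums[OF summable_norm_cancel])
    have "blinfun_apply \<Theta> f = blinfun_apply f (- x)" if f: "f \<in> N" for f
    proof -
      have "(\<lambda>k. (\<delta> k * blinfun_apply (g k) x) * blinfun_apply (\<Psi> k) f) sums blinfun_apply \<Theta> f"
        using bounded_linear.sums[OF blinfun.bounded_linear_left sum, of f] by (simp add: blinfun.scaleR_left)
      then have "blinfun_apply \<Theta> f = blinfun_apply (S f) x"
        using Sapp[of f x] by (simp add: mult_ac sums_unique2)
      moreover have "f + S f \<in> M" using f closure_subset by (force simp: M_def M0_def)
      then have "blinfun_apply f x + blinfun_apply (S f) x = 0" using x by (simp add: blinfun.add_left[symmetric])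
      ultimately show ?thesis by (simp add: blinfun.minus_right)
    qed
    then have \<Theta>J: "\<Theta> \<in> J" unfolding J_def represented_def N_def by blast
    have "blinfun_apply (g j) x = 0" for j
    proof (induction j rule: less_induct)
      case (less j)
      have "(\<lambda>k. (\<delta> k * blinfun_apply (g k) x) * blinfun_apply (\<xi> j) (\<Psi> k)) sums blinfun_apply (\<xi> j) \<Theta>"
        using bounded_linear.sums[OF blinfun.bounded_linear_right sum, of "\<xi> j"] by (simp add: blinfun.scaleR_right)
      moreover have "(\<delta> k * blinfun_apply (g k) x) * blinfun_apply (\<xi> j) (\<Psi> k)
          = (if k = j then \<delta> j * blinfun_apply (g j) x else 0)" for k
        using less[of k] \<xi>0[of j k] \<xi>1[of j] by (cases k j rule: linorder_cases) auto
      ultimately have "\<delta> j * blinfun_apply (g j) x = blinfun_apply (\<xi> j) \<Theta>"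
        using sums_single[of j "\<lambda>_. \<delta> j * blinfun_apply (g j) x"] by (simp add: sums_unique2)
      then show ?case using \<xi>J[OF \<Theta>J] \<delta>(1)[of j] by simp
    qed
    then show ?thesis by (rule g_total)
  qed
  then have tot: "total_subspace M" using Mcs by (auto simp: total_subspace_def)
  obtain C where C: "C > 0" "\<And>x. \<exists>w. norm w \<le> C * q x \<and> q (x - w) = 0"
    using complete_seminorm_lifting[OF q] by blast
  \<comment> \<open>Up to the factor \<open>norm f\<close>, these summable functionals bound the
    terms of \<open>S f\<close> at \<open>x\<close>, so one nuclear term serves all
    \<open>f\<close>.\<close>
  define g' where "g' k = ((1 / 2) ^ k :: real) *\<^sub>R g k" for k
  have g'n: "norm (g' k) \<le> (1 / 2) ^ k" for k
    using mult_left_mono[OF g(1)[of k], of "(1 / 2) ^ k"] by (simp add: g'_def)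
  have sg': "summable (\<lambda>k. norm (g' k))"
    by (rule summable_comparison_test'[of "\<lambda>k. (1 / 2) ^ k" 0]) (use g'n in \<open>auto intro: summable_geometric\<close>)
  \<comment> \<open>The estimate is a closed condition, so it suffices on \<open>M0\<close>. There
    \<open>f\<close> may be evaluated at a lift of \<open>x\<close> of norm at most
    \<open>C * q x\<close>, and the factor 2 passes from \<open>norm f\<close> to
    \<open>norm h\<close>.\<close>
  have bound: "\<bar>blinfun_apply h x\<bar> \<le> 2 * norm h * (C * q x + (\<Sum>k. \<bar>blinfun_apply (g' k) x\<bar>))"
    if h: "h \<in> M" for h x
  proof -
    let ?c = "C * q x + (\<Sum>k. \<bar>blinfun_apply (g' k) x\<bar>)"
    have sg'x: "summable (\<lambda>k. \<bar>blinfun_apply (g' k) x\<bar>)"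
      using summable_mult2[OF sg', of "norm x"]
      by (rule summable_comparison_test'[where N = 0]) (simp add: abs_blinfun_apply_le)
    have c0: "0 \<le> ?c" using C(1) seminorm_nonneg[OF q(1), of x] suminf_nonneg[OF sg'x] by simp
    have "closed {h. \<bar>blinfun_apply h x\<bar> \<le> 2 * norm h * ?c}"
      by (intro closed_Collect_le continuous_intros)
    moreover have "M0 \<subseteq> {h. \<bar>blinfun_apply h x\<bar> \<le> 2 * norm h * ?c}"
    proof
      fix h assume "h \<in> M0"
      then obtain f where f: "f \<in> N" "h = f + S f" by (auto simp: M0_def)
      obtain R where R: "\<And>y. \<bar>blinfun_apply f y\<bar> \<le> R * q y" using f by (auto simp: N_def dominated_def)
      obtain w where w: "norm w \<le> C * q x" "q (x - w) = 0" using C(2) by blast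
      have "blinfun_apply f x = blinfun_apply f w" using R[of "x - w"] w(2) by (simp add: blinfun.diff_right)
      then have "\<bar>blinfun_apply f x\<bar> \<le> norm f * norm w" using abs_blinfun_apply_le[of f w] by simp
      also have "\<dots> \<le> norm f * (C * q x)" using w(1) by (intro mult_left_mono) auto
      finally have 1: "\<bar>blinfun_apply f x\<bar> \<le> norm f * (C * q x)" .
      have t: "\<bar>\<delta> k * blinfun_apply (\<Psi> k) f * blinfun_apply (g k) x\<bar> \<le> norm f * \<bar>blinfun_apply (g' k) x\<bar>" for k
      proof -
        have "\<bar>\<delta> k * blinfun_apply (\<Psi> k) f\<bar> \<le> (1 / 2) ^ k * norm f"
          by (rule order.trans[OF coef mult_right_mono]) auto
        then have "\<bar>\<delta> k * blinfun_apply (\<Psi> k) f\<bar> * \<bar>blinfun_apply (g k) x\<bar>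
            \<le> ((1 / 2) ^ k * norm f) * \<bar>blinfun_apply (g k) x\<bar>" by (intro mult_right_mono) auto
        then show ?thesis by (simp add: g'_def blinfun.scaleR_left abs_mult mult_ac)
      qed
      have st: "summable (\<lambda>k. norm f * \<bar>blinfun_apply (g' k) x\<bar>)" by (rule summable_mult[OF sg'x])
      have st': "summable (\<lambda>k. \<bar>\<delta> k * blinfun_apply (\<Psi> k) f * blinfun_apply (g k) x\<bar>)"
        by (rule summable_comparison_test'[OF st, of 0]) (use t in simp)
      have "\<bar>blinfun_apply (S f) x\<bar> \<le> (\<Sum>k. \<bar>\<delta> k * blinfun_apply (\<Psi> k) f * blinfun_apply (g k) x\<bar>)"
        using summable_rabs[OF st'] sums_unique[OF Sapp[of f x]] by simp
      also have "\<dots> \<le> (\<Sum>k. norm f * \<bar>blinfun_apply (g' k) x\<bar>)" by (rule suminf_le[OF t st' st])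
      also have "\<dots> = norm f * (\<Sum>k. \<bar>blinfun_apply (g' k) x\<bar>)" by (rule suminf_mult[OF sg'x])
      finally have "\<bar>blinfun_apply h x\<bar> \<le> norm f * ?c" using 1 f(2) by (simp add: blinfun.add_left distrib_left)
      moreover have "norm f \<le> 2 * norm h"
        using Sle[of f] norm_triangle_ineq4[of h "S f"] f(2) by simp
      ultimately show "h \<in> {h. \<bar>blinfun_apply h x\<bar> \<le> 2 * norm h * ?c}"
        using mult_right_mono[OF _ c0, of "norm f" "2 * norm h"] by simp
    qed
    ultimately have "M \<subseteq> {h. \<bar>blinfun_apply h x\<bar> \<le> 2 * norm h * ?c}" unfolding M_def by (rule closure_minimal[rotated])
    then show ?thesis using h by blast
  qed
  have "nowhere_dominating (dual_seminorm M)"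
  proof (rule nowhere_dominating_mono[OF nowhere_dominating_add_nuclear[OF nd sg'], of "2 * max C 1"])
    fix x
    let ?s = "\<Sum>k. \<bar>blinfun_apply (g' k) x\<bar>"
    have sg'x: "summable (\<lambda>k. \<bar>blinfun_apply (g' k) x\<bar>)"
      using summable_mult2[OF sg', of "norm x"]
      by (rule summable_comparison_test'[where N = 0]) (simp add: abs_blinfun_apply_le)
    have s0: "0 \<le> ?s" using suminf_nonneg[OF sg'x] by simp
    have "C * q x \<le> max C 1 * q x" using seminorm_nonneg[OF q(1)] by (intro mult_right_mono) auto
    moreover have "1 * ?s \<le> max C 1 * ?s" using s0 by (intro mult_right_mono) auto
    ultimately have c: "C * q x + ?s \<le> max C 1 * (q x + ?s)" by (simp add: distrib_left)
    have c0: "0 \<le> C * q x + ?s" using C(1) seminorm_nonneg[OF q(1), of x] s0 by simp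
    show "dual_seminorm M x \<le> 2 * max C 1 * (q x + ?s)"
    proof (rule dual_seminorm_least[OF Ms])
      fix h assume h: "h \<in> M" "norm h \<le> 1"
      have "\<bar>blinfun_apply h x\<bar> \<le> 2 * norm h * (C * q x + ?s)" by (rule bound[OF h(1)])
      also have "\<dots> \<le> 2 * (C * q x + ?s)" using h(2) c0 by (intro mult_right_mono) auto
      also have "\<dots> \<le> 2 * max C 1 * (q x + ?s)" using c by simp
      finally show "\<bar>blinfun_apply h x\<bar> \<le> 2 * max C 1 * (q x + ?s)" .
    qed
  qed simp
  moreover have "M \<noteq> {0}"
  proof
    assume "M = {0}"
    then have "x \<in> span {}" for x :: 'a using total[of x] by simp
    then have "(UNIV :: 'a set) \<subseteq> span {}" by (rule subsetI)
    then show False using inf unfolding infinite_dimensional_def by blast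
  qed
  ultimately have "nowhere_norming M" using nowhere_norming_iff[OF Mcs] by simp
  then show ?thesis using tot unfolding TNNS_def by blast
qed

section \<open>Operators onto a space on a carrier set\<close>

locale onto_operator = normed_space_on Y for Y :: "'v nspace" +
  fixes T :: "'a::banach \<Rightarrow> 'v"
  assumes bounded: "bounded_operator Y T" and onto: "range T = ncarrier Y"
begin

section \<open>The seminorm of the operator, completeness and strict singularity\<close>

definition q :: "'a \<Rightarrow> real" where "q x = nnorm Y (T x)"

lemma T_closed: "T x \<in> ncarrier Y"
  and T_add: "T (x + y) = nadd Y (T x) (T y)"
  and T_scale: "T (r *\<^sub>R x) = nscale Y r (T x)"
  using bounded by (auto simp: bounded_operator_def)

lemma T_surj: "y \<in> ncarrier Y \<Longrightarrow> \<exists>x. y = T x"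
  using onto by blast

lemma T_diff: "nadd Y (T x) (nscale Y (- 1) (T y)) = T (x - y)"
  using T_add[of x "(- 1) *\<^sub>R y"] T_scale[of "- 1" y] by simp

lemma seminorm_q: "seminorm q"
  by (rule seminormI) (auto simp: q_def T_add T_scale norm_triangle norm_scale T_closed)

lemma q_bound: obtains K where "\<And>x. q x \<le> K * norm x"
  using bounded unfolding bounded_operator_def q_def by blast

lemma q_diff_eq_0: "q (x - y) = 0 \<longleftrightarrow> T x = T y"
proof
  assume "q (x - y) = 0"
  then have "T (x - y) = nzero Y" using norm_eq_zero[OF T_closed[of "x - y"]] by (simp add: q_def)
  then have "nadd Y (T y) (T (x - y)) = T y" using add_zero[OF T_closed] by simp
  then show "T x = T y" using T_add[of y "x - y"] by simp
next
  assume "T x = T y"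
  then have "T (x - y) = nzero Y" using T_diff[of x y] add_inverse[OF T_closed[of y]] by simp
  then show "q (x - y) = 0" using norm_eq_zero[OF T_closed[of "x - y"]] by (simp add: q_def)
qed

lemma ndist_T: "ndist Y (T x) (T y) = q (x - y)"
  by (simp add: ndist_def T_closed T_diff q_def)

lemma Metric_space_Y: "Metric_space (ncarrier Y) (ndist Y)"
proof
  show "0 \<le> ndist Y x y" for x y
  proof (cases "x \<in> ncarrier Y \<and> y \<in> ncarrier Y")
    case True
    then obtain a b where "x = T a" "y = T b" using T_surj by blast
    then show ?thesis by (simp add: ndist_T seminorm_nonneg[OF seminorm_q])
  qed (auto simp: ndist_def)
  show "ndist Y x y = ndist Y y x" for x y
  proof (cases "x \<in> ncarrier Y \<and> y \<in> ncarrier Y")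
    case True
    then obtain a b where "x = T a" "y = T b" using T_surj by blast
    then show ?thesis by (simp add: ndist_T seminorm_commute[OF seminorm_q, of a b])
  qed (auto simp: ndist_def)
  show "(ndist Y x y = 0) = (x = y)" if xy: "x \<in> ncarrier Y" "y \<in> ncarrier Y" for x y
  proof -
    obtain a b where "x = T a" "y = T b" using T_surj xy by blast
    then show ?thesis by (simp add: ndist_T q_diff_eq_0)
  qed
  show "ndist Y x z \<le> ndist Y x y + ndist Y y z"
    if xyz: "x \<in> ncarrier Y" "y \<in> ncarrier Y" "z \<in> ncarrier Y" for x y z
  proof -
    obtain a b c where "x = T a" "y = T b" "z = T c" using T_surj xyz by blast
    then show ?thesis by (simp add: ndist_T seminorm_triangle[OF seminorm_q])
  qed
qed

lemma banach_space_on_iff: "banach_space_on Y \<longleftrightarrow> seminorm_complete q"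
proof -
  interpret Metric_space "ncarrier Y" "ndist Y" by (rule Metric_space_Y)
  have "mcomplete \<longleftrightarrow> seminorm_complete q"
  proof
    assume mc: mcomplete
    show "seminorm_complete q"
      unfolding seminorm_complete_def
    proof (intro allI impI)
      fix X :: "nat \<Rightarrow> 'a" assume "\<forall>e>0. \<exists>N. \<forall>m\<ge>N. \<forall>n\<ge>N. q (X m - X n) < e"
      then have "MCauchy (\<lambda>n. T (X n))"
        unfolding MCauchy_def ndist_T using T_closed by blast
      then obtain y where "limitin mtopology (\<lambda>n. T (X n)) y sequentially"
        using mc unfolding mcomplete_def by blast
      then have y: "y \<in> ncarrier Y" "\<And>e. e > 0 \<Longrightarrow> \<exists>N. \<forall>n\<ge>N. ndist Y (T (X n)) y < e"
        unfolding limit_metric_sequentially by blast+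
      obtain x where x: "y = T x" using T_surj y(1) by blast
      have "(\<lambda>n. q (X n - x)) \<longlonglongrightarrow> 0"
        using y(2) unfolding x ndist_T
        by (intro LIMSEQ_I) (simp add: seminorm_nonneg[OF seminorm_q])
      then show "\<exists>x. (\<lambda>n. q (X n - x)) \<longlonglongrightarrow> 0" by blast
    qed
  next
    assume sc: "seminorm_complete q"
    show mcomplete
      unfolding mcomplete_def
    proof (intro allI impI)
      fix \<sigma> assume \<sigma>: "MCauchy \<sigma>"
      then have "\<forall>n. \<exists>x. \<sigma> n = T x" unfolding MCauchy_def using T_surj by blast
      then have "\<exists>X. \<forall>n. \<sigma> n = T (X n)" by (rule choice)
      then obtain X where "\<forall>n. \<sigma> n = T (X n)" by (rule exE)
      then have X: "\<sigma> = (\<lambda>n. T (X n))" by (simp add: fun_eq_iff)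
      have "\<forall>e>0. \<exists>N. \<forall>m n. N \<le> m \<longrightarrow> N \<le> n \<longrightarrow> q (X m - X n) < e"
        using \<sigma> by (simp add: MCauchy_def X ndist_T)
      then have "\<forall>e>0. \<exists>N. \<forall>m\<ge>N. \<forall>n\<ge>N. q (X m - X n) < e" by meson
      then obtain x where x: "(\<lambda>n. q (X n - x)) \<longlonglongrightarrow> 0" using sc unfolding seminorm_complete_def by blast
      have "limitin mtopology \<sigma> (T x) sequentially"
        unfolding limit_metric_sequentially X ndist_T
        using LIMSEQ_D[OF x] by (simp add: T_closed seminorm_nonneg[OF seminorm_q])
      then show "\<exists>x. limitin mtopology \<sigma> x sequentially" by blast
    qed
  qed
  then show ?thesis using normed_space_on_axioms by (simp add: banach_space_on_def)
qed

lemma isomorphism_onto_image_iff: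
  assumes L: "subspace L"
  shows "isomorphism_onto_image Y T L \<longleftrightarrow> (\<exists>c>0. \<forall>x\<in>L. c * norm x \<le> q x)"
proof
  assume "isomorphism_onto_image Y T L"
  then obtain K where inj: "inj_on T L" and K: "\<And>y. y \<in> T ` L \<Longrightarrow> norm (the_inv_into L T y) \<le> K * nnorm Y y"
    by (auto simp: isomorphism_onto_image_def)
  have "1 / (\<bar>K\<bar> + 1) * norm x \<le> q x" if x: "x \<in> L" for x
  proof -
    have "norm x \<le> K * q x" using K[of "T x"] x by (simp add: the_inv_into_f_f[OF inj] q_def)
    also have "\<dots> \<le> (\<bar>K\<bar> + 1) * q x" using seminorm_nonneg[OF seminorm_q] by (intro mult_right_mono) auto
    finally show ?thesis by (simp add: field_simps)
  qed
  then show "\<exists>c>0. \<forall>x\<in>L. c * norm x \<le> q x" by (intro exI[of _ "1 / (\<bar>K\<bar> + 1)"]) simp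
next
  assume "\<exists>c>0. \<forall>x\<in>L. c * norm x \<le> q x"
  then obtain c where c: "c > 0" "\<And>x. x \<in> L \<Longrightarrow> c * norm x \<le> q x" by blast
  have inj: "inj_on T L"
  proof (rule inj_onI)
    fix x y assume xy: "x \<in> L" "y \<in> L" "T x = T y"
    then have "c * norm (x - y) \<le> 0" using c(2)[OF subspace_diff[OF L xy(1,2)]] by (simp add: q_diff_eq_0[THEN iffD2])
    then show "x = y" using c(1) by (simp add: mult_le_0_iff)
  qed
  have "norm (the_inv_into L T y) \<le> 1 / c * nnorm Y y" if y: "y \<in> T ` L" for y
  proof -
    obtain x where x: "x \<in> L" "y = T x" using y by blast
    then show ?thesis using c by (simp add: the_inv_into_f_f[OF inj] q_def field_simps)
  qed
  then show "isomorphism_onto_image Y T L" using inj unfolding isomorphism_onto_image_def by blast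
qed

text \<open>An isomorphism on \<open>L\<close> is a lower estimate of \<open>q\<close> by a positive
  multiple of the norm; \<open>nowhere_dominating\<close> denies it for every infinite-dimensional
  \<open>L\<close>.\<close>

lemma strictly_singular_iff: "strictly_singular Y T \<longleftrightarrow> nowhere_dominating q"
proof -
  have "\<not> isomorphism_onto_image Y T L \<longleftrightarrow> (\<forall>c>0. \<exists>x\<in>L. q x < c * norm x)" if "closed_subspace L" for L
    using isomorphism_onto_image_iff[of L] that by (simp add: closed_subspace_def not_less[symmetric])
  then have "(closed_subspace L \<and> infinite_dimensional L \<longrightarrow> \<not> isomorphism_onto_image Y T L) \<longleftrightarrow>
      (\<forall>c. closed_subspace L \<and> infinite_dimensional L \<and> c > 0 \<longrightarrow> (\<exists>x\<in>L. q x < c * norm x))" for L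
    by blast
  then show ?thesis
    unfolding strictly_singular_def nowhere_dominating_def using bounded by simp
qed

section \<open>The dual of the target as the dominated functionals\<close>

abbreviation "D \<equiv> ncarrier (dual Y)"
abbreviation "E \<equiv> ncarrier (dual (dual Y))"

text \<open>The adjoint of \<open>T\<close>; it is meaningful for arguments in \<open>D\<close>,
  where the composition with \<open>T\<close> is bounded linear.\<close>

definition pull :: "('v \<Rightarrow> real) \<Rightarrow> 'a \<Rightarrow>\<^sub>L real" where "pull \<phi> = Blinfun (\<lambda>x. \<phi> (T x))"

lemma carrier_dual: "D = bounded_linear_functionals Y"
  by (simp add: dual_def)

lemma D_add: "\<lbrakk>\<phi> \<in> D; x \<in> ncarrier Y; y \<in> ncarrier Y\<rbrakk> \<Longrightarrow> \<phi> (nadd Y x y) = \<phi> x + \<phi> y"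
  and D_scale: "\<lbrakk>\<phi> \<in> D; x \<in> ncarrier Y\<rbrakk> \<Longrightarrow> \<phi> (nscale Y r x) = r * \<phi> x"
  and D_bound: "\<phi> \<in> D \<Longrightarrow> \<exists>K. \<forall>x\<in>ncarrier Y. \<bar>\<phi> x\<bar> \<le> K * nnorm Y x"
  by (auto simp: carrier_dual bounded_linear_functionals_def)

lemma pull_apply:
  assumes \<phi>: "\<phi> \<in> D"
  shows "blinfun_apply (pull \<phi>) x = \<phi> (T x)"
proof -
  obtain K where K: "\<And>x. \<bar>\<phi> (T x)\<bar> \<le> K * q x" using D_bound[OF \<phi>] T_closed by (auto simp: q_def)
  obtain K' where K': "\<And>x. q x \<le> K' * norm x" using q_bound by blast
  have "\<bar>\<phi> (T x)\<bar> \<le> norm x * (\<bar>K\<bar> * K')" for x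
  proof -
    have "K * q x \<le> \<bar>K\<bar> * q x" using seminorm_nonneg[OF seminorm_q] by (intro mult_right_mono) auto
    also have "\<dots> \<le> \<bar>K\<bar> * (K' * norm x)" using K' by (intro mult_left_mono) auto
    finally show ?thesis using K[of x] by (simp add: mult_ac)
  qed
  then have "bounded_linear (\<lambda>x. \<phi> (T x))"
    by (intro bounded_linear_intro) (auto simp: T_add T_scale D_add[OF \<phi>] D_scale[OF \<phi>] T_closed)
  then show ?thesis by (simp add: pull_def bounded_linear_Blinfun_apply)
qed

lemma pull_dominated:
  assumes \<phi>: "\<phi> \<in> D"
  shows "pull \<phi> \<in> dominated q"
proof -
  obtain K where "\<And>x. x \<in> ncarrier Y \<Longrightarrow> \<bar>\<phi> x\<bar> \<le> K * nnorm Y x" using D_bound[OF \<phi>] by blast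
  then have "\<bar>blinfun_apply (pull \<phi>) x\<bar> \<le> K * q x" for x
    using T_closed by (simp add: pull_apply[OF \<phi>] q_def)
  then show ?thesis unfolding dominated_def by blast
qed

text \<open>A dominated functional is constant on the fibres of \<open>T\<close>, since
  \<open>T x = T y\<close> means \<open>q (x - y) = 0\<close>; the preimage picked by
  \<open>SOME\<close> therefore does not matter.\<close>

lemma dominated_pull:
  assumes f: "f \<in> dominated q"
  shows "\<exists>\<phi>\<in>D. pull \<phi> = f"
proof -
  obtain R where R: "\<And>y. \<bar>blinfun_apply f y\<bar> \<le> R * q y" using f by (auto simp: dominated_def)
  define \<phi> where "\<phi> = (\<lambda>y\<in>ncarrier Y. blinfun_apply f (SOME x. T x = y))"
  have \<phi>T: "\<phi> (T x) = blinfun_apply f x" for x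
  proof -
    have "T (SOME x'. T x' = T x) = T x" by (rule someI) simp
    then have "q ((SOME x'. T x' = T x) - x) = 0" by (simp add: q_diff_eq_0)
    then have "blinfun_apply f (SOME x'. T x' = T x) = blinfun_apply f x"
      using R[of "(SOME x'. T x' = T x) - x"] by (simp add: blinfun.diff_right)
    then show ?thesis by (simp add: \<phi>_def T_closed)
  qed
  have "\<phi> \<in> D"
    unfolding carrier_dual bounded_linear_functionals_def
  proof (intro CollectI conjI ballI allI)
    show "\<phi> \<in> extensional (ncarrier Y)" by (simp add: \<phi>_def)
    show "\<phi> (nadd Y x y) = \<phi> x + \<phi> y" if xy: "x \<in> ncarrier Y" "y \<in> ncarrier Y" for x y
    proof -
      obtain a b where "x = T a" "y = T b" using T_surj xy by blast
      then show ?thesis by (simp add: T_add[symmetric] \<phi>T blinfun.add_right)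
    qed
    show "\<phi> (nscale Y r x) = r * \<phi> x" if x: "x \<in> ncarrier Y" for r x
    proof -
      obtain a where "x = T a" using T_surj x by blast
      then show ?thesis by (simp add: T_scale[symmetric] \<phi>T blinfun.scaleR_right)
    qed
    show "\<exists>K. \<forall>x\<in>ncarrier Y. \<bar>\<phi> x\<bar> \<le> K * nnorm Y x"
    proof (intro exI ballI)
      fix y assume "y \<in> ncarrier Y"
      then obtain x where "y = T x" using T_surj by blast
      then show "\<bar>\<phi> y\<bar> \<le> R * nnorm Y y" using R[of x] by (simp add: \<phi>T q_def)
    qed
  qed
  moreover from this have "pull \<phi> = f" by (intro blinfun_eqI) (simp add: pull_apply \<phi>T)
  ultimately show ?thesis by blast
qed

lemma nadd_dual: "nadd (dual Y) \<phi> \<psi> = (\<lambda>x\<in>ncarrier Y. \<phi> x + \<psi> x)"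
  and nscale_dual: "nscale (dual Y) r \<phi> = (\<lambda>x\<in>ncarrier Y. r * \<phi> x)"
  and nnorm_dual: "nnorm (dual Y) \<phi> = (SUP x \<in> {x \<in> ncarrier Y. nnorm Y x \<le> 1}. \<bar>\<phi> x\<bar>)"
  by (simp_all add: dual_def)

text \<open>Membership in \<open>D\<close> is obtained from \<open>dominated_pull\<close>, and
  extensionality identifies the functional found there with the sum in the dual.\<close>

lemma pull_nadd:
  assumes "\<phi> \<in> D" "\<psi> \<in> D"
  shows "nadd (dual Y) \<phi> \<psi> \<in> D" "pull (nadd (dual Y) \<phi> \<psi>) = pull \<phi> + pull \<psi>"
proof -
  obtain \<theta> where \<theta>: "\<theta> \<in> D" "pull \<theta> = pull \<phi> + pull \<psi>"
    using dominated_pull subspace_add[OF subspace_dominated[OF seminorm_q]] pull_dominated assms by metis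
  have "\<theta> (T x) = \<phi> (T x) + \<psi> (T x)" for x
    using arg_cong[OF \<theta>(2), of "\<lambda>f. blinfun_apply f x"] assms \<theta>(1) by (simp add: pull_apply blinfun.add_left)
  then have "\<theta> = nadd (dual Y) \<phi> \<psi>"
    unfolding nadd_dual using \<theta>(1) T_surj
    by (intro extensionalityI[of _ "ncarrier Y"]) (auto simp: carrier_dual bounded_linear_functionals_def dest: T_surj)
  then show "nadd (dual Y) \<phi> \<psi> \<in> D" "pull (nadd (dual Y) \<phi> \<psi>) = pull \<phi> + pull \<psi>" using \<theta> by auto
qed

lemma pull_nscale:
  assumes "\<phi> \<in> D"
  shows "nscale (dual Y) r \<phi> \<in> D" "pull (nscale (dual Y) r \<phi>) = r *\<^sub>R pull \<phi>"
proof -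
  obtain \<theta> where \<theta>: "\<theta> \<in> D" "pull \<theta> = r *\<^sub>R pull \<phi>"
    using dominated_pull subspace_scale[OF subspace_dominated[OF seminorm_q]] pull_dominated assms by metis
  have "\<theta> (T x) = r * \<phi> (T x)" for x
    using arg_cong[OF \<theta>(2), of "\<lambda>f. blinfun_apply f x"] assms \<theta>(1) by (simp add: pull_apply blinfun.scaleR_left)
  then have "\<theta> = nscale (dual Y) r \<phi>"
    unfolding nscale_dual using \<theta>(1) T_surj
    by (intro extensionalityI[of _ "ncarrier Y"]) (auto simp: carrier_dual bounded_linear_functionals_def dest: T_surj)
  then show "nscale (dual Y) r \<phi> \<in> D" "pull (nscale (dual Y) r \<phi>) = r *\<^sub>R pull \<phi>" using \<theta> by auto
qed

lemma dual_norm_bound: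
  assumes \<phi>: "\<phi> \<in> D"
  shows "\<bar>\<phi> (T x)\<bar> \<le> nnorm (dual Y) \<phi> * q x" "0 \<le> nnorm (dual Y) \<phi>"
proof -
  obtain K where K: "\<And>x. \<bar>\<phi> (T x)\<bar> \<le> K * q x" using D_bound[OF \<phi>] T_closed by (auto simp: q_def)
  have "\<bar>\<phi> y\<bar> \<le> \<bar>K\<bar>" if y: "y \<in> {x \<in> ncarrier Y. nnorm Y x \<le> 1}" for y
  proof -
    obtain x where x: "y = T x" using T_surj y by blast
    have "K * q x \<le> \<bar>K\<bar> * q x" using seminorm_nonneg[OF seminorm_q] by (intro mult_right_mono) auto
    also have "\<dots> \<le> \<bar>K\<bar> * 1" using y x by (intro mult_left_mono) (auto simp: q_def)
    finally show ?thesis using K[of x] x by simp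
  qed
  then have bdd: "bdd_above ((\<lambda>x. \<bar>\<phi> x\<bar>) ` {x \<in> ncarrier Y. nnorm Y x \<le> 1})" by (rule bdd_aboveI2)
  have up: "\<bar>\<phi> (T x)\<bar> \<le> nnorm (dual Y) \<phi>" if "q x \<le> 1" for x
    unfolding nnorm_dual using that bdd by (intro cSUP_upper) (auto simp: T_closed q_def)
  show "0 \<le> nnorm (dual Y) \<phi>" using up[of 0] seminorm_zero[OF seminorm_q] by simp
  show "\<bar>\<phi> (T x)\<bar> \<le> nnorm (dual Y) \<phi> * q x"
  proof (cases "q x = 0")
    case True
    then show ?thesis using K[of x] by simp
  next
    case False
    then have qx: "q x > 0" using seminorm_nonneg[OF seminorm_q, of x] by simp
    have "\<bar>\<phi> (T ((1 / q x) *\<^sub>R x))\<bar> \<le> nnorm (dual Y) \<phi>"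
      using qx by (intro up) (simp add: seminorm_scale[OF seminorm_q])
    then show ?thesis using qx by (simp add: T_scale D_scale[OF \<phi> T_closed] abs_mult field_simps)
  qed
qed

text \<open>The adjoint is bounded below, because the image of the ball of radius \<open>C\<close>
  covers the unit ball of \<open>Y\<close>.\<close>

lemma dual_norm_le_pull:
  assumes C: "0 \<le> C" "\<And>x. \<exists>w. norm w \<le> C * q x \<and> q (x - w) = 0" and \<phi>: "\<phi> \<in> D"
  shows "nnorm (dual Y) \<phi> \<le> C * norm (pull \<phi>)"
  unfolding nnorm_dual
proof (rule cSUP_least)
  have "T 0 \<in> {x \<in> ncarrier Y. nnorm Y x \<le> 1}"
    using seminorm_zero[OF seminorm_q] by (simp add: T_closed q_def)
  then show "{x \<in> ncarrier Y. nnorm Y x \<le> 1} \<noteq> {}" by blast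
  fix y assume y: "y \<in> {x \<in> ncarrier Y. nnorm Y x \<le> 1}"
  then obtain x where x: "y = T x" using T_surj by blast
  obtain w where w: "norm w \<le> C * q x" "q (x - w) = 0" using C(2) by blast
  have "\<bar>\<phi> y\<bar> = \<bar>blinfun_apply (pull \<phi>) w\<bar>" using w(2) by (simp add: x pull_apply[OF \<phi>] q_diff_eq_0)
  also have "\<dots> \<le> norm (pull \<phi>) * norm w" by (rule abs_blinfun_apply_le)
  also have "\<dots> \<le> norm (pull \<phi>) * C"
  proof (rule mult_left_mono)
    have "C * q x \<le> C * 1" using C(1) y by (intro mult_left_mono) (auto simp: x q_def)
    then show "norm w \<le> C" using w(1) by simp
  qed simp
  finally show "\<bar>\<phi> y\<bar> \<le> C * norm (pull \<phi>)" by (simp add: mult.commute)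
qed

lemma pull_norm_le:
  obtains K where "0 \<le> K" "\<And>\<phi>. \<phi> \<in> D \<Longrightarrow> norm (pull \<phi>) \<le> K * nnorm (dual Y) \<phi>"
proof -
  obtain K where K: "\<And>x. q x \<le> K * norm x" using q_bound by blast
  have "norm (pull \<phi>) \<le> \<bar>K\<bar> * nnorm (dual Y) \<phi>" if \<phi>: "\<phi> \<in> D" for \<phi>
  proof (rule norm_blinfun_bound)
    show "0 \<le> \<bar>K\<bar> * nnorm (dual Y) \<phi>" using dual_norm_bound(2)[OF \<phi>] by simp
    fix x :: 'a
    have "K * norm x \<le> \<bar>K\<bar> * norm x" by (intro mult_right_mono) auto
    then have "q x \<le> \<bar>K\<bar> * norm x" using K[of x] by simp
    then have "nnorm (dual Y) \<phi> * q x \<le> nnorm (dual Y) \<phi> * (\<bar>K\<bar> * norm x)"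
      using dual_norm_bound(2)[OF \<phi>] by (intro mult_left_mono)
    then show "norm (blinfun_apply (pull \<phi>) x) \<le> \<bar>K\<bar> * nnorm (dual Y) \<phi> * norm x"
      using dual_norm_bound(1)[OF \<phi>, of x] by (simp add: pull_apply[OF \<phi>] mult_ac)
  qed
  then show ?thesis by (intro that[of "\<bar>K\<bar>"]) auto
qed

section \<open>The bidual and quasireflexivity\<close>

text \<open>The second adjoint of \<open>T\<close>, restricted to \<open>D\<close> because elements
  of the bidual are extensional.\<close>

definition push :: "(('a \<Rightarrow>\<^sub>L real) \<Rightarrow>\<^sub>L real) \<Rightarrow> ('v \<Rightarrow> real) \<Rightarrow> real" where
  "push \<Psi> = (\<lambda>\<phi>\<in>D. blinfun_apply \<Psi> (pull \<phi>))"

lemma carrier_bidual: "E = bounded_linear_functionals (dual Y)"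
  by (simp add: dual_def[of "dual Y"])

lemma push_closed: "push \<Psi> \<in> E"
  unfolding carrier_bidual bounded_linear_functionals_def
proof (intro CollectI conjI ballI allI)
  show "push \<Psi> \<in> extensional D" by (simp add: push_def)
  show "push \<Psi> (nadd (dual Y) \<phi> \<psi>) = push \<Psi> \<phi> + push \<Psi> \<psi>" if "\<phi> \<in> D" "\<psi> \<in> D" for \<phi> \<psi>
    using that by (simp add: push_def pull_nadd blinfun.add_right)
  show "push \<Psi> (nscale (dual Y) r \<phi>) = r * push \<Psi> \<phi>" if "\<phi> \<in> D" for r \<phi>
    using that by (simp add: push_def pull_nscale blinfun.scaleR_right)
  obtain K where K: "0 \<le> K" "\<And>\<phi>. \<phi> \<in> D \<Longrightarrow> norm (pull \<phi>) \<le> K * nnorm (dual Y) \<phi>" using pull_norm_le by blast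
  show "\<exists>K. \<forall>\<phi>\<in>D. \<bar>push \<Psi> \<phi>\<bar> \<le> K * nnorm (dual Y) \<phi>"
  proof (intro exI ballI)
    fix \<phi> assume \<phi>: "\<phi> \<in> D"
    have "\<bar>blinfun_apply \<Psi> (pull \<phi>)\<bar> \<le> norm \<Psi> * norm (pull \<phi>)" by (rule abs_blinfun_apply_le)
    also have "\<dots> \<le> norm \<Psi> * (K * nnorm (dual Y) \<phi>)" using K(2)[OF \<phi>] by (intro mult_left_mono) auto
    finally show "\<bar>push \<Psi> \<phi>\<bar> \<le> (norm \<Psi> * K) * nnorm (dual Y) \<phi>" using \<phi> by (simp add: push_def mult.assoc)
  qed
qed

text \<open>The second adjoint is onto: \<open>pull\<close> is bounded below, so
  \<open>\<Phi>\<close> becomes a bounded functional on the range of \<open>pull\<close> and extends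
  by Hahn-Banach.\<close>

lemma bidual_extension:
  assumes sc: "seminorm_complete q" and \<Phi>: "\<Phi> \<in> E"
  shows "\<exists>\<Psi> :: ('a \<Rightarrow>\<^sub>L real) \<Rightarrow>\<^sub>L real. \<forall>\<phi>\<in>D. blinfun_apply \<Psi> (pull \<phi>) = \<Phi> \<phi>"
proof -
  obtain K where K: "\<And>x. q x \<le> K * norm x" using q_bound by blast
  obtain C where C: "C > 0" "\<And>x. \<exists>w. norm w \<le> C * q x \<and> q (x - w) = 0"
    using complete_seminorm_lifting[OF seminorm_q K sc] by blast
  have add: "\<And>\<phi> \<psi>. \<phi> \<in> D \<Longrightarrow> \<psi> \<in> D \<Longrightarrow> \<Phi> (nadd (dual Y) \<phi> \<psi>) = \<Phi> \<phi> + \<Phi> \<psi>"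
    and scale: "\<And>r \<phi>. \<phi> \<in> D \<Longrightarrow> \<Phi> (nscale (dual Y) r \<phi>) = r * \<Phi> \<phi>"
    using \<Phi> by (auto simp: carrier_bidual bounded_linear_functionals_def)
  obtain R where R: "\<And>\<phi>. \<phi> \<in> D \<Longrightarrow> \<bar>\<Phi> \<phi>\<bar> \<le> R * nnorm (dual Y) \<phi>"
    using \<Phi> unfolding carrier_bidual bounded_linear_functionals_def by blast
  let ?P = "\<lambda>f :: 'a \<Rightarrow>\<^sub>L real. (\<bar>R\<bar> * C) * norm f"
  have P: "seminorm ?P"
  proof (rule seminormI)
    show "?P (f + h) \<le> ?P f + ?P h" for f h
      unfolding distrib_left[symmetric] using C(1) norm_triangle_ineq by (intro mult_left_mono) auto
  qed simp
  let ?G = "{(pull \<phi>, \<Phi> \<phi>) | \<phi>. \<phi> \<in> D}"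
  have "\<exists>F. linear F \<and> (\<forall>(f, a)\<in>?G. F f = a) \<and> (\<forall>f. \<bar>F f\<bar> \<le> ?P f)"
  proof (rule Hahn_Banach_graph[OF P])
    show "subspace ?G"
    proof (rule subspaceI)
      obtain \<phi> where "\<phi> \<in> D"
        using dominated_pull[OF subspace_0[OF subspace_dominated[OF seminorm_q]]] by blast
      then have "(pull (nscale (dual Y) 0 \<phi>), \<Phi> (nscale (dual Y) 0 \<phi>)) \<in> ?G" using pull_nscale(1) by blast
      then show "0 \<in> ?G" using \<open>\<phi> \<in> D\<close> by (simp add: pull_nscale scale zero_prod_def)
      show "x + y \<in> ?G" if xy: "x \<in> ?G" "y \<in> ?G" for x y
      proof -
        obtain \<phi> \<psi> where "\<phi> \<in> D" "\<psi> \<in> D" "x = (pull \<phi>, \<Phi> \<phi>)" "y = (pull \<psi>, \<Phi> \<psi>)" using xy by blast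
        then have "x + y = (pull (nadd (dual Y) \<phi> \<psi>), \<Phi> (nadd (dual Y) \<phi> \<psi>))" "nadd (dual Y) \<phi> \<psi> \<in> D"
          by (simp_all add: pull_nadd add)
        then show ?thesis by blast
      qed
      show "r *\<^sub>R x \<in> ?G" if x: "x \<in> ?G" for r x
      proof -
        obtain \<phi> where "\<phi> \<in> D" "x = (pull \<phi>, \<Phi> \<phi>)" using x by blast
        then have "r *\<^sub>R x = (pull (nscale (dual Y) r \<phi>), \<Phi> (nscale (dual Y) r \<phi>))" "nscale (dual Y) r \<phi> \<in> D"
          by (simp_all add: pull_nscale scale)
        then show ?thesis by blast
      qed
    qed
    fix f a assume "(f, a) \<in> ?G"
    then obtain \<phi> where \<phi>: "\<phi> \<in> D" "f = pull \<phi>" "a = \<Phi> \<phi>" by blast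
    have "R * nnorm (dual Y) \<phi> \<le> \<bar>R\<bar> * nnorm (dual Y) \<phi>"
      using dual_norm_bound(2)[OF \<phi>(1)] by (intro mult_right_mono) auto
    also have "\<dots> \<le> \<bar>R\<bar> * (C * norm (pull \<phi>))"
      using dual_norm_le_pull[OF less_imp_le[OF C(1)] C(2) \<phi>(1)] by (intro mult_left_mono) auto
    finally show "a \<le> ?P f" using R[OF \<phi>(1)] \<phi> by (simp add: mult.assoc)
  qed
  then obtain F where F: "linear F" "\<forall>(f, a)\<in>?G. F f = a" "\<And>f. \<bar>F f\<bar> \<le> ?P f" by blast
  obtain \<Psi> where \<Psi>: "\<And>f. blinfun_apply \<Psi> f = F f"
    by (rule blinfun_of_linear[OF F(1,3)]) (use C(1) in auto)
  have "blinfun_apply \<Psi> (pull \<phi>) = \<Phi> \<phi>" if "\<phi> \<in> D" for \<phi>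
    using bspec[OF F(2), of "(pull \<phi>, \<Phi> \<phi>)"] that \<Psi> by auto
  then show ?thesis by blast
qed

lemma represented_iff:
  "\<Psi> \<in> represented q \<longleftrightarrow> (\<exists>y\<in>ncarrier Y. \<forall>\<phi>\<in>D. blinfun_apply \<Psi> (pull \<phi>) = \<phi> y)"
proof
  assume "\<Psi> \<in> represented q"
  then obtain x where "\<forall>f\<in>dominated q. blinfun_apply \<Psi> f = blinfun_apply f x" by (auto simp: represented_def)
  then have "\<forall>\<phi>\<in>D. blinfun_apply \<Psi> (pull \<phi>) = \<phi> (T x)" using pull_dominated pull_apply by simp
  then show "\<exists>y\<in>ncarrier Y. \<forall>\<phi>\<in>D. blinfun_apply \<Psi> (pull \<phi>) = \<phi> y" using T_closed by blast
next
  assume "\<exists>y\<in>ncarrier Y. \<forall>\<phi>\<in>D. blinfun_apply \<Psi> (pull \<phi>) = \<phi> y"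
  then obtain x where x: "\<forall>\<phi>\<in>D. blinfun_apply \<Psi> (pull \<phi>) = \<phi> (T x)" using T_surj by blast
  have "blinfun_apply \<Psi> f = blinfun_apply f x" if "f \<in> dominated q" for f
    using dominated_pull[OF that] x pull_apply by auto
  then show "\<Psi> \<in> represented q" by (auto simp: represented_def)
qed

text \<open>Finite complements are carried to the bidual of the domain by
  \<open>bidual_extension\<close> and back by \<open>push\<close>, while
  \<open>represented_iff\<close> matches the subspaces.\<close>

lemma quasireflexive_iff:
  assumes sc: "seminorm_complete q"
  shows "quasireflexive Y \<longleftrightarrow> finite_corank q"
proof
  assume "quasireflexive Y"
  then obtain B where B: "finite B" "B \<subseteq> E"
    and rep: "\<And>\<Phi>. \<Phi> \<in> E \<Longrightarrow> \<exists>w\<in>canonical_embedding Y ` ncarrier Y. \<exists>c. \<forall>\<phi>\<in>D. \<Phi> \<phi> = w \<phi> + (\<Sum>b\<in>B. c b * b \<phi>)"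
    unfolding quasireflexive_def finite_codimension_in_dual_def by blast
  have "\<forall>b\<in>B. \<exists>\<Psi> :: ('a \<Rightarrow>\<^sub>L real) \<Rightarrow>\<^sub>L real. \<forall>\<phi>\<in>D. blinfun_apply \<Psi> (pull \<phi>) = b \<phi>"
    using bidual_extension[OF sc] B(2) by blast
  then obtain h :: "(('v \<Rightarrow> real) \<Rightarrow> real) \<Rightarrow> ('a \<Rightarrow>\<^sub>L real) \<Rightarrow>\<^sub>L real"
    where h: "\<And>b \<phi>. \<lbrakk>b \<in> B; \<phi> \<in> D\<rbrakk> \<Longrightarrow> blinfun_apply (h b) (pull \<phi>) = b \<phi>" by metis
  have "\<exists>b\<in>span (h ` B). \<Psi> - b \<in> represented q" for \<Psi>
  proof -
    obtain w c where w: "w \<in> canonical_embedding Y ` ncarrier Y"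
      and c: "\<forall>\<phi>\<in>D. push \<Psi> \<phi> = w \<phi> + (\<Sum>b\<in>B. c b * b \<phi>)"
      using rep[OF push_closed] by blast
    obtain y where y: "y \<in> ncarrier Y" "w = canonical_embedding Y y" using w by blast
    let ?b = "\<Sum>b\<in>B. c b *\<^sub>R h b"
    have "blinfun_apply (\<Psi> - ?b) (pull \<phi>) = \<phi> y" if \<phi>: "\<phi> \<in> D" for \<phi>
    proof -
      have "(\<Sum>b\<in>B. c b * blinfun_apply (h b) (pull \<phi>)) = (\<Sum>b\<in>B. c b * b \<phi>)"
        using h \<phi> by (intro sum.cong) auto
      then show ?thesis using c \<phi>
        by (simp add: blinfun.diff_left blinfun.sum_left blinfun.scaleR_left push_def y(2) canonical_embedding_def)
    qed
    then have "\<Psi> - ?b \<in> represented q" unfolding represented_iff using y(1) by blast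
    moreover have "?b \<in> span (h ` B)" by (intro span_sum span_scale span_base) auto
    ultimately show ?thesis by blast
  qed
  then show "finite_corank q" unfolding finite_corank_def using B(1) by blast
next
  assume "finite_corank q"
  then obtain B where B: "finite B" "\<And>\<Psi>. \<exists>b\<in>span B. \<Psi> - b \<in> represented q" by (auto simp: finite_corank_def)
  have "\<exists>w\<in>canonical_embedding Y ` ncarrier Y. \<exists>c. \<forall>\<phi>\<in>D. \<Phi> \<phi> = w \<phi> + (\<Sum>b\<in>push ` B. c b * b \<phi>)"
    if \<Phi>: "\<Phi> \<in> E" for \<Phi>
  proof -
    obtain \<Psi> :: "('a \<Rightarrow>\<^sub>L real) \<Rightarrow>\<^sub>L real" where \<Psi>: "\<And>\<phi>. \<phi> \<in> D \<Longrightarrow> blinfun_apply \<Psi> (pull \<phi>) = \<Phi> \<phi>"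
      using bidual_extension[OF sc \<Phi>] by blast
    obtain b where b: "b \<in> span B" "\<Psi> - b \<in> represented q" using B(2) by blast
    obtain u where u: "b = (\<Sum>v\<in>B. u v *\<^sub>R v)" using b(1) span_finite[OF B(1)] by auto
    obtain y where y: "y \<in> ncarrier Y" "\<forall>\<phi>\<in>D. blinfun_apply (\<Psi> - b) (pull \<phi>) = \<phi> y"
      using b(2) unfolding represented_iff by blast
    \<comment> \<open>\<open>push\<close> may identify elements of \<open>B\<close>, so their
      coefficients are added up.\<close>
    define c where "c b' = (\<Sum>v\<in>{v \<in> B. push v = b'}. u v)" for b'
    have "\<Phi> \<phi> = canonical_embedding Y y \<phi> + (\<Sum>b\<in>push ` B. c b * b \<phi>)" if \<phi>: "\<phi> \<in> D" for \<phi>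
    proof -
      have "\<Phi> \<phi> = \<phi> y + (\<Sum>v\<in>B. u v * push v \<phi>)"
        using bspec[OF y(2) \<phi>] \<Psi>[OF \<phi>] \<phi>
        by (simp add: u blinfun.diff_left blinfun.sum_left blinfun.scaleR_left push_def)
      also have "(\<Sum>v\<in>B. u v * push v \<phi>) = (\<Sum>b'\<in>push ` B. \<Sum>v\<in>{v \<in> B. push v = b'}. u v * push v \<phi>)"
        by (rule sum.image_gen[OF B(1)])
      also have "\<dots> = (\<Sum>b'\<in>push ` B. c b' * b' \<phi>)"
        unfolding c_def sum_distrib_right by (intro sum.cong) auto
      finally show ?thesis using \<phi> by (simp add: canonical_embedding_def)
    qed
    then show ?thesis using y(1) by blast
  qed
  moreover have "push ` B \<subseteq> E" using push_closed by blast
  ultimately show "quasireflexive Y"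
    unfolding quasireflexive_def finite_codimension_in_dual_def using B(1) by blast
qed

end

lemma TNNS_if_strictly_singular_surjection:
  fixes Y :: "'v nspace" and T :: "'a::banach \<Rightarrow> 'v"
  assumes sep: "separable_space (euclidean :: 'a topology)" and inf: "infinite_dimensional (UNIV :: 'a set)"
    and Y: "banach_space_on Y" "\<not> quasireflexive Y" and T: "strictly_singular Y T" "range T = ncarrier Y"
  shows "TNNS TYPE('a)"
proof -
  interpret onto_operator Y T
    using Y T by (auto simp: onto_operator_def onto_operator_axioms_def banach_space_on_def strictly_singular_def)
  obtain d :: "nat \<Rightarrow> 'a" where d: "\<And>x e. e > 0 \<Longrightarrow> \<exists>n. norm (x - d n) < e"
    using separable_dense_sequence[OF sep] by blast
  obtain K where K: "\<And>x. q x \<le> K * norm x" using q_bound by blast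
  have sc: "seminorm_complete q" using Y(1) by (simp add: banach_space_on_iff)
  show ?thesis
    using TNNS_if_quotient_seminorm[OF seminorm_q K sc _ _ inf d] T(1) Y(2) strictly_singular_iff
      quasireflexive_iff[OF sc] by blast
qed

section \<open>The quotient by the kernel of a seminorm\<close>

definition coset :: "('a::real_vector \<Rightarrow> real) \<Rightarrow> 'a \<Rightarrow> 'a set" where
  "coset q x = {y. q (x - y) = 0}"

definition representative :: "'a set \<Rightarrow> 'a" where
  "representative A = (SOME a. a \<in> A)"

text \<open>The norm is \<open>q\<close> itself. On cosets the operations do not depend on the
  chosen representatives, because \<open>q\<close> does not see the difference of two of
  them.\<close>

definition coset_space :: "('a::real_vector \<Rightarrow> real) \<Rightarrow> 'a set nspace" where
  "coset_space q = \<lparr> ncarrier = range (coset q), nzero = coset q 0,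
     nadd = (\<lambda>A B. coset q (representative A + representative B)),
     nscale = (\<lambda>r A. coset q (r *\<^sub>R representative A)),
     nnorm = (\<lambda>A. q (representative A)) \<rparr>"

context
  fixes q :: "'a::real_vector \<Rightarrow> real"
  assumes q: "seminorm q"
begin

lemma coset_eq_iff: "coset q x = coset q y \<longleftrightarrow> q (x - y) = 0"
proof
  assume "coset q x = coset q y"
  moreover have "y \<in> coset q y" using seminorm_zero[OF q] by (simp add: coset_def)
  ultimately have "y \<in> coset q x" by simp
  then show "q (x - y) = 0" by (simp add: coset_def)
next
  assume xy: "q (x - y) = 0"
  have "q (x - z) = q (y - z)" for z
    using seminorm_triangle[OF q, of x z y] seminorm_triangle[OF q, of y z x]
      seminorm_commute[OF q, of x y] xy by linarith
  then show "coset q x = coset q y" by (simp add: coset_def)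
qed

lemma representative_coset: "q (x - representative (coset q x)) = 0"
proof -
  have "x \<in> coset q x" using seminorm_zero[OF q] by (simp add: coset_def)
  then have "representative (coset q x) \<in> coset q x" unfolding representative_def by (rule someI)
  then show ?thesis by (simp add: coset_def)
qed

lemma nadd_coset: "nadd (coset_space q) (coset q x) (coset q y) = coset q (x + y)"
proof -
  let ?x = "representative (coset q x)" and ?y = "representative (coset q y)"
  have "q ((?x + ?y) - (x + y)) \<le> q (?x - x) + q (?y - y)"
    using seminorm_add[OF q, of "?x - x" "?y - y"] by (simp add: algebra_simps)
  then have "q ((?x + ?y) - (x + y)) = 0"
    using representative_coset[of x] representative_coset[of y] seminorm_nonneg[OF q, of "(?x + ?y) - (x + y)"]
    by (simp add: seminorm_commute[OF q, of ?x] seminorm_commute[OF q, of ?y])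
  then show ?thesis by (simp add: coset_space_def coset_eq_iff)
qed

lemma nscale_coset: "nscale (coset_space q) r (coset q x) = coset q (r *\<^sub>R x)"
proof -
  let ?x = "representative (coset q x)"
  have "q (r *\<^sub>R ?x - r *\<^sub>R x) = \<bar>r\<bar> * q (?x - x)"
    by (simp add: scaleR_diff_right[symmetric] seminorm_scale[OF q] del: scaleR_diff_right)
  then have "q (r *\<^sub>R ?x - r *\<^sub>R x) = 0"
    using representative_coset[of x] by (simp add: seminorm_commute[OF q, of ?x])
  then show ?thesis by (simp add: coset_space_def coset_eq_iff)
qed

lemma nnorm_coset: "nnorm (coset_space q) (coset q x) = q x"
proof -
  let ?x = "representative (coset q x)"
  have "q ?x = q x"
    using seminorm_le_shift[OF q, of ?x x] seminorm_le_shift[OF q, of x ?x] representative_coset[of x]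
    by (simp add: seminorm_commute[OF q, of ?x])
  then show ?thesis by (simp add: coset_space_def)
qed

lemma carrier_coset_space: "ncarrier (coset_space q) = range (coset q)"
  and nzero_coset_space: "nzero (coset_space q) = coset q 0"
  by (simp_all add: coset_space_def)

lemma normed_space_on_coset_space: "normed_space_on (coset_space q)"
proof -
  note ops = carrier_coset_space nzero_coset_space nadd_coset nscale_coset nnorm_coset
  show ?thesis
  proof
    show "(nnorm (coset_space q) A = 0) = (A = nzero (coset_space q))" if A: "A \<in> ncarrier (coset_space q)" for A
    proof -
      obtain x where "A = coset q x" using A by (auto simp: ops)
      then show ?thesis by (simp add: ops coset_eq_iff)
    qed
  qed (auto simp: ops seminorm_nonneg[OF q] seminorm_add[OF q] seminorm_scale[OF q] algebra_simps)
qed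

end

lemma strictly_singular_surjection_if_TNNS:
  assumes sep: "separable_space (euclidean :: 'a::banach topology)"
    and inf: "infinite_dimensional (UNIV :: 'a set)" and TNNS: "TNNS TYPE('a)"
  shows "\<exists>(Y :: 'a set nspace) (T :: 'a \<Rightarrow> 'a set).
     banach_space_on Y \<and> \<not> quasireflexive Y \<and> strictly_singular Y T \<and> range T = ncarrier Y"
proof -
  obtain M :: "('a \<Rightarrow>\<^sub>L real) set" where M: "total_subspace M" "nowhere_norming M"
    using TNNS by (auto simp: TNNS_def)
  \<comment> \<open>The space is not zero, so a total subspace is nonzero and the sphere in
    \<open>norming_over\<close> is nonempty.\<close>
  have "M \<noteq> {0}"
  proof
    assume "M = {0}"
    then have "x \<in> span {}" for x :: 'a using M(1) by (auto simp: total_subspace_def)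
    then have "(UNIV :: 'a set) \<subseteq> span {}" by (rule subsetI)
    then show False using inf unfolding infinite_dimensional_def by blast
  qed
  then have nd: "nowhere_dominating (dual_seminorm M)"
    using M nowhere_norming_iff[of M] by (simp add: total_subspace_def)
  obtain d :: "nat \<Rightarrow> 'a" where d: "\<And>x e. e > 0 \<Longrightarrow> \<exists>n. norm (x - d n) < e"
    using separable_dense_sequence[OF sep] by blast
  obtain p :: "'a \<Rightarrow> real" and C where p: "seminorm p" "\<And>x. p x \<le> norm x" "nowhere_dominating p"
    "\<And>x. \<exists>w. norm w \<le> C * p x \<and> p (x - w) = 0" "\<not> finite_corank p"
    using quotient_seminorm_exists[OF M(1) nd inf d] by metis
  have p1: "p x \<le> 1 * norm x" for x using p(2) by simp
  have sc: "seminorm_complete p" by (rule lifting_imp_complete[OF p(1) p1 p(4)])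
  interpret onto_operator "coset_space p" "coset p"
  proof (intro onto_operator.intro onto_operator_axioms.intro)
    show "normed_space_on (coset_space p)" by (rule normed_space_on_coset_space[OF p(1)])
    show "bounded_operator (coset_space p) (coset p)"
      unfolding bounded_operator_def
      using p1 by (auto simp: carrier_coset_space[OF p(1)] nadd_coset[OF p(1)] nscale_coset[OF p(1)] nnorm_coset[OF p(1)]
          intro!: exI[of _ 1])
  qed (simp add: carrier_coset_space[OF p(1)])
  have qp: "q = p" by (rule ext) (simp add: q_def nnorm_coset[OF p(1)])
  have "banach_space_on (coset_space p)" "strictly_singular (coset_space p) (coset p)"
    "\<not> quasireflexive (coset_space p)"
    using sc p(3,5) banach_space_on_iff strictly_singular_iff quasireflexive_iff unfolding qp by simp_all
  then show ?thesis using onto by blast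
qed

text \<open>The space built from \<open>TNNS\<close> has cosets as points, hence the type
  \<open>'a set\<close>; the second conjunct lets the points of \<open>Y\<close> have any type. In
  finite dimension the whole dual is total and vacuously nowhere norming while every image is
  quasireflexive, which is why that case is excluded.\<close>

theorem theorem2p1:
  assumes "separable_space (euclidean :: 'a::banach topology)"
    and "infinite_dimensional (UNIV :: 'a set)"
  shows "(TNNS TYPE('a) \<longleftrightarrow>
            (\<exists>(Y :: 'a set nspace) (T :: 'a \<Rightarrow> 'a set).
               banach_space_on Y \<and> \<not> quasireflexive Y \<and>
               strictly_singular Y T \<and> range T = ncarrier Y))
       \<and> ((\<exists>(Y :: 'b nspace) (T :: 'a \<Rightarrow> 'b).
               banach_space_on Y \<and> \<not> quasireflexive Y \<and>
               strictly_singular Y T \<and> range T = ncarrier Y) \<longrightarrow> TNNS TYPE('a))"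
proof (intro conjI iffI impI)
  assume "TNNS TYPE('a)"
  then show "\<exists>(Y :: 'a set nspace) (T :: 'a \<Rightarrow> 'a set).
      banach_space_on Y \<and> \<not> quasireflexive Y \<and> strictly_singular Y T \<and> range T = ncarrier Y"
    by (rule strictly_singular_surjection_if_TNNS[OF assms])
qed (elim exE conjE, rule TNNS_if_strictly_singular_surjection[OF assms], assumption+)+

end
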